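(* Let $(M,g)$ be an $N$-dimensional spherically symmetric Riemannian manifold ($N\ge2$) with radius $R\in(0,\infty)$ and warping function $\phi$. Let $p\ge1$ be real and $k\ge1$ an integer. Assume that the limit $\lim_{r\to R}\phi^{(j)}(r)\in(0,\infty)$ exists for every $j\ge0$. Suppose that $N>kp$ and $\theta\ge0$, and put $p^*_\theta:=\frac{(\theta+N)p}{N-kp}$. If $1\le q<p^*_\theta$, then the embedding $W^{k,p}_{\mathrm{rad}}(M)\hookrightarrow L^q_{\phi^\theta}(M)$ is compact.
   Context: A spherically symmetric Riemannian manifold $(M,g)$ of dimension $N\ge2$ is one such that (1) a single chart covers $M$, with image a ball $B_R=\{x\in\mathbb R^N:|x|<R\}$, $R\in(0,\infty]$; the point $o\in M$ corresponding to $0$ is the origin; (2) in polar coordinates $(r,\theta)$ of this chart, $g=\mathrm dr^2+\phi^2(r)\widetilde g$ where $\widetilde g$ is the standard metric of $\mathbb S^{N-1}$ and $\phi$ (the warping function) is a nonnegative smooth function on $[0,R)$, positive on $(0,R)$, with $\phi'(0)=1$ and $\phi^{(i)}(0)=0$ for all even $i\ge0$. One identifies $M=B_R$ and $M\setminus\{o\}=(0,R)\times\mathbb S^{N-1}$. A function $u\colon M\to\mathbb R$ is radial if there is $v\colon(0,R)\to\mathbb R$ with $u(x)=v(r)$ for all $x=(r,\theta)\in M\setminus\{o\}$. $\nabla^j u$ is the $j$-th covariant derivative ($\nabla^0u=u$) and $|\nabla^j u|_g$ its pointwise tensor norm induced by $g$. $W^{k,p}(M)$ is the completion of $\{u\in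 C^\infty(M):\int_M|\nabla^ju|_g^p\,\mathrm dV_g<\infty,\ j=0,\ldots,k\}$ under $\|u\|_{W^{k,p}(M)}=\sum_{j=0}^k(\int_M|\nabla^ju|_g^p\,\mathrm dV_g)^{1/p}$, regarded as a subspace of $L^p(M)$. $W^{k,p}_{\mathrm{rad}}(M)$ is the subspace of radial functions. $L^q_{\phi^\theta}(M)$ is the space of measurable $u\colon M\to\mathbb R$ with $\|u\|_{L^q_{\phi^\theta}(M)}=\big(\int_M|u(x)|^q\phi(r)^\theta\,\mathrm dV_g\big)^{1/q}<\infty$, where $x=(r,\cdot)$ in polar coordinates (the real exponent $\theta$ here is unrelated to the angular variable). *)

theory Defs
  imports "HOL-Analysis.Analysis"
begin

(* A Riemannian manifold covered by a single chart is given by its chart image U, an open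
   subset of real^'n, and by the Gram matrices g x of the metric in the chart coordinates. *)

section \<open>Smoothness\<close>

(* One-sided at end points of S, as needed for a warping function on {0..<R}. *)
primrec deriv_within :: "real set \<Rightarrow> nat \<Rightarrow> (real \<Rightarrow> real) \<Rightarrow> real \<Rightarrow> real" where
  "deriv_within S 0 f = f"
| "deriv_within S (Suc j) f = (\<lambda>r. vector_derivative (deriv_within S j f) (at r within S))"

definition smooth_within :: "real set \<Rightarrow> (real \<Rightarrow> real) \<Rightarrow> bool" where
  "smooth_within S f \<longleftrightarrow> (\<forall>j. \<forall>r\<in>S. deriv_within S j f differentiable (at r within S))"

definition partial :: "'n::finite \<Rightarrow> (real^'n \<Rightarrow> real) \<Rightarrow> real^'n \<Rightarrow> real" where
  "partial i f x = frechet_derivative f (at x) (axis i 1)"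

(* For open U this is C^\<infinity>: differentiability of all iterated partial derivatives
   makes all of them continuous. *)
definition smooth_on :: "(real^'n::finite) set \<Rightarrow> (real^'n \<Rightarrow> real) \<Rightarrow> bool" where
  "smooth_on U f \<longleftrightarrow> (\<forall>is. \<forall>x\<in>U. foldr partial is f differentiable (at x))"

section \<open>Covariant derivatives and volume of a metric in a chart\<close>

definition christoffel ::
  "(real^'n::finite \<Rightarrow> real^'n^'n) \<Rightarrow> 'n \<Rightarrow> 'n \<Rightarrow> 'n \<Rightarrow> real^'n \<Rightarrow> real" where
  "christoffel g l i j x =
     (\<Sum>m\<in>UNIV. matrix_inv (g x) $ l $ m *
        (partial i (\<lambda>y. g y $ j $ m) x + partial j (\<lambda>y. g y $ i $ m) x
          - partial m (\<lambda>y. g y $ i $ j) x)) / 2"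

(* A covariant tensor field of order j is given by its components T [i1,...,ij] x in the
   coordinate frame; values on lists of any other length are irrelevant.
   The index of differentiation is put first. *)
fun cov_deriv ::
  "(real^'n::finite \<Rightarrow> real^'n^'n) \<Rightarrow> ('n list \<Rightarrow> real^'n \<Rightarrow> real) \<Rightarrow> 'n list \<Rightarrow> real^'n \<Rightarrow> real"
where
  "cov_deriv g T [] x = 0"
| "cov_deriv g T (i # is) x =
     partial i (T is) x
       - (\<Sum>s<length is. \<Sum>m\<in>UNIV. christoffel g m i (is ! s) x * T (is[s := m]) x)"

definition nabla ::
  "(real^'n::finite \<Rightarrow> real^'n^'n) \<Rightarrow> nat \<Rightarrow> (real^'n \<Rightarrow> real) \<Rightarrow> 'n list \<Rightarrow> real^'n \<Rightarrow> real"
where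
  "nabla g j u = (cov_deriv g ^^ j) (\<lambda>_. u)"

definition tensor_norm ::
  "(real^'n::finite \<Rightarrow> real^'n^'n) \<Rightarrow> nat \<Rightarrow> ('n list \<Rightarrow> real^'n \<Rightarrow> real) \<Rightarrow> real^'n \<Rightarrow> real"
where
  "tensor_norm g j T x =
     sqrt (\<Sum>is\<in>{is. length is = j}. \<Sum>ls\<in>{ls. length ls = j}.
             (\<Prod>s<j. matrix_inv (g x) $ (is ! s) $ (ls ! s)) * T is x * T ls x)"

definition vol :: "(real^'n::finite) set \<Rightarrow> (real^'n \<Rightarrow> real^'n^'n) \<Rightarrow> (real^'n) measure" where
  "vol U g = density (lebesgue_on U) (\<lambda>x. ennreal (sqrt (det (g x))))"

section \<open>Lebesgue and Sobolev spaces\<close>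

(* Functions are not identified up to null sets, so the norms below are seminorms on sets of
   representatives. *)

definition lp_space :: "'a measure \<Rightarrow> real \<Rightarrow> ('a \<Rightarrow> real) set" where
  "lp_space M p = {u \<in> borel_measurable M. integrable M (\<lambda>x. \<bar>u x\<bar> powr p)}"

definition lp_norm :: "'a measure \<Rightarrow> real \<Rightarrow> ('a \<Rightarrow> real) \<Rightarrow> real" where
  "lp_norm M p u = (\<integral>x. \<bar>u x\<bar> powr p \<partial>M) powr (1 / p)"

definition smooth_sobolev ::
  "(real^'n::finite) set \<Rightarrow> (real^'n \<Rightarrow> real^'n^'n) \<Rightarrow> nat \<Rightarrow> real \<Rightarrow> (real^'n \<Rightarrow> real) set" where
  "smooth_sobolev U g k p =
     {u. smooth_on U u \<and> (\<forall>j\<le>k. tensor_norm g j (nabla g j u) \<in> lp_space (vol U g) p)}"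

definition smooth_sobolev_norm ::
  "(real^'n::finite) set \<Rightarrow> (real^'n \<Rightarrow> real^'n^'n) \<Rightarrow> nat \<Rightarrow> real \<Rightarrow> (real^'n \<Rightarrow> real) \<Rightarrow> real" where
  "smooth_sobolev_norm U g k p u =
     (\<Sum>j\<le>k. lp_norm (vol U g) p (tensor_norm g j (nabla g j u)))"

(* The Cauchy sequence us represents an element of the completion of smooth_sobolev, and u is
   the element of L^p with which it is identified. *)
definition sobolev_represents ::
  "(real^'n::finite) set \<Rightarrow> (real^'n \<Rightarrow> real^'n^'n) \<Rightarrow> nat \<Rightarrow> real \<Rightarrow>
   (nat \<Rightarrow> real^'n \<Rightarrow> real) \<Rightarrow> (real^'n \<Rightarrow> real) \<Rightarrow> bool" where
  "sobolev_represents U g k p us u \<longleftrightarrow>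
     (\<forall>n. us n \<in> smooth_sobolev U g k p) \<and>
     (\<forall>e>0. \<exists>n0. \<forall>m\<ge>n0. \<forall>n\<ge>n0. smooth_sobolev_norm U g k p (\<lambda>x. us m x - us n x) < e) \<and>
     u \<in> lp_space (vol U g) p \<and>
     (\<lambda>n. lp_norm (vol U g) p (\<lambda>x. us n x - u x)) \<longlonglongrightarrow> 0"

definition sobolev ::
  "(real^'n::finite) set \<Rightarrow> (real^'n \<Rightarrow> real^'n^'n) \<Rightarrow> nat \<Rightarrow> real \<Rightarrow> (real^'n \<Rightarrow> real) set" where
  "sobolev U g k p = {u. \<exists>us. sobolev_represents U g k p us u}"

(* The norm of the completion: the limit of the norms along a representing Cauchy sequence.
   For a smooth metric this limit is the same for all us representing u (covariant
   differentiation is closable in L^p), so the infimum is over one value. *)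
definition sobolev_norm ::
  "(real^'n::finite) set \<Rightarrow> (real^'n \<Rightarrow> real^'n^'n) \<Rightarrow> nat \<Rightarrow> real \<Rightarrow> (real^'n \<Rightarrow> real) \<Rightarrow> real" where
  "sobolev_norm U g k p u =
     Inf {l. \<exists>us. sobolev_represents U g k p us u \<and>
                  (\<lambda>n. smooth_sobolev_norm U g k p (us n)) \<longlonglongrightarrow> l}"

section \<open>Spherically symmetric manifolds\<close>

definition warping_function :: "real \<Rightarrow> (real \<Rightarrow> real) \<Rightarrow> bool" where
  "warping_function R \<phi> \<longleftrightarrow>
     smooth_within {0..<R} \<phi> \<and>
     (\<forall>r\<in>{0..<R}. 0 \<le> \<phi> r) \<and> (\<forall>r\<in>{0<..<R}. 0 < \<phi> r) \<and>
     deriv_within {0..<R} 1 \<phi> 0 = 1 \<and>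
     (\<forall>i. even i \<longrightarrow> deriv_within {0..<R} i \<phi> 0 = 0)"

(* dr^2 + \<phi>(r)^2 * (round metric of the unit sphere) in the Cartesian coordinates of the
   chart: r is the norm, the angular variable is sgn x = x /R norm x, and the round metric is
   induced by the inner product. At the origin the identity matrix is the continuous extension,
   since the derivative of \<phi> at 0 is 1. *)
definition warped_metric :: "(real \<Rightarrow> real) \<Rightarrow> real^'n::finite \<Rightarrow> real^'n^'n" where
  "warped_metric \<phi> x =
     (if x = 0 then mat 1
      else (\<chi> i j. frechet_derivative norm (at x) (axis i 1) * frechet_derivative norm (at x) (axis j 1)
              + (\<phi> (norm x))\<^sup>2 *
                (frechet_derivative sgn (at x) (axis i 1) \<bullet> frechet_derivative sgn (at x) (axis j 1))))"

definition radial :: "real \<Rightarrow> ('a::real_normed_vector \<Rightarrow> real) \<Rightarrow> bool" where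
  "radial R u \<longleftrightarrow> (\<exists>v. \<forall>x\<in>ball 0 R - {0}. u x = v (norm x))"

(* Since the elements of sobolev are arbitrary representatives, radiality is required only of
   some representative of the same class. *)
definition sobolev_rad :: "real \<Rightarrow> (real \<Rightarrow> real) \<Rightarrow> nat \<Rightarrow> real \<Rightarrow> (real^'n::finite \<Rightarrow> real) set" where
  "sobolev_rad R \<phi> k p =
     {u \<in> sobolev (ball 0 R) (warped_metric \<phi>) k p.
        \<exists>w. radial R w \<and> (AE x in vol (ball 0 R) (warped_metric \<phi>). u x = w x)}"

definition weighted_space :: "real \<Rightarrow> (real \<Rightarrow> real) \<Rightarrow> real \<Rightarrow> real \<Rightarrow> (real^'n::finite \<Rightarrow> real) set" where
  "weighted_space R \<phi> \<theta> q =
     {u \<in> borel_measurable (vol (ball 0 R) (warped_metric \<phi>)).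
        integrable (vol (ball 0 R) (warped_metric \<phi>)) (\<lambda>x. \<bar>u x\<bar> powr q * \<phi> (norm x) powr \<theta>)}"

definition weighted_norm :: "real \<Rightarrow> (real \<Rightarrow> real) \<Rightarrow> real \<Rightarrow> real \<Rightarrow> (real^'n::finite \<Rightarrow> real) \<Rightarrow> real" where
  "weighted_norm R \<phi> \<theta> q u =
     (\<integral>x. \<bar>u x\<bar> powr q * \<phi> (norm x) powr \<theta> \<partial>vol (ball 0 R) (warped_metric \<phi>)) powr (1 / q)"

section \<open>Compact embeddings\<close>

definition compact_embedding ::
  "('a \<Rightarrow> real) set \<Rightarrow> (('a \<Rightarrow> real) \<Rightarrow> real) \<Rightarrow> ('a \<Rightarrow> real) set \<Rightarrow> (('a \<Rightarrow> real) \<Rightarrow> real) \<Rightarrow> bool"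
where
  "compact_embedding X nX Y nY \<longleftrightarrow>
     X \<subseteq> Y \<and> (\<exists>C. \<forall>u\<in>X. nY u \<le> C * nX u) \<and>
     (\<forall>us B. (\<forall>n::nat. us n \<in> X \<and> nX (us n) \<le> B) \<longrightarrow>
        (\<exists>s v. strict_mono (s :: nat \<Rightarrow> nat) \<and> v \<in> Y \<and>
               (\<lambda>n. nY (\<lambda>x. us (s n) x - v x)) \<longlonglongrightarrow> 0))"

end

theory Submission
  imports Defs "HOL-Probability.Helly_Selection"
begin

text \<open>
  The rays through the origin are unit speed geodesics, so \<open>\<partial>\<^sub>r\<^sup>j u\<close> is \<open>\<nabla>\<^sup>j u\<close> evaluated on the unit
  radial vector and \<open>\<bar>\<partial>\<^sub>r\<^sup>j u\<bar> \<le> \<bar>\<nabla>\<^sup>j u\<bar>\<close>. Since \<open>\<phi>(r)/r\<close> and the volume density lie between positive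
  constants, everything reduces to \<open>L\<^sup>p\<close> bounds of \<open>\<partial>\<^sub>r\<^sup>j u\<close> on a Euclidean ball of dimension \<open>N\<close>.
  Integrating \<open>k\<close> times along rays from the boundary yields the radial lemma
  \<open>\<integral>\<bar>u(r\<omega>)\<bar> d\<omega> \<le> C \<parallel>u\<parallel> r powr (k - N/p)\<close>, which needs no radiality of \<open>u\<close> and hence applies to the
  smooth approximants of an element of the completion; by Fatou's lemma a radial limit \<open>v\<close> satisfies
  \<open>\<bar>v(r)\<bar> \<le> C \<parallel>v\<parallel> r powr (k - N/p)\<close>. The \<open>q\<close>-th power of this bound is integrable against
  \<open>\<phi>\<^sup>\<theta> dV\<close> exactly if \<open>q\<close> is subcritical. For compactness, the functions \<open>r\<^sup>N \<integral>u\<^sub>m(r\<omega>) d\<omega>\<close> have uniformly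
  bounded variation, so a subsequence converges almost everywhere by Helly's theorem, and the
  pointwise bound allows dominated convergence.
\<close>

text \<open>The exponent comes from counting: for a function bounded in \<open>L\<^sup>p\<close> the
  tail integral over (r, R) of its spherical means is O(r^(1 - N/p)), and each of the k - 1 further
  integrations raises the power by one, ending at r^(-b) with b = N/p - k. Subcriticality of q is
  then just q * b < \<theta> + N. Nothing vanishes at the boundary, so in place of a boundary value
  the average over (R/2, R) is used, which the same tail estimate controls. The factor r^N in the
  compactness part makes the variation a volume integral: the derivative of r^N u along a ray is N
  r^(N-1) u + r^N u', and both terms are dominated by the polar volume element, uniformly down to
  the origin. The Sobolev norm is an infimum over representing sequences, so all bounds are proved
  for every K strictly above it. Helly's theorem is applied to smooth approximants of the u_m chosen
  within 2^(-m) in \<open>L\<^sup>p\<close>. These errors are summable, so on almost every sphere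
  the means of approximant and function differ by a null sequence, and no further subsequence is
  required.\<close>

section \<open>Polar coordinates\<close>

text \<open>Up to the factor \<open>DIM('a)\<close> this is the surface measure of the unit sphere.\<close>

definition cone_measure :: "'a::euclidean_space measure" where
  "cone_measure = distr (restrict_space lborel (ball 0 1)) borel sgn"

text \<open>The factor \<open>N\<close> makes up for the missing one in \<open>cone_measure\<close>:
  an initial segment of length x \<le> R gets mass x^N, the ratio of the volumes of the balls of
  radius x and 1.\<close>

definition radial_measure :: "nat \<Rightarrow> real \<Rightarrow> real measure" where
  "radial_measure N R = density lborel (\<lambda>r. ennreal (real N * r ^ (N - 1)) * indicator {0<..<R} r)"

lemma borel_measurable_sgn [measurable]: "(sgn :: 'a::euclidean_space \<Rightarrow> 'a) \<in> borel_measurable borel"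
  unfolding sgn_div_norm [abs_def] by measurable

lemma sets_cone_measure [measurable_cong, simp]: "sets cone_measure = sets borel"
  by (simp add: cone_measure_def)

lemma space_cone_measure [simp]: "space cone_measure = UNIV"
  by (simp add: cone_measure_def)

lemma sets_radial_measure [measurable_cong, simp]: "sets (radial_measure N R) = sets borel"
  by (simp add: radial_measure_def)

lemma space_radial_measure [simp]: "space (radial_measure N R) = UNIV"
  by (simp add: radial_measure_def)

lemma emeasure_cone_measure:
  fixes A :: "'a::euclidean_space set"
  assumes [measurable]: "A \<in> sets borel"
  shows "emeasure cone_measure A = emeasure lborel (ball 0 1 \<inter> sgn -` A)"
proof -
  have "emeasure cone_measure A = emeasure (restrict_space lborel (ball 0 1)) (sgn -` A \<inter> ball 0 1)"
    unfolding cone_measure_def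
    by (subst emeasure_distr) (auto simp: space_restrict_space intro: measurable_restrict_space1)
  also have "\<dots> = emeasure lborel (sgn -` A \<inter> ball 0 1)"
    by (rule emeasure_restrict_space) auto
  finally show ?thesis by (simp add: Int_commute)
qed

lemma finite_cone_measure: "finite_measure (cone_measure :: 'a::euclidean_space measure)"
proof
  have "emeasure lborel (ball (0::'a) 1) < \<infinity>"
    using emeasure_lborel_ball_finite by blast
  then show "emeasure cone_measure (space (cone_measure :: 'a measure)) \<noteq> \<infinity>"
    by (simp add: emeasure_cone_measure)
qed

interpretation cone: finite_measure "cone_measure :: 'a::euclidean_space measure"
  by (rule finite_cone_measure)

lemma cone_measure_pos: "0 < measure (cone_measure :: 'a::euclidean_space measure) UNIV"
proof -
  have "measure (cone_measure :: 'a measure) UNIV = measure lborel (ball (0::'a) 1)"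
    by (simp add: emeasure_cone_measure measure_def)
  also have "\<dots> > 0"
    using content_ball_pos [of 1 "0::'a"] by simp
  finally show ?thesis .
qed

text \<open>Only the origin, a null set, is not sent to the unit sphere by \<open>sgn\<close>. Facts
  about rays with \<open>norm w = 1\<close> may therefore be used almost everywhere.\<close>

lemma AE_cone_measure_norm: "AE w in (cone_measure :: 'a::euclidean_space measure). norm w = 1"
proof -
  have "{w \<in> space (cone_measure :: 'a measure). norm w \<noteq> 1} = {w. norm w \<noteq> 1}" by simp
  moreover have [measurable]: "{w :: 'a. norm w \<noteq> 1} \<in> sets borel" by measurable
  moreover have "emeasure cone_measure {w::'a. norm w \<noteq> 1} = 0"
  proof -
    have "ball 0 1 \<inter> sgn -` {w::'a. norm w \<noteq> 1} = {0}"
      by (auto simp: norm_sgn)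
    then show ?thesis by (simp add: emeasure_cone_measure)
  qed
  ultimately show ?thesis
    by (intro AE_I [of _ _ "{w. norm w \<noteq> 1}"]) auto
qed

text \<open>The preimage of a set under \<open>sgn\<close> is a cone, hence invariant under
  dilations, which scale Lebesgue measure by the power \<open>DIM('a)\<close>.\<close>

lemma emeasure_cone_ball:
  fixes A :: "'a::euclidean_space set"
  assumes [measurable]: "A \<in> sets borel" and "r > 0"
  shows "emeasure lborel (ball 0 r \<inter> sgn -` A) = ennreal (r ^ DIM('a)) * emeasure cone_measure A"
proof -
  have m [measurable]: "ball 0 s \<inter> sgn -` A \<in> sets (borel :: 'a measure)" for s
    by (intro sets.Int measurable_sets_borel [of sgn borel]) auto
  have "emeasure lborel (ball 0 r \<inter> sgn -` A)
      = emeasure (density (distr lborel borel (\<lambda>x::'a. 0 + r *\<^sub>R x)) (\<lambda>_. \<bar>r\<bar> ^ DIM('a))) (ball 0 r \<inter> sgn -` A)"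
    using lborel_affine [of r "0::'a"] \<open>r > 0\<close> by simp
  also have "\<dots> = ennreal (r ^ DIM('a)) * emeasure (distr lborel borel (\<lambda>x::'a. r *\<^sub>R x)) (ball 0 r \<inter> sgn -` A)"
    using \<open>r > 0\<close> by (subst emeasure_density_const) auto
  also have "emeasure (distr lborel borel (\<lambda>x::'a. r *\<^sub>R x)) (ball 0 r \<inter> sgn -` A)
       = emeasure lborel ((\<lambda>x::'a. r *\<^sub>R x) -` (ball 0 r \<inter> sgn -` A))"
    by (subst emeasure_distr) auto
  also have "(\<lambda>x::'a. r *\<^sub>R x) -` (ball 0 r \<inter> sgn -` A) = ball 0 1 \<inter> sgn -` A"
    using \<open>r > 0\<close> by (auto simp: sgn_scaleR)
  finally show ?thesis by (simp add: emeasure_cone_measure)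
qed

lemma emeasure_radial_measure_lessThan:
  assumes "N \<ge> 1" "R > 0"
  shows "emeasure (radial_measure N R) {..<x} = ennreal (max 0 (min x R) ^ N)"
proof -
  define y where "y = max 0 (min x R)"
  have "y \<ge> 0" by (simp add: y_def)
  have "emeasure (radial_measure N R) {..<x} =
      (\<integral>\<^sup>+r. ennreal (real N * r ^ (N - 1)) * indicator {0..y} r \<partial>lborel)"
    unfolding radial_measure_def
  proof (subst emeasure_density, simp_all, intro nn_integral_cong_AE)
    have "AE r in lborel. r \<noteq> 0 \<and> r \<noteq> y"
      using AE_lborel_singleton [of "0::real"] AE_lborel_singleton [of y] by eventually_elim auto
    then show "AE r in lborel. ennreal (real N * r ^ (N - Suc 0)) * indicator {0<..<R} r * indicator {..<x} r =
               ennreal (real N * r ^ (N - Suc 0)) * indicator {0..y} r"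
      by eventually_elim (auto simp: indicator_def y_def)
  qed
  also have "\<dots> = ennreal (y ^ N - 0 ^ N)"
    using \<open>y \<ge> 0\<close>
    by (intro nn_integral_FTC_Icc) (auto intro!: derivative_eq_intros)
  finally show ?thesis using assms by (simp add: y_def)
qed

lemma finite_radial_measure:
  assumes "N \<ge> 1" "R > 0"
  shows "finite_measure (radial_measure N R)"
proof
  have "emeasure (radial_measure N R) UNIV = emeasure (radial_measure N R) {..<R}"
    unfolding radial_measure_def
    by (subst (1 2) emeasure_density) (auto intro!: nn_integral_cong simp: indicator_def)
  then show "emeasure (radial_measure N R) (space (radial_measure N R)) \<noteq> \<infinity>"
    using emeasure_radial_measure_lessThan [OF assms, of R] by simp
qed

text \<open>It suffices to compare the measures on rectangles \<open>A \<times> B\<close>. For fixed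
  \<open>B\<close> both sides are measures in \<open>A\<close> (\<open>M1\<close> and
  \<open>M2\<close>), so half-lines \<open>{..<x}\<close> suffice as a generator; there the set is a
  cone truncated at radius \<open>min x R\<close>.\<close>

theorem distr_polar:
  assumes "R > 0"
  shows "distr (restrict_space lborel (ball (0::'a::euclidean_space) R)) (borel \<Otimes>\<^sub>M borel) (\<lambda>x. (norm x, sgn x))
       = radial_measure DIM('a) R \<Otimes>\<^sub>M cone_measure" (is "?D = ?P")
proof (rule sym, rule pair_measure_eqI)
  let ?N = "DIM('a)"
  interpret r: finite_measure "radial_measure ?N R"
    using assms by (intro finite_radial_measure) (auto simp: DIM_positive Suc_leI)
  show "sigma_finite_measure (radial_measure ?N R)" "sigma_finite_measure (cone_measure :: 'a measure)"
    by unfold_locales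
  show "sets ?P = sets ?D"
    by (simp cong: sets_pair_measure_cong)
  fix A :: "real set" and B :: "'a set"
  assume "A \<in> sets (radial_measure DIM('a) R)" "B \<in> sets cone_measure"
  then have [measurable]: "A \<in> sets borel" "B \<in> sets borel" by auto
  have mB [measurable]: "ball 0 x \<inter> sgn -` B \<in> sets (borel :: 'a measure)" for x
    by (intro sets.Int measurable_sets_borel [of sgn borel]) auto
  define S where "S = ball 0 R \<inter> sgn -` B"
  have [measurable]: "S \<in> sets borel" by (simp add: S_def)
  define M1 where "M1 = distr (density lborel (indicator S)) borel (norm :: 'a \<Rightarrow> real)"
  define M2 where "M2 = density (radial_measure ?N R) (\<lambda>_. emeasure cone_measure B)"
  have M1: "emeasure M1 C = emeasure lborel (norm -` C \<inter> S)" if [measurable]: "C \<in> sets borel" for C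
  proof -
    have [measurable]: "norm -` C \<in> sets (borel :: 'a measure)"
      by (intro measurable_sets_borel [of norm borel]) auto
    show ?thesis
      by (simp add: M1_def emeasure_distr emeasure_density Int_commute
            indicator_inter_arith [symmetric])
  qed
  have M2: "emeasure M2 C = emeasure cone_measure B * emeasure (radial_measure ?N R) C" if "C \<in> sets borel" for C
    using that by (simp add: M2_def emeasure_density_const)
  have "M1 = M2"
  proof (rule measure_eqI_generator_eq [where E = "range lessThan" and \<Omega> = UNIV and A = "\<lambda>i. {..<real i}"])
    show "Int_stable (range lessThan :: real set set)"
      by (auto simp: Int_stable_def intro: range_eqI [where x = "min _ _"])
    show "range lessThan \<subseteq> Pow (UNIV :: real set)" by auto
    have "sigma_sets UNIV (range lessThan) = sets (borel :: real measure)"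
      by (simp add: borel_Iio)
    then show "sets M1 = sigma_sets UNIV (range lessThan)" "sets M2 = sigma_sets UNIV (range lessThan)"
      by (simp_all add: M1_def M2_def)
    show "range (\<lambda>i. {..<real i}) \<subseteq> range lessThan" by auto
    show "(\<Union>i. {..<real i}) = UNIV"
      using reals_Archimedean2 by auto
    have eq: "emeasure M1 {..<x} = emeasure M2 {..<x}" for x
    proof (cases "x > 0")
      case True
      have "norm -` {..<x} \<inter> S = ball 0 (min x R) \<inter> sgn -` B"
        by (auto simp: S_def)
      then show ?thesis using True assms
        by (simp add: M1 M2 emeasure_radial_measure_lessThan DIM_positive Suc_leI emeasure_cone_ball mult.commute)
    next
      case False
      have *: "norm -` {..<x} \<inter> S = {}"
        using False by (auto simp: S_def dest: order.strict_trans1 [OF norm_ge_zero])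
      show ?thesis using False assms
        by (simp add: M1 M2 * emeasure_radial_measure_lessThan DIM_positive Suc_leI)
    qed
    then show "emeasure M1 X = emeasure M2 X" if "X \<in> range lessThan" for X
      using that by auto
    fix i :: nat
    have "emeasure M1 {..<real i} \<le> emeasure lborel (ball (0::'a) R)"
      unfolding M1 [of "{..<real i}", simplified] by (rule emeasure_mono) (auto simp: S_def)
    also have "\<dots> < \<infinity>" using emeasure_lborel_ball_finite by blast
    finally show "emeasure M1 {..<real i} \<noteq> \<infinity>" by simp
  qed
  have "emeasure ?D (A \<times> B) = emeasure (restrict_space lborel (ball (0::'a) R))
         ((\<lambda>x. (norm x, sgn x)) -` (A \<times> B) \<inter> ball 0 R)"
    by (subst emeasure_distr) (auto simp: space_restrict_space intro!: measurable_restrict_space1)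
  also have "\<dots> = emeasure lborel ((\<lambda>x. (norm x, sgn x)) -` (A \<times> B) \<inter> ball (0::'a) R)"
    by (rule emeasure_restrict_space) auto
  also have "(\<lambda>x. (norm x, sgn x)) -` (A \<times> B) \<inter> ball (0::'a) R = norm -` A \<inter> S"
    by (auto simp: S_def)
  also have "emeasure lborel \<dots> = emeasure M2 A" by (simp add: M1 flip: \<open>M1 = M2\<close>)
  finally show "emeasure (radial_measure ?N R) A * emeasure cone_measure B = emeasure ?D (A \<times> B)"
    by (simp add: M2 mult.commute)
qed

lemma norm_scaleR_sgn: "norm x *\<^sub>R sgn x = (x :: 'a::real_normed_vector)"
  by (cases "x = 0") (auto simp: sgn_div_norm)

theorem nn_integral_polar:
  fixes f :: "'a::euclidean_space \<Rightarrow> ennreal"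
  assumes [measurable]: "f \<in> borel_measurable borel" and "R > 0"
  shows "(\<integral>\<^sup>+x\<in>ball 0 R. f x \<partial>lborel) =
    (\<integral>\<^sup>+r\<in>{0<..<R}. ennreal (real DIM('a) * r ^ (DIM('a) - 1)) * (\<integral>\<^sup>+w. f (r *\<^sub>R w) \<partial>cone_measure) \<partial>lborel)"
proof -
  have "(\<integral>\<^sup>+x\<in>ball 0 R. f x \<partial>lborel) = (\<integral>\<^sup>+x. f x \<partial>restrict_space lborel (ball 0 R))"
    by (subst nn_integral_restrict_space) auto
  also have "\<dots> = (\<integral>\<^sup>+x. f (norm x *\<^sub>R sgn x) \<partial>restrict_space lborel (ball 0 R))"
    by (intro nn_integral_cong) (simp add: norm_scaleR_sgn)
  also have "\<dots> = (\<integral>\<^sup>+z. f (fst z *\<^sub>R snd z) \<partial>distr (restrict_space lborel (ball (0::'a) R)) (borel \<Otimes>\<^sub>M borel) (\<lambda>x. (norm x, sgn x)))"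
    by (subst nn_integral_distr) (auto intro!: measurable_restrict_space1)
  also have "\<dots> = (\<integral>\<^sup>+z. f (fst z *\<^sub>R snd z) \<partial>(radial_measure DIM('a) R \<Otimes>\<^sub>M cone_measure))"
    using assms by (simp add: distr_polar)
  also have "\<dots> = (\<integral>\<^sup>+r. \<integral>\<^sup>+w. f (r *\<^sub>R w) \<partial>cone_measure \<partial>radial_measure DIM('a) R)"
    by (subst cone.nn_integral_fst [symmetric]) auto
  also have "\<dots> = (\<integral>\<^sup>+r\<in>{0<..<R}. ennreal (real DIM('a) * r ^ (DIM('a) - 1)) * (\<integral>\<^sup>+w. f (r *\<^sub>R w) \<partial>cone_measure) \<partial>lborel)"
    unfolding radial_measure_def
    by (subst nn_integral_density) (auto simp: mult_ac intro!: nn_integral_cong)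
  finally show ?thesis .
qed

text \<open>Almost every spherical slice of a null set is null: the polar formula is applied to a
  Borel null set containing the exceptional points, and the weight r^(N-1) is positive on the
  interval.\<close>

lemma AE_polar:
  fixes P :: "'a::euclidean_space \<Rightarrow> bool"
  assumes "R > 0" and "AE x in lborel. x \<in> ball 0 R \<longrightarrow> P x"
  shows "AE r in lborel. r \<in> {0<..<R} \<longrightarrow> (AE w in cone_measure. P (r *\<^sub>R w))"
proof -
  obtain Z where Z: "{x. \<not> (x \<in> ball 0 R \<longrightarrow> P x)} \<subseteq> Z" and Z0: "emeasure lborel Z = 0"
    and [measurable]: "Z \<in> sets borel"
    using assms(2) by (auto elim!: AE_E)
  let ?I = "\<integral>\<^sup>+r\<in>{0<..<R}. ennreal (real DIM('a) * r ^ (DIM('a) - 1)) *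
      (\<integral>\<^sup>+w. indicator Z (r *\<^sub>R (w :: 'a)) \<partial>cone_measure) \<partial>lborel"
  have "?I = (\<integral>\<^sup>+x\<in>ball 0 R. indicator Z x \<partial>lborel)"
    using assms by (subst nn_integral_polar) auto
  also have "\<dots> \<le> (\<integral>\<^sup>+x. indicator Z x \<partial>lborel)"
    by (intro nn_integral_mono) (auto simp: indicator_def)
  also have "\<dots> = 0" by (simp add: Z0)
  finally have "?I = 0" by simp
  then have "AE r in lborel. ennreal (real DIM('a) * r ^ (DIM('a) - 1)) *
      (\<integral>\<^sup>+w. indicator Z (r *\<^sub>R (w::'a)) \<partial>cone_measure) * indicator {0<..<R} r = 0"
    by (subst (asm) nn_integral_0_iff_AE) measurable
  then show ?thesis
  proof eventually_elim
    case (elim r)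
    show ?case
    proof
      assume r: "r \<in> {0<..<R}"
      have "ennreal (real DIM('a) * r ^ (DIM('a) - 1)) \<noteq> 0"
        using r by (simp add: ennreal_eq_0_iff not_le)
      then have "(\<integral>\<^sup>+w. indicator Z (r *\<^sub>R w) \<partial>cone_measure) = 0"
        using elim r by auto
      then have "AE w in cone_measure. indicator Z (r *\<^sub>R (w::'a)) = (0::ennreal)"
        by (subst (asm) nn_integral_0_iff_AE) measurable
      with AE_cone_measure_norm show "AE w in cone_measure. P (r *\<^sub>R w)"
      proof eventually_elim
        case (elim w)
        then have "r *\<^sub>R w \<in> ball 0 R" "r *\<^sub>R w \<notin> Z"
          using r by (auto simp: indicator_def split: if_splits)
        then show ?case using Z by blast
      qed
    qed
  qed
qed

section \<open>Estimates along rays\<close>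

text \<open>The values are in \<open>ennreal\<close>, so that transport along rays can be stated
  before any mean is known to be finite; finiteness is a result of
  \<open>radial_lemma\<close>.\<close>

definition sphere_L1 :: "('a::euclidean_space \<Rightarrow> real) \<Rightarrow> real \<Rightarrow> ennreal" where
  "sphere_L1 f r = (\<integral>\<^sup>+w. ennreal \<bar>f (r *\<^sub>R w)\<bar> \<partial>cone_measure)"

text \<open>\<open>F j\<close> stands for the \<open>j\<close>-th radial derivative of \<open>F 0\<close>.\<close>

definition ray_chain :: "real \<Rightarrow> (nat \<Rightarrow> 'a::euclidean_space \<Rightarrow> real) \<Rightarrow> bool" where
  "ray_chain R F \<longleftrightarrow> (\<forall>j. F j \<in> borel_measurable borel) \<and>
     (\<forall>j w t. norm w = 1 \<longrightarrow> 0 < t \<longrightarrow> t < R \<longrightarrow>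
        ((\<lambda>t. F j (t *\<^sub>R w)) has_real_derivative F (Suc j) (t *\<^sub>R w)) (at t))"

text \<open>Writing the bound as \<open>K powr p\<close> lets \<open>K\<close> scale like a norm. It
  is kept positive because it serves as the threshold in \<open>le_add_powr\<close>.\<close>

definition ray_chain_bound :: "nat \<Rightarrow> real \<Rightarrow> real \<Rightarrow> real \<Rightarrow> (nat \<Rightarrow> 'a::euclidean_space \<Rightarrow> real) \<Rightarrow> bool" where
  "ray_chain_bound k p R K F \<longleftrightarrow> ray_chain R F \<and> K > 0 \<and>
     (\<forall>j\<le>k. (\<integral>\<^sup>+x\<in>ball 0 R. ennreal (\<bar>F j x\<bar> powr p) \<partial>lborel) \<le> ennreal (K powr p))"

lemma ray_chain_measurable: "ray_chain R F \<Longrightarrow> F j \<in> borel_measurable borel"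
  by (simp add: ray_chain_def)

lemma measurable_sphere_L1 [measurable]:
  fixes f :: "'a::euclidean_space \<Rightarrow> real"
  assumes [measurable]: "f \<in> borel_measurable borel"
  shows "sphere_L1 f \<in> borel_measurable borel"
unfolding sphere_L1_def [abs_def] by measurable

text \<open>With \<open>\<mu> = K t powr (- N / p)\<close> this replaces Hoelder's inequality and includes the case \<open>p = 1\<close>.\<close>

lemma le_add_powr:
  fixes t \<mu> p :: real
  assumes "t \<ge> 0" "\<mu> > 0" "p \<ge> 1"
  shows "t \<le> \<mu> + \<mu> powr (1 - p) * t powr p"
proof (cases "t \<le> \<mu>")
  case True
  then show ?thesis by (simp add: add_increasing2)
next
  case False
  then have "t > 0" using assms by simp
  then have "t = t powr (1 - p) * t powr p" by (simp flip: powr_add)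
  also have "\<dots> \<le> \<mu> powr (1 - p) * t powr p"
    using False assms by (intro mult_right_mono powr_mono2') auto
  finally show ?thesis using assms by simp
qed

lemma abs_diff_le_nn_integral_deriv:
  fixes f f' :: "real \<Rightarrow> real"
  assumes "a \<le> b" and d: "\<And>x. x \<in> {a..b} \<Longrightarrow> (f has_real_derivative f' x) (at x)"
    and c: "continuous_on {a..b} f'"
  shows "ennreal \<bar>f b - f a\<bar> \<le> (\<integral>\<^sup>+t\<in>{a..b}. ennreal \<bar>f' t\<bar> \<partial>lborel)"
proof -
  have I: "integrable lborel (\<lambda>x. indicator {a..b} x *\<^sub>R f' x)"
    using borel_integrable_compact [of "{a..b}" f'] c by simp
  have "(\<integral>x. indicator {a..b} x *\<^sub>R f' x \<partial>lborel) = f b - f a"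
    using assms
    by (intro integral_FTC_atLeastAtMost) (auto simp: has_real_derivative_iff_has_vector_derivative
        intro: has_vector_derivative_at_within)
  then have "ennreal \<bar>f b - f a\<bar> \<le> (\<integral>\<^sup>+x. norm (indicator {a..b} x *\<^sub>R f' x) \<partial>lborel)"
    using integral_norm_bound_ennreal [OF I] by simp
  also have "\<dots> = (\<integral>\<^sup>+t\<in>{a..b}. ennreal \<bar>f' t\<bar> \<partial>lborel)"
    by (intro nn_integral_cong) (simp add: indicator_def)
  finally show ?thesis .
qed

lemma nn_integral_powr_tail:
  fixes r b :: real
  assumes "r > 0" "b > 1"
  shows "(\<integral>\<^sup>+t\<in>{r<..<R}. ennreal (t powr - b) \<partial>lborel) \<le> ennreal (r powr (1 - b) / (b - 1))"
proof -
  have "(\<integral>\<^sup>+t\<in>{r<..<R}. ennreal (t powr - b) \<partial>lborel) \<le> (\<integral>\<^sup>+t. ennreal (t powr - b) * indicator {r..} t \<partial>lborel)"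
    by (intro nn_integral_mono) (auto simp: indicator_def)
  also have "\<dots> = ennreal (0 - r powr (1 - b) / (1 - b))"
  proof (rule nn_integral_FTC_atLeast)
    show "((\<lambda>t. t powr (1 - b) / (1 - b)) \<longlongrightarrow> 0) at_top"
      using tendsto_neg_powr [OF _ filterlim_ident, of "1 - b"] \<open>b > 1\<close> 
      by (auto intro!: tendsto_divide_zero)
    show "((\<lambda>t. t powr (1 - b) / (1 - b)) has_real_derivative x powr - b) (at x)" if "r \<le> x" for x
      using that assms by (auto intro!: derivative_eq_intros)
  qed auto
  also have "0 - r powr (1 - b) / (1 - b) = r powr (1 - b) / (b - 1)"
    using assms by (simp add: field_simps)
  finally show ?thesis .
qed

text \<open>Apply \<open>le_add_powr\<close> at radius t with threshold K t^(-a), a = N/p. The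
  threshold itself is integrable on (r, \<infinity>) because a > 1 and contributes the term with a -
  1 in the denominator. The coefficient of the \<open>p\<close>-th power is at most a constant times
  the polar density, so the rest is bounded by the integral over the ball and contributes the
  summand 1.\<close>

lemma sphere_L1_tail:
  fixes f :: "'a::euclidean_space \<Rightarrow> real"
  assumes [measurable]: "f \<in> borel_measurable borel"
    and "p \<ge> 1" "K > 0" "r > 0" "r < R" and a: "real DIM('a) / p > 1"
    and fK: "(\<integral>\<^sup>+x\<in>ball 0 R. ennreal (\<bar>f x\<bar> powr p) \<partial>lborel) \<le> ennreal (K powr p)"
  shows "(\<integral>\<^sup>+t\<in>{r<..<R}. sphere_L1 f t \<partial>lborel) \<le>
    ennreal ((measure (cone_measure :: 'a measure) UNIV / (real DIM('a) / p - 1) + 1) * K * r powr (1 - real DIM('a) / p))"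
proof -
  define a where "a = real DIM('a) / p"
  define N where "N = real DIM('a)"
  define \<sigma> where "\<sigma> = measure (cone_measure :: 'a measure) UNIV"
  define c where "c = K powr (1 - p) * r powr (1 - a)"
  let ?I = "\<lambda>t. \<integral>\<^sup>+w. ennreal (\<bar>f (t *\<^sub>R w)\<bar> powr p) \<partial>cone_measure" and ?w = "\<lambda>t. ennreal (N * t ^ (DIM('a) - 1))"
  have "a > 1" using assms by (simp add: a_def)
  have "N \<ge> 1" by (simp add: N_def DIM_positive Suc_leI)
  have "c > 0" using assms by (simp add: c_def)
  have [simp]: "emeasure (cone_measure :: 'a measure) UNIV = ennreal \<sigma>" "\<sigma> \<ge> 0"
    by (simp_all add: \<sigma>_def cone.emeasure_eq_measure)
  have G: "sphere_L1 f t \<le> ennreal (K * \<sigma>) * ennreal (t powr - a) +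
      ennreal c * (?w t * ?I t)"
    if t: "r < t" for t
  proof -
    have "t > 0" using t assms by simp
    have *: "(K * t powr - a) powr (1 - p) \<le> c * (N * t ^ (DIM('a) - 1))"
    proof -
      have "(K * t powr - a) powr (1 - p) = K powr (1 - p) * t powr (a * (p - 1))"
        using assms \<open>t > 0\<close> by (simp add: powr_mult powr_powr algebra_simps)
      \<comment> \<open>Since a * p = N, the power of t splits into the polar weight t^(N-1) and a
        decreasing factor, which is then bounded by its value at r.\<close>
      also have "a * (p - 1) = (N - 1) + (1 - a)"
        using assms by (simp add: a_def N_def field_simps)
      also have "t powr \<dots> = t powr (N - 1) * t powr (1 - a)"
        by (rule powr_add)
      also have "t powr (N - 1) = t ^ (DIM('a) - 1)"
        using \<open>t > 0\<close> by (simp add: N_def DIM_positive Suc_leI of_nat_diff flip: powr_realpow)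
      also have "t powr (1 - a) \<le> r powr (1 - a)"
        using t assms \<open>a > 1\<close> by (intro powr_mono2') auto
      finally have "(K * t powr - a) powr (1 - p) \<le> c * t ^ (DIM('a) - 1)"
        using assms \<open>t > 0\<close> by (simp add: c_def mult_ac)
      also have "\<dots> \<le> c * (N * t ^ (DIM('a) - 1))"
        using \<open>N \<ge> 1\<close> \<open>c > 0\<close> \<open>t > 0\<close> by (intro mult_left_mono) auto
      finally show ?thesis .
    qed
    have "\<bar>f (t *\<^sub>R w)\<bar> \<le> K * t powr - a + c * (N * t ^ (DIM('a) - 1)) * \<bar>f (t *\<^sub>R w)\<bar> powr p" for w
    proof -
      have "\<bar>f (t *\<^sub>R w)\<bar> \<le> K * t powr - a + (K * t powr - a) powr (1 - p) * \<bar>f (t *\<^sub>R w)\<bar> powr p"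
        using assms \<open>t > 0\<close> by (intro le_add_powr) auto
      also have "\<dots> \<le> K * t powr - a + c * (N * t ^ (DIM('a) - 1)) * \<bar>f (t *\<^sub>R w)\<bar> powr p"
        using * by (intro add_left_mono mult_right_mono) auto
      finally show ?thesis .
    qed
    then have "sphere_L1 f t \<le> (\<integral>\<^sup>+w. ennreal (K * t powr - a + c * (N * t ^ (DIM('a) - 1)) * \<bar>f (t *\<^sub>R w)\<bar> powr p) \<partial>cone_measure)"
      unfolding sphere_L1_def by (intro nn_integral_mono ennreal_leI)
    also have "\<dots> = (\<integral>\<^sup>+w. ennreal (K * t powr - a) + ennreal c * (?w t * ennreal (\<bar>f (t *\<^sub>R w)\<bar> powr p)) \<partial>cone_measure)"
      using assms \<open>t > 0\<close> \<open>c > 0\<close> \<open>N \<ge> 1\<close>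
      by (intro nn_integral_cong) (simp add: ennreal_mult mult.assoc)
    also have "\<dots> = ennreal (K * \<sigma>) * ennreal (t powr - a) +
      ennreal c * (?w t * ?I t)"
      using assms by (simp add: nn_integral_add nn_integral_cmult, simp add: mult_ac flip: ennreal_mult)
    finally show ?thesis .
  qed
  have "(\<integral>\<^sup>+t\<in>{r<..<R}. sphere_L1 f t \<partial>lborel) \<le>
     (\<integral>\<^sup>+t. ennreal (K * \<sigma>) * (ennreal (t powr - a) * indicator {r<..<R} t) +
      ennreal c * (?w t * ?I t * indicator {0<..<R} t) \<partial>lborel)"
    using G \<open>r > 0\<close> by (intro nn_integral_mono) (auto simp: indicator_def)
  also have "\<dots> = ennreal (K * \<sigma>) * (\<integral>\<^sup>+t\<in>{r<..<R}. ennreal (t powr - a) \<partial>lborel) +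
      ennreal c * (\<integral>\<^sup>+t\<in>{0<..<R}. ?w t * ?I t \<partial>lborel)"
    by (subst nn_integral_add, simp, measurable, simp add: nn_integral_cmult)
  also have "(\<integral>\<^sup>+t\<in>{0<..<R}. ?w t * ?I t \<partial>lborel)
      = (\<integral>\<^sup>+x\<in>ball 0 R. ennreal (\<bar>f x\<bar> powr p) \<partial>lborel)"
    using assms by (subst nn_integral_polar) (auto simp: N_def)
  also have "ennreal (K * \<sigma>) * (\<integral>\<^sup>+t\<in>{r<..<R}. ennreal (t powr - a) \<partial>lborel) + ennreal c * \<dots>
      \<le> ennreal (K * \<sigma>) * ennreal (r powr (1 - a) / (a - 1)) + ennreal c * ennreal (K powr p)"
    using nn_integral_powr_tail [of r a] fK \<open>a > 1\<close> \<open>r > 0\<close> by (intro add_mono mult_left_mono) auto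
  also have "\<dots> = ennreal (K * \<sigma> * (r powr (1 - a) / (a - 1)) + c * K powr p)"
    using assms \<open>c > 0\<close> \<open>a > 1\<close> by (simp flip: ennreal_mult ennreal_plus)
  also have "c * K powr p = K * r powr (1 - a)"
    using assms by (simp add: c_def mult_ac flip: powr_add)
  also have "K * \<sigma> * (r powr (1 - a) / (a - 1)) + K * r powr (1 - a) = (\<sigma> / (a - 1) + 1) * K * r powr (1 - a)"
    by (simp add: algebra_simps)
  finally show ?thesis by (simp add: a_def \<sigma>_def)
qed

text \<open>The fundamental theorem of calculus on each ray, followed by Tonelli. As
  \<open>m\<close> lies below both radii, one and the same tail serves for either order of
  \<open>r\<close> and \<open>s\<close>.\<close>

lemma sphere_L1_transport:
  fixes F :: "nat \<Rightarrow> 'a::euclidean_space \<Rightarrow> real"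
  assumes F: "ray_chain R F" and "m > 0" "r \<in> {m..<R}" "s \<in> {m..<R}"
  shows "sphere_L1 (F j) r \<le> sphere_L1 (F j) s + (\<integral>\<^sup>+t\<in>{m<..<R}. sphere_L1 (F (Suc j)) t \<partial>lborel)"
proof -
  interpret ps: pair_sigma_finite lborel "cone_measure :: 'a measure" ..
  note [measurable] = ray_chain_measurable [OF F]
  let ?J = "\<lambda>w. \<integral>\<^sup>+t\<in>{m<..<R}. ennreal \<bar>F (Suc j) (t *\<^sub>R w)\<bar> \<partial>lborel"
  have *: "ennreal \<bar>F j (r *\<^sub>R w)\<bar> \<le> ennreal \<bar>F j (s *\<^sub>R w)\<bar> + ?J w"
    if w: "norm w = 1" for w
  proof -
    have d: "((\<lambda>t. F j (t *\<^sub>R w)) has_real_derivative F (Suc j) (t *\<^sub>R w)) (at t)" if "m \<le> t" "t < R" for j t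
      using F w that \<open>m > 0\<close> by (auto simp: ray_chain_def)
    have c: "continuous_on {a..b} (\<lambda>t. F (Suc j) (t *\<^sub>R w))" if "m \<le> a" "b < R" for a b
      using that by (intro continuous_at_imp_continuous_on ballI DERIV_isCont [OF d]) auto
    have "ennreal \<bar>F j (b *\<^sub>R w) - F j (a *\<^sub>R w)\<bar> \<le> ?J w"
      if "m \<le> a" "a \<le> b" "b < R" for a b
    proof -
      have "ennreal \<bar>F j (b *\<^sub>R w) - F j (a *\<^sub>R w)\<bar> \<le> (\<integral>\<^sup>+t\<in>{a..b}. ennreal \<bar>F (Suc j) (t *\<^sub>R w)\<bar> \<partial>lborel)"
        using that by (intro abs_diff_le_nn_integral_deriv d c) auto
      also have "\<dots> \<le> ?J w"
      proof (rule nn_integral_mono_AE)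
        have "AE t in lborel. t \<noteq> m" by (rule AE_lborel_singleton)
        then show "AE t in lborel. ennreal \<bar>F (Suc j) (t *\<^sub>R w)\<bar> * indicator {a..b} t
            \<le> ennreal \<bar>F (Suc j) (t *\<^sub>R w)\<bar> * indicator {m<..<R} t"
          by eventually_elim (use that in \<open>auto simp: indicator_def\<close>)
      qed
      finally show ?thesis .
    qed
    note D = this
    have "ennreal \<bar>F j (r *\<^sub>R w) - F j (s *\<^sub>R w)\<bar> \<le> ?J w"
      using D [of s r] D [of r s] assms(3,4) by (cases "s \<le> r") (auto simp: abs_minus_commute)
    moreover have "ennreal \<bar>F j (r *\<^sub>R w)\<bar> \<le> ennreal \<bar>F j (s *\<^sub>R w)\<bar> + ennreal \<bar>F j (r *\<^sub>R w) - F j (s *\<^sub>R w)\<bar>"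
      by (auto simp flip: ennreal_plus intro!: ennreal_leI)
    ultimately show ?thesis by (meson add_left_mono order_trans)
  qed
  have "sphere_L1 (F j) r \<le> (\<integral>\<^sup>+w. ennreal \<bar>F j (s *\<^sub>R w)\<bar> + ?J w \<partial>cone_measure)"
    unfolding sphere_L1_def
    by (rule nn_integral_mono_AE) (use AE_cone_measure_norm in eventually_elim, use * in auto)
  also have "\<dots> = sphere_L1 (F j) s + (\<integral>\<^sup>+w. ?J w \<partial>cone_measure)"
    by (subst nn_integral_add) (auto simp: sphere_L1_def)
  also have "(\<integral>\<^sup>+w. ?J w \<partial>cone_measure) =
     (\<integral>\<^sup>+t. (\<integral>\<^sup>+w. ennreal \<bar>F (Suc j) (t *\<^sub>R w)\<bar> * indicator {m<..<R} t \<partial>cone_measure) \<partial>lborel)"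
    by (rule ps.Fubini') measurable
  also have "\<dots> = (\<integral>\<^sup>+t\<in>{m<..<R}. sphere_L1 (F (Suc j)) t \<partial>lborel)"
    by (simp add: nn_integral_multc sphere_L1_def)
  finally show ?thesis .
qed

text \<open>The mean at r is compared with the means at all s in (R/2, R), and the inequality is
  averaged over s. The average is bounded by \<open>sphere_L1_tail\<close> for \<open>F j\<close>
  itself, the error by the assumed tail of the next derivative. \<open>C'\<close> is chosen before
  \<open>F\<close> and \<open>K\<close>, which makes it uniform along sequences.\<close>

lemma sphere_L1_le_of_tail:
  assumes "p \<ge> 1" "R > 0" and N: "real DIM('a::euclidean_space) / p > 1" and "b > 0" "C \<ge> 0"
  obtains C' where "C' \<ge> 0" and "\<And>F :: nat \<Rightarrow> 'a \<Rightarrow> real. \<And>K r. ray_chain_bound k p R K F \<Longrightarrow> j \<le> k \<Longrightarrow>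
     (\<And>r. r \<in> {0<..<R} \<Longrightarrow> (\<integral>\<^sup>+t\<in>{r<..<R}. sphere_L1 (F (Suc j)) t \<partial>lborel) \<le> ennreal (C * K * r powr - b)) \<Longrightarrow>
     r \<in> {0<..<R} \<Longrightarrow> sphere_L1 (F j) r \<le> ennreal (C' * K * r powr - b)"
proof -
  define a where "a = real DIM('a) / p"
  define D where "D = measure (cone_measure :: 'a measure) UNIV / (a - 1) + 1"
  have "a > 1" using N by (simp add: a_def)
  then have "D \<ge> 0" by (simp add: D_def)
  \<comment> \<open>\<open>E * K\<close> bounds the average of the means over (R/2, R):
    \<open>sphere_L1_tail\<close> at radius R/2, divided by the length R/2.\<close>
  define E where "E = 2 / R * D * (R / 2) powr (1 - a)"
  have "E \<ge> 0" using \<open>D \<ge> 0\<close> \<open>R > 0\<close> by (simp add: E_def)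
  \<comment> \<open>The factor \<open>R powr b\<close> turns a constant into a multiple of
    \<open>r powr - b\<close> on (0, R); \<open>(1/2) powr - b\<close> pays for starting the tail at
    r/2.\<close>
  define C' where "C' = E * R powr b + C * (1/2) powr - b"
  have "C' \<ge> 0" using \<open>E \<ge> 0\<close> \<open>C \<ge> 0\<close> by (simp add: C'_def)
  moreover have "sphere_L1 (F j) r \<le> ennreal (C' * K * r powr - b)"
    if F: "ray_chain_bound k p R K F" and "j \<le> k"
    and tail: "\<And>r. r \<in> {0<..<R} \<Longrightarrow> (\<integral>\<^sup>+t\<in>{r<..<R}. sphere_L1 (F (Suc j)) t \<partial>lborel) \<le> ennreal (C * K * r powr - b)"
    and r: "r \<in> {0<..<R}" for F :: "nat \<Rightarrow> 'a \<Rightarrow> real" and K r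
  proof -
    from F have rc: "ray_chain R F" and "K > 0"
      and FK: "(\<integral>\<^sup>+x\<in>ball 0 R. ennreal (\<bar>F j x\<bar> powr p) \<partial>lborel) \<le> ennreal (K powr p)"
      using \<open>j \<le> k\<close> by (auto simp: ray_chain_bound_def)
    note [measurable] = ray_chain_measurable [OF rc]
    \<comment> \<open>As r < R, this radius is below r and below every s in (R/2, R).\<close>
    define m where "m = r / 2"
    have m: "m \<in> {0<..<R}" "m < r" "m < R / 2" using r by (auto simp: m_def)
    define T where "T = (\<integral>\<^sup>+t\<in>{m<..<R}. sphere_L1 (F (Suc j)) t \<partial>lborel)"
    let ?H = "{R/2<..<R}"
    have "ennreal (R / 2) * sphere_L1 (F j) r = (\<integral>\<^sup>+s\<in>?H. sphere_L1 (F j) r \<partial>lborel)"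
      using \<open>R > 0\<close> by (simp add: nn_integral_cmult mult.commute)
    also have "\<dots> \<le> (\<integral>\<^sup>+s. sphere_L1 (F j) s * indicator ?H s + T * indicator ?H s \<partial>lborel)"
      using sphere_L1_transport [OF rc, of m r _ j] m r unfolding T_def [symmetric]
      by (intro nn_integral_mono) (auto simp: indicator_def)
    also have "\<dots> = (\<integral>\<^sup>+s\<in>?H. sphere_L1 (F j) s \<partial>lborel) + ennreal (R / 2) * T"
      using \<open>R > 0\<close> by (subst nn_integral_add) (simp_all add: nn_integral_cmult_indicator mult.commute)
    also have "\<dots> \<le> ennreal (D * K * (R / 2) powr (1 - a)) + ennreal (R / 2) * ennreal (C * K * m powr - b)"
    unfolding T_def
    proof (intro add_mono mult_left_mono tail m)
      show "(\<integral>\<^sup>+s\<in>?H. sphere_L1 (F j) s \<partial>lborel) \<le> ennreal (D * K * (R / 2) powr (1 - a))"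
        using sphere_L1_tail [OF _ _ \<open>K > 0\<close> _ _ _ FK, of "R / 2"] N \<open>R > 0\<close> \<open>p \<ge> 1\<close> by (simp add: a_def D_def)
    qed simp
    also have "\<dots> = ennreal (R / 2) * ennreal (E * K + C * K * m powr - b)"
    proof -
      have "D * K * (R / 2) powr (1 - a) + R / 2 * (C * K * m powr - b) = R / 2 * (E * K + C * K * m powr - b)"
        using \<open>R > 0\<close> by (simp add: E_def field_simps)
      then show ?thesis using \<open>R > 0\<close> \<open>D \<ge> 0\<close> \<open>E \<ge> 0\<close> \<open>C \<ge> 0\<close> \<open>K > 0\<close>
        by (simp flip: ennreal_mult ennreal_plus)
    qed
    finally have "sphere_L1 (F j) r \<le> ennreal (E * K + C * K * m powr - b)"
      using \<open>R > 0\<close> by (subst (asm) ennreal_mult_le_mult_iff) auto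
    also have "E * K + C * K * m powr - b \<le> C' * K * r powr - b"
    proof -
      have "1 = r powr b * r powr - b" using r by (simp flip: powr_add)
      also have "\<dots> \<le> R powr b * r powr - b"
        using r \<open>b > 0\<close> by (intro mult_right_mono powr_mono2) auto
      finally have "E * K * 1 \<le> E * K * (R powr b * r powr - b)"
        using \<open>E \<ge> 0\<close> \<open>K > 0\<close> by (intro mult_left_mono) auto
      moreover have "m powr - b = (1/2) powr - b * r powr - b"
        using r unfolding m_def by (subst powr_mult [symmetric]) auto
      ultimately show ?thesis by (simp add: C'_def algebra_simps)
    qed
    finally show ?thesis by (simp add: ennreal_leI)
  qed
  ultimately show thesis using that by blast
qed

text \<open>Downward induction on the order of the derivative, starting from \<open>F k\<close>, for
  which only the \<open>L\<^sup>p\<close> bound is available. One step bounds the mean of the next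
  lower derivative by the tail above it and integrates that bound, which raises the power of r by
  one.\<close>

lemma sphere_L1_tail_iterated:
  assumes "p \<ge> 1" "R > 0" and k: "real DIM('a) / p > real k" and "i < k"
  shows "\<exists>C\<ge>0. \<forall>(F :: nat \<Rightarrow> 'a::euclidean_space \<Rightarrow> real) K. ray_chain_bound k p R K F \<longrightarrow>
     (\<forall>r\<in>{0<..<R}. (\<integral>\<^sup>+t\<in>{r<..<R}. sphere_L1 (F (k - i)) t \<partial>lborel) \<le>
        ennreal (C * K * r powr - (real DIM('a) / p - 1 - real i)))"
  using \<open>i < k\<close>
proof (induction i)
  case 0
  define a where "a = real DIM('a) / p"
  define C where "C = measure (cone_measure :: 'a measure) UNIV / (a - 1) + 1"
  have "a > 1" using k 0 by (simp add: a_def)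
  then have "C \<ge> 0" by (simp add: C_def)
  show ?case
  proof (intro exI [of _ C] conjI allI impI ballI)
    fix F :: "nat \<Rightarrow> 'a \<Rightarrow> real" and K r assume F: "ray_chain_bound k p R K F" and r: "r \<in> {0<..<R}"
    then have m: "F k \<in> borel_measurable borel" and K: "K > 0"
      and FK: "(\<integral>\<^sup>+x\<in>ball 0 R. ennreal (\<bar>F k x\<bar> powr p) \<partial>lborel) \<le> ennreal (K powr p)"
      by (auto simp: ray_chain_bound_def ray_chain_def)
    show "(\<integral>\<^sup>+t\<in>{r<..<R}. sphere_L1 (F (k - 0)) t \<partial>lborel) \<le> ennreal (C * K * r powr - (real DIM('a) / p - 1 - real 0))"
      using sphere_L1_tail [OF m \<open>p \<ge> 1\<close> K _ _ _ FK, of r] r \<open>a > 1\<close> by (simp add: C_def a_def)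
  qed (use \<open>C \<ge> 0\<close> in auto)
next
  case (Suc i)
  define a where "a = real DIM('a) / p"
  define b where "b = a - 1 - real i"
  \<comment> \<open>\<open>Suc i < k\<close> and k < N/p leave room for one more integration: the
    power \<open>t powr - b\<close> is integrable at infinity only for b > 1.\<close>
  have "a > 1" "b > 1" using k Suc.prems by (auto simp: a_def b_def)
  from Suc obtain C where "C \<ge> 0" and
    C: "\<And>F :: nat \<Rightarrow> 'a \<Rightarrow> real. \<And>K r. ray_chain_bound k p R K F \<Longrightarrow> r \<in> {0<..<R} \<Longrightarrow>
     (\<integral>\<^sup>+t\<in>{r<..<R}. sphere_L1 (F (k - i)) t \<partial>lborel) \<le> ennreal (C * K * r powr - b)"
    unfolding a_def b_def by auto
  define j where "j = k - Suc i"
  have j: "Suc j = k - i" "j \<le> k" using Suc.prems by (auto simp: j_def)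
  obtain C' where "C' \<ge> 0" and
    C': "\<And>F :: nat \<Rightarrow> 'a \<Rightarrow> real. \<And>K r. ray_chain_bound k p R K F \<Longrightarrow> r \<in> {0<..<R} \<Longrightarrow>
       sphere_L1 (F j) r \<le> ennreal (C' * K * r powr - b)"
    using sphere_L1_le_of_tail [of p R b C k j, where 'a = 'a] C \<open>C \<ge> 0\<close> assms \<open>a > 1\<close> \<open>b > 1\<close> j
    by (simp add: a_def) metis
  show ?case
  proof (intro exI [of _ "C' / (b - 1)"] conjI allI impI ballI)
    fix F :: "nat \<Rightarrow> 'a \<Rightarrow> real" and K r assume F: "ray_chain_bound k p R K F" and r: "r \<in> {0<..<R}"
    then have "K > 0" by (simp add: ray_chain_bound_def)
    have "(\<integral>\<^sup>+t\<in>{r<..<R}. sphere_L1 (F (k - Suc i)) t \<partial>lborel) \<le>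
        (\<integral>\<^sup>+t. ennreal (C' * K) * (ennreal (t powr - b) * indicator {r<..<R} t) \<partial>lborel)"
      using C' [OF F] r \<open>C' \<ge> 0\<close> \<open>K > 0\<close> unfolding j_def [symmetric]
      by (intro nn_integral_mono) (auto simp: indicator_def simp flip: ennreal_mult)
    also have "\<dots> = ennreal (C' * K) * (\<integral>\<^sup>+t\<in>{r<..<R}. ennreal (t powr - b) \<partial>lborel)"
      by (rule nn_integral_cmult) measurable
    also have "\<dots> \<le> ennreal (C' * K) * ennreal (r powr (1 - b) / (b - 1))"
      using nn_integral_powr_tail [of r b] r \<open>b > 1\<close> by (intro mult_left_mono) auto
    also have "\<dots> = ennreal (C' / (b - 1) * K * r powr - (real DIM('a) / p - 1 - real (Suc i)))"
      using \<open>C' \<ge> 0\<close> \<open>K > 0\<close> \<open>b > 1\<close> by (simp add: b_def a_def algebra_simps flip: ennreal_mult)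
    finally show "(\<integral>\<^sup>+t\<in>{r<..<R}. sphere_L1 (F (k - Suc i)) t \<partial>lborel) \<le>
       ennreal (C' / (b - 1) * K * r powr - (real DIM('a) / p - 1 - real (Suc i)))" .
  qed (use \<open>C' \<ge> 0\<close> \<open>b > 1\<close> in auto)
qed

text \<open>After k - 1 integrations the tail of \<open>F 1\<close> decays with exponent N/p - k.
  The passage from this tail to \<open>F 0\<close> does not integrate again, so here it is enough
  that the exponent is positive.\<close>

theorem radial_lemma:
  assumes "p \<ge> 1" "R > 0" "k \<ge> 1" and k: "real DIM('a::euclidean_space) / p > real k"
  shows "\<exists>C\<ge>0. \<forall>(F :: nat \<Rightarrow> 'a \<Rightarrow> real) K r. ray_chain_bound k p R K F \<longrightarrow> r \<in> {0<..<R} \<longrightarrow>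
     sphere_L1 (F 0) r \<le> ennreal (C * K * r powr - (real DIM('a) / p - real k))"
proof -
  define b where "b = real DIM('a) / p - real k"
  have "b > 0" using k by (simp add: b_def)
  have a: "real DIM('a) / p > 1" using k \<open>k \<ge> 1\<close> by linarith
  have e: "real DIM('a) / p - 1 - real (k - 1) = b" "k - (k - 1) = Suc 0"
    using \<open>k \<ge> 1\<close> by (auto simp: b_def of_nat_diff)
  obtain C where "C \<ge> 0" and
    C: "\<And>F :: nat \<Rightarrow> 'a \<Rightarrow> real. \<And>K r. ray_chain_bound k p R K F \<Longrightarrow> r \<in> {0<..<R} \<Longrightarrow>
     (\<integral>\<^sup>+t\<in>{r<..<R}. sphere_L1 (F (Suc 0)) t \<partial>lborel) \<le> ennreal (C * K * r powr - b)"
    using sphere_L1_tail_iterated [OF \<open>p \<ge> 1\<close> \<open>R > 0\<close> k, of "k - 1"] \<open>k \<ge> 1\<close> unfolding e by auto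
  show ?thesis
    using sphere_L1_le_of_tail [of p R b C k 0, where 'a = 'a] C \<open>C \<ge> 0\<close> assms a \<open>b > 0\<close>
    unfolding b_def by simp metis
qed

section \<open>Compactness of spherical means\<close>

text \<open>Helly's theorem is about monotone functions, so each \<open>h m\<close> is split into
  the distribution functions of the positive and negative parts of its derivative
  \<open>g m\<close>, up to a bounded constant. The two limits are monotone, hence continuous off a
  countable set, and there the subsequences converge.\<close>

lemma helly_absolutely_continuous:
  fixes h g :: "nat \<Rightarrow> real \<Rightarrow> real"
  assumes g: "\<And>m. integrable lborel (g m)" and gM: "\<And>m. (\<integral>t. \<bar>g m t\<bar> \<partial>lborel) \<le> M"
    and h: "\<And>m s r. 0 < s \<Longrightarrow> s \<le> r \<Longrightarrow> r < R \<Longrightarrow> h m r - h m s = (\<integral>t. indicator {s..r} t * g m t \<partial>lborel)"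
    and c: "0 < c" "c < R" and hc: "\<And>m. \<bar>h m c\<bar> \<le> M"
  obtains \<tau> H where "strict_mono (\<tau> :: nat \<Rightarrow> nat)"
    and "AE r in lborel. r \<in> {0<..<R} \<longrightarrow> (\<lambda>m. h (\<tau> m) r) \<longlonglongrightarrow> H r"
proof -
  have [measurable]: "g m \<in> borel_measurable borel" for m
    using borel_measurable_integrable [OF g [of m]] by simp
  \<comment> \<open>For e = 1 and e = -1 these measures have the positive and the negative part of
    \<open>g m\<close> as densities.\<close>
  define V where "V e m = density lborel (\<lambda>t. ennreal (max 0 (e * g m t)))" for e m
  define P where "P e m = cdf (V e m)" for e m
  have sets_V [simp]: "sets (V e m) = sets borel" "space (V e m) = UNIV" for e m
    by (simp_all add: V_def)
  have I: "integrable lborel (\<lambda>t. max 0 (e * g m t))" for e m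
    using integrable_mult_right [OF g, of e m] by auto
  have V: "emeasure (V e m) A = ennreal (\<integral>t. indicator A t * max 0 (e * g m t) \<partial>lborel)"
    if [measurable]: "A \<in> sets borel" for e m A
  proof -
    have "emeasure (V e m) A = (\<integral>\<^sup>+t. ennreal (indicator A t * max 0 (e * g m t)) \<partial>lborel)"
      unfolding V_def by (subst emeasure_density) (auto simp: indicator_def intro!: nn_integral_cong)
    also have "\<dots> = ennreal (\<integral>t. indicator A t * max 0 (e * g m t) \<partial>lborel)"
      using integrable_real_mult_indicator [OF _ I, of A e m]
      by (intro nn_integral_eq_integral) (auto simp: mult.commute)
    finally show ?thesis .
  qed
  have mV: "measure (V e m) A = (\<integral>t. indicator A t * max 0 (e * g m t) \<partial>lborel)"
    if "A \<in> sets borel" for e m A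
    using that V [of A e m] by (simp add: measure_def)
  have fin: "finite_borel_measure (V e m)" for e m
  proof -
    interpret finite_measure "V e m" by (rule finite_measureI) (simp add: V)
    show ?thesis by unfold_locales simp
  qed
  have mono: "mono (P e m)" for e m
    unfolding P_def by (intro monoI finite_borel_measure.cdf_nondecreasing [OF fin])
  have rc: "continuous (at_right x) (P e m)" for e m x
    unfolding P_def by (rule finite_borel_measure.cdf_is_right_cont [OF fin])
  have bdd: "0 \<le> P e m x" "P e m x \<le> M" if "\<bar>e\<bar> = 1" for e m x
  proof -
    show "0 \<le> P e m x" by (simp add: P_def cdf_def)
    have "P e m x \<le> measure (V e m) UNIV"
      using finite_borel_measure.cdf_bounded [OF fin, of e m x] by (simp add: P_def)
    also have "\<dots> = (\<integral>t. max 0 (e * g m t) \<partial>lborel)" by (simp add: mV)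
    also have "\<dots> \<le> (\<integral>t. \<bar>g m t\<bar> \<partial>lborel)"
      using that by (intro integral_mono I integrable_abs g) (auto simp: abs_if split: if_splits)
    finally show "P e m x \<le> M" using gM [of m] by simp
  qed
  have hP: "h m r - h m s = (P 1 m r - P 1 m s) - (P (-1) m r - P (-1) m s)"
    if "0 < s" "s \<le> r" "r < R" for m r s
  proof -
    have D: "P e m r - P e m s = (\<integral>t. indicator {s<..r} t * max 0 (e * g m t) \<partial>lborel)" for e
    proof (cases "s = r")
      case False
      then have "P e m r - P e m s = measure (V e m) {s<..r}"
        using that finite_borel_measure.cdf_diff_eq [OF fin, of s r e m] by (simp add: P_def)
      then show ?thesis by (simp add: mV)
    qed simp
    have "h m r - h m s = (\<integral>t. indicator {s..r} t * g m t \<partial>lborel)"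
      using h that by simp
    also have "\<dots> = (\<integral>t. indicator {s<..r} t * max 0 (1 * g m t) - indicator {s<..r} t * max 0 (-1 * g m t) \<partial>lborel)"
    proof (rule integral_cong_AE)
      \<comment> \<open>Differences of distribution functions live on \<open>{s<..r}\<close>,
        whereas the hypothesis integrates over \<open>{s..r}\<close>; the point s is null.\<close>
      have "AE t in lborel. t \<noteq> s" by (rule AE_lborel_singleton)
      then show "AE t in lborel. indicator {s..r} t * g m t =
         indicator {s<..r} t * max 0 (1 * g m t) - indicator {s<..r} t * max 0 (-1 * g m t)"
        by eventually_elim (auto simp: indicator_def)
    qed measurable
    also have "\<dots> = (P 1 m r - P 1 m s) - (P (-1) m r - P (-1) m s)"
    proof -
      have "integrable lborel (\<lambda>t. indicator {s<..r} t * max 0 (e * g m t))" for e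
        using integrable_real_mult_indicator [OF _ I, of "{s<..r}" e m] by (simp add: mult.commute)
      then show ?thesis
        unfolding D by (intro Bochner_Integration.integral_diff)
    qed
    finally show ?thesis .
  qed
  \<comment> \<open>The integration constant, read off at the anchor \<open>c\<close>. It is merged
    into the family \<open>P 1\<close> below, so that two selections are enough.\<close>
  define C where "C m = h m c - (P 1 m c - P (-1) m c)" for m
  have C: "\<bar>C m\<bar> \<le> 3 * M" for m
    using bdd [of 1 m c] bdd [of "-1" m c] hc [of m] by (simp add: C_def)
  have hC: "h m r = C m + P 1 m r - P (-1) m r" if "r \<in> {0<..<R}" for m r
    using hP [of c r m] hP [of r c m] that c by (cases "c \<le> r") (auto simp: C_def)
  have b1: "\<bar>C m + P 1 m x\<bar> \<le> 4 * M" for m x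
    using C [of m] bdd [of 1 m x] by simp
  have m1: "mono (\<lambda>x. C m + P 1 m x)" for m
    using mono [of 1 m] by (simp add: mono_def)
  have r1: "continuous (at_right x) (\<lambda>x. C m + P 1 m x)" for m x
    by (intro continuous_intros rc)
  obtain \<tau>1 F1 where \<tau>1: "strict_mono (\<tau>1 :: nat \<Rightarrow> nat)" and F1: "mono F1"
    and l1: "\<And>x. continuous (at x) F1 \<Longrightarrow> (\<lambda>n. C (\<tau>1 n) + P 1 (\<tau>1 n) x) \<longlonglongrightarrow> F1 x"
    using Helly_selection [of "\<lambda>m x. C m + P 1 m x" "4 * M", OF r1 m1 b1] by blast
  have b2: "\<bar>P (-1) (\<tau>1 m) x\<bar> \<le> M" for m x
    using bdd [of "-1" "\<tau>1 m" x] by simp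
  obtain \<tau>2 F2 where \<tau>2: "strict_mono (\<tau>2 :: nat \<Rightarrow> nat)" and F2: "mono F2"
    and l2: "\<And>x. continuous (at x) F2 \<Longrightarrow> (\<lambda>n. P (-1) (\<tau>1 (\<tau>2 n)) x) \<longlonglongrightarrow> F2 x"
    using Helly_selection [of "\<lambda>m. P (-1) (\<tau>1 m)" M, OF rc mono b2] by blast
  show thesis
  proof (rule that)
    show "strict_mono (\<tau>1 \<circ> \<tau>2)" using \<tau>1 \<tau>2 by (rule strict_mono_o)
    have "AE r in lborel. r \<notin> {x. \<not> isCont F1 x} \<union> {x. \<not> isCont F2 x}"
      using mono_ctble_discont [OF F1] mono_ctble_discont [OF F2]
      by (intro AE_not_in countable_imp_null_set_lborel countable_Un)
    then show "AE r in lborel. r \<in> {0<..<R} \<longrightarrow> (\<lambda>m. h ((\<tau>1 \<circ> \<tau>2) m) r) \<longlonglongrightarrow> F1 r - F2 r"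
    proof eventually_elim
      case (elim r)
      then have "(\<lambda>n. C (\<tau>1 (\<tau>2 n)) + P 1 (\<tau>1 (\<tau>2 n)) r - P (-1) (\<tau>1 (\<tau>2 n)) r) \<longlonglongrightarrow> F1 r - F2 r"
        using LIMSEQ_subseq_LIMSEQ [OF l1 \<tau>2, of r] l2 [of r]
        by (intro tendsto_diff) (auto simp: o_def)
      then show ?case by (auto simp: hC)
    qed
  qed
qed

definition sphere_integral :: "('a::euclidean_space \<Rightarrow> real) \<Rightarrow> real \<Rightarrow> real" where
  "sphere_integral f r = (\<integral>w. f (r *\<^sub>R w) \<partial>cone_measure)"

text \<open>\<open>le_add_powr\<close> with the constant threshold \<open>K\<close>: the first
  summand gives the volume of the ball, the second gives 1.\<close>

lemma nn_integral_ball_le: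
  fixes f :: "'a::euclidean_space \<Rightarrow> real"
  assumes [measurable]: "f \<in> borel_measurable borel" and "p \<ge> 1" "K > 0"
    and fK: "(\<integral>\<^sup>+x\<in>ball 0 R. ennreal (\<bar>f x\<bar> powr p) \<partial>lborel) \<le> ennreal (K powr p)"
  shows "(\<integral>\<^sup>+x\<in>ball 0 R. ennreal \<bar>f x\<bar> \<partial>lborel) \<le> ennreal ((measure lborel (ball (0::'a) R) + 1) * K)"
proof -
  let ?B = "ball (0::'a) R"
  have [measurable]: "?B \<in> sets borel" by simp
  have "(\<integral>\<^sup>+x\<in>?B. ennreal \<bar>f x\<bar> \<partial>lborel) \<le>
      (\<integral>\<^sup>+x. ennreal K * indicator ?B x + ennreal (K powr (1 - p)) * (ennreal (\<bar>f x\<bar> powr p) * indicator ?B x) \<partial>lborel)"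
  proof (rule nn_integral_mono)
    fix x :: 'a
    have "ennreal \<bar>f x\<bar> \<le> ennreal (K + K powr (1 - p) * \<bar>f x\<bar> powr p)"
      using le_add_powr [of "\<bar>f x\<bar>" K p] assms by (intro ennreal_leI) auto
    then show "ennreal \<bar>f x\<bar> * indicator ?B x \<le>
       ennreal K * indicator ?B x + ennreal (K powr (1 - p)) * (ennreal (\<bar>f x\<bar> powr p) * indicator ?B x)"
      using \<open>K > 0\<close> by (auto simp: indicator_def ennreal_mult)
  qed
  also have "\<dots> = ennreal K * emeasure lborel ?B + ennreal (K powr (1 - p)) * (\<integral>\<^sup>+x\<in>?B. ennreal (\<bar>f x\<bar> powr p) \<partial>lborel)"
    by (simp add: nn_integral_add nn_integral_cmult)
  also have "\<dots> \<le> ennreal K * ennreal (measure lborel ?B) + ennreal (K powr (1 - p)) * ennreal (K powr p)"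
    using emeasure_lborel_ball_finite [of "0::'a" R] fK
    by (intro add_mono mult_left_mono) (simp_all add: emeasure_eq_ennreal_measure)
  also have "\<dots> = ennreal ((measure lborel ?B + 1) * K)"
  proof -
    have "K powr (1 - p) * K powr p = K" using \<open>K > 0\<close> by (simp flip: powr_add)
    then show ?thesis using \<open>K > 0\<close> by (simp add: algebra_simps flip: ennreal_mult ennreal_plus)
  qed
  finally show ?thesis .
qed

text \<open>Helly's theorem is applied to the means multiplied by r^N. Without this factor the
  variation near the origin would not be controlled by integrals over the ball. Dividing by r^N
  afterwards is harmless at a fixed r > 0.\<close>

theorem sphere_integral_compact:
  fixes F :: "nat \<Rightarrow> nat \<Rightarrow> 'a::euclidean_space \<Rightarrow> real"
  assumes "p \<ge> 1" "R > 0" "k \<ge> 1" and k: "real DIM('a) / p > real k"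
    and F: "\<And>m. ray_chain_bound k p R K (F m)"
  obtains \<tau> H where "strict_mono (\<tau> :: nat \<Rightarrow> nat)"
    and "AE r in lborel. r \<in> {0<..<R} \<longrightarrow> (\<lambda>m. sphere_integral (F (\<tau> m) 0) r) \<longlonglongrightarrow> H r"
proof -
  interpret ps: pair_sigma_finite lborel "cone_measure :: 'a measure" ..
  define N where "N = DIM('a)"
  have "N \<ge> 1" by (simp add: N_def DIM_positive Suc_leI)
  have "K > 0" using F [of 0] by (simp add: ray_chain_bound_def)
  have rc: "ray_chain R (F m)" for m using F by (simp add: ray_chain_bound_def)
  note [measurable] = ray_chain_measurable [OF rc]
  obtain C where "C \<ge> 0" and
    C0: "\<And>F :: nat \<Rightarrow> 'a \<Rightarrow> real. \<And>K r. ray_chain_bound k p R K F \<Longrightarrow> r \<in> {0<..<R} \<Longrightarrow>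
      sphere_L1 (F 0) r \<le> ennreal (C * K * r powr - (real DIM('a) / p - real k))"
    using radial_lemma [OF \<open>p \<ge> 1\<close> \<open>R > 0\<close> \<open>k \<ge> 1\<close> k] by blast
  note C = C0 [OF F]
  define M1 where "M1 = (measure lborel (ball (0::'a) R) + 1) * K"
  have "M1 \<ge> 0" using \<open>K > 0\<close> by (simp add: M1_def)
  have L1: "(\<integral>\<^sup>+x\<in>ball 0 R. ennreal \<bar>F m j x\<bar> \<partial>lborel) \<le> ennreal M1" if "j \<le> 1" for m j
    using F [of m] \<open>k \<ge> 1\<close> that \<open>p \<ge> 1\<close> unfolding M1_def
    by (intro nn_integral_ball_le) (auto simp: ray_chain_bound_def)
  \<comment> \<open>The radial lemma gives integrability on every sphere and not just on almost
    every one; \<open>hg\<close> below has arbitrary end points.\<close>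
  have int0: "integrable cone_measure (\<lambda>w. F m 0 (r *\<^sub>R w))" if "r \<in> {0<..<R}" for m r
  proof (rule integrableI_bounded)
    show "(\<integral>\<^sup>+ x. ennreal (norm (F m 0 (r *\<^sub>R x))) \<partial>cone_measure) < \<infinity>"
      using C [OF that, of m] by (simp add: sphere_L1_def order.strict_trans1)
  qed measurable
  \<comment> \<open>The derivative of \<open>t ^ N * F m 0 (t *\<^sub>R w)\<close> along the
    ray.\<close>
  define \<Phi> where "\<Phi> m t w = real N * t ^ (N - 1) * F m 0 (t *\<^sub>R w) + t ^ N * F m 1 (t *\<^sub>R w)" for m t w
  have [measurable]: "case_prod (\<Phi> m) \<in> borel_measurable (lborel \<Otimes>\<^sub>M cone_measure)" for m
    unfolding \<Phi>_def by measurable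
  \<comment> \<open>From t^N \<le> (R/N) * N t^(N-1): the second summand of \<Phi> costs the factor
    R/N relative to the polar density.\<close>
  define M2 where "M2 = M1 + R / real N * M1"
  let ?\<Phi> = "\<lambda>m z. indicator {0<..<R} (fst z) * \<Phi> m (fst z) (snd z)"
  let ?I = "\<lambda>m. \<integral>\<^sup>+z. ennreal \<bar>?\<Phi> m z\<bar> \<partial>(lborel \<Otimes>\<^sub>M cone_measure)"
  have nn: "?I m \<le> ennreal M2" for m
  proof -
    let ?w = "\<lambda>t. ennreal (real N * t ^ (N - 1))"
    have pt: "ennreal \<bar>indicator {0<..<R} t * \<Phi> m t w\<bar> \<le> ?w t * ennreal \<bar>F m 0 (t *\<^sub>R w)\<bar> * indicator {0<..<R} t
          + ennreal (R / real N) * (?w t * ennreal \<bar>F m 1 (t *\<^sub>R w)\<bar> * indicator {0<..<R} t)" for t w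
    proof (cases "t \<in> {0<..<R}")
      case True
      have "t ^ N = t * t ^ (N - 1)" using \<open>N \<ge> 1\<close> by (cases N) auto
      also have "\<dots> \<le> R * t ^ (N - 1)" using True by (intro mult_right_mono) auto
      finally have "t ^ N * \<bar>F m 1 (t *\<^sub>R w)\<bar> \<le> R * t ^ (N - 1) * \<bar>F m 1 (t *\<^sub>R w)\<bar>"
        by (intro mult_right_mono) auto
      then have "\<bar>\<Phi> m t w\<bar> \<le> real N * t ^ (N - 1) * \<bar>F m 0 (t *\<^sub>R w)\<bar> + R / real N * (real N * t ^ (N - 1) * \<bar>F m 1 (t *\<^sub>R w)\<bar>)"
        using True \<open>N \<ge> 1\<close> unfolding \<Phi>_def
        by (intro order_trans [OF abs_triangle_ineq]) (simp add: abs_mult)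
      then show ?thesis
        using True \<open>R > 0\<close> by (simp flip: ennreal_mult ennreal_plus)
    qed simp
    have "?I m
       = (\<integral>\<^sup>+t. \<integral>\<^sup>+w. ennreal \<bar>indicator {0<..<R} t * \<Phi> m t w\<bar> \<partial>cone_measure \<partial>lborel)"
      by (subst cone.nn_integral_fst [symmetric]) (auto simp: case_prod_beta')
    also have "\<dots> \<le> (\<integral>\<^sup>+t. \<integral>\<^sup>+w. ?w t * ennreal \<bar>F m 0 (t *\<^sub>R w)\<bar> * indicator {0<..<R} t
          + ennreal (R / real N) * (?w t * ennreal \<bar>F m 1 (t *\<^sub>R w)\<bar> * indicator {0<..<R} t) \<partial>cone_measure \<partial>lborel)"
      by (intro nn_integral_mono pt)
    also have "\<dots> = (\<integral>\<^sup>+t\<in>{0<..<R}. ?w t * (\<integral>\<^sup>+w. ennreal \<bar>F m 0 (t *\<^sub>R w)\<bar> \<partial>cone_measure) \<partial>lborel)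
        + ennreal (R / real N) * (\<integral>\<^sup>+t\<in>{0<..<R}. ?w t * (\<integral>\<^sup>+w. ennreal \<bar>F m 1 (t *\<^sub>R w)\<bar> \<partial>cone_measure) \<partial>lborel)"
      by (simp add: nn_integral_add nn_integral_cmult nn_integral_multc)
    also have "\<dots> = (\<integral>\<^sup>+x\<in>ball 0 R. ennreal \<bar>F m 0 x\<bar> \<partial>lborel) + ennreal (R / real N) * (\<integral>\<^sup>+x\<in>ball 0 R. ennreal \<bar>F m 1 x\<bar> \<partial>lborel)"
      using \<open>R > 0\<close> by (simp add: nn_integral_polar N_def)
    also have "\<dots> \<le> ennreal M1 + ennreal (R / real N) * ennreal M1"
      by (intro add_mono mult_left_mono L1) auto
    also have "\<dots> = ennreal M2"
      using \<open>M1 \<ge> 0\<close> \<open>R > 0\<close> by (simp add: M2_def flip: ennreal_mult ennreal_plus)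
    finally show ?thesis .
  qed
  have int\<Phi>: "integrable (lborel \<Otimes>\<^sub>M cone_measure) (?\<Phi> m)" for m
  proof (rule integrableI_bounded)
    show "(\<integral>\<^sup>+z. ennreal (norm (indicator {0<..<R} (fst z) * \<Phi> m (fst z) (snd z))) \<partial>(lborel \<Otimes>\<^sub>M cone_measure)) < \<infinity>"
      using nn [of m] by (simp add: order.strict_trans1)
  qed measurable
  define g where "g m t = (\<integral>w. indicator {0<..<R} t * \<Phi> m t w \<partial>cone_measure)" for m t
  define h where "h m r = r ^ N * sphere_integral (F m 0) r" for m r
  have g: "integrable lborel (g m)" for m
    using ps.integrable_fst' [OF int\<Phi> [of m]] by (simp add: g_def [abs_def])
  have gM: "(\<integral>t. \<bar>g m t\<bar> \<partial>lborel) \<le> M2" for m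
  proof -
    have "ennreal (\<integral>t. \<bar>g m t\<bar> \<partial>lborel) = (\<integral>\<^sup>+t. ennreal \<bar>g m t\<bar> \<partial>lborel)"
      using g by (subst nn_integral_eq_integral) auto
    also have "\<dots> \<le> (\<integral>\<^sup>+t. \<integral>\<^sup>+w. ennreal \<bar>indicator {0<..<R} t * \<Phi> m t w\<bar> \<partial>cone_measure \<partial>lborel)"
    proof (rule nn_integral_mono_AE)
      from ps.AE_integrable_fst' [OF int\<Phi> [of m]]
      show "AE t in lborel. ennreal \<bar>g m t\<bar> \<le> (\<integral>\<^sup>+w. ennreal \<bar>indicator {0<..<R} t * \<Phi> m t w\<bar> \<partial>cone_measure)"
      proof eventually_elim
        case (elim t)
        then show ?case
          using integral_norm_bound_ennreal [of cone_measure "\<lambda>w. indicator {0<..<R} t * \<Phi> m t w"] by (simp add: g_def)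
      qed
    qed
    also have "\<dots> = ?I m"
      by (subst cone.nn_integral_fst [symmetric]) (auto simp: case_prod_beta')
    also have "\<dots> \<le> ennreal M2" by (rule nn)
    finally show ?thesis
      using \<open>M1 \<ge> 0\<close> \<open>R > 0\<close> by (subst (asm) ennreal_le_iff) (auto simp: M2_def)
  qed
  have hg: "h m r - h m s = (\<integral>t. indicator {s..r} t * g m t \<partial>lborel)" if "0 < s" "s \<le> r" "r < R" for m r s
  proof -
    have sr: "s \<in> {0<..<R}" "r \<in> {0<..<R}" using that by auto
    have "h m r - h m s = (\<integral>w. r ^ N * F m 0 (r *\<^sub>R w) - s ^ N * F m 0 (s *\<^sub>R w) \<partial>cone_measure)"
      using int0 [OF sr(1)] int0 [OF sr(2)] by (simp add: h_def sphere_integral_def)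
    also have "\<dots> = (\<integral>w. (\<integral>t. indicator {s..r} t * \<Phi> m t w \<partial>lborel) \<partial>cone_measure)"
    proof (rule integral_cong_AE)
      show "AE w in cone_measure. r ^ N * F m 0 (r *\<^sub>R w) - s ^ N * F m 0 (s *\<^sub>R w) =
            (\<integral>t. indicator {s..r} t * \<Phi> m t w \<partial>lborel)"
        using AE_cone_measure_norm
      proof eventually_elim
        case (elim w)
        have d: "((\<lambda>t. F m j (t *\<^sub>R w)) has_real_derivative F m (Suc j) (t *\<^sub>R w)) (at t)" if "s \<le> t" "t \<le> r" for j t
          using rc [of m] elim that \<open>0 < s\<close> \<open>r < R\<close> by (auto simp: ray_chain_def)
        have c: "continuous_on {s..r} (\<lambda>t. F m j (t *\<^sub>R w))" for j
          by (intro continuous_at_imp_continuous_on ballI DERIV_isCont [OF d]) auto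
        have d2: "((\<lambda>t. t ^ N * F m 0 (t *\<^sub>R w)) has_real_derivative \<Phi> m t w) (at t)" if "s \<le> t" "t \<le> r" for t
          by (rule DERIV_cong [OF DERIV_mult [OF DERIV_pow [of N t] d [OF that, of 0]]]) (simp add: \<Phi>_def)
        have "(\<integral>t. indicator {s..r} t *\<^sub>R \<Phi> m t w \<partial>lborel) = r ^ N * F m 0 (r *\<^sub>R w) - s ^ N * F m 0 (s *\<^sub>R w)"
        proof (rule integral_FTC_atLeastAtMost [OF \<open>s \<le> r\<close>])
          show "((\<lambda>t. t ^ N * F m 0 (t *\<^sub>R w)) has_vector_derivative \<Phi> m t w) (at t within {s..r})" if "s \<le> t" "t \<le> r" for t
            using d2 [OF that] by (simp add: has_real_derivative_iff_has_vector_derivative has_vector_derivative_at_within)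
          show "continuous_on {s..r} (\<lambda>t. \<Phi> m t w)"
            unfolding \<Phi>_def by (intro continuous_intros c)
        qed
        then show ?case by simp
      qed
    qed measurable
    also have "\<dots> = (\<integral>t. (\<integral>w. indicator {s..r} t * \<Phi> m t w \<partial>cone_measure) \<partial>lborel)"
    proof (rule ps.Fubini_integral)
      have "integrable (lborel \<Otimes>\<^sub>M cone_measure) (\<lambda>z. indicator ({s..r} \<times> UNIV) z *\<^sub>R (indicator {0<..<R} (fst z) * \<Phi> m (fst z) (snd z)))"
        by (intro integrable_mult_indicator int\<Phi>) (auto intro!: pair_measureI)
      moreover have "(\<lambda>z. indicator ({s..r} \<times> UNIV) z *\<^sub>R (indicator {0<..<R} (fst z) * \<Phi> m (fst z) (snd z)))
         = (\<lambda>(t, w). indicator {s..r} t * \<Phi> m t w)"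
        using that by (auto simp: fun_eq_iff indicator_def)
      ultimately show "integrable (lborel \<Otimes>\<^sub>M cone_measure) (\<lambda>(t, w). indicator {s..r} t * \<Phi> m t w)"
        by simp
    qed
    also have "\<dots> = (\<integral>t. indicator {s..r} t * g m t \<partial>lborel)"
      using that by (intro Bochner_Integration.integral_cong) (auto simp: g_def indicator_def)
    finally show ?thesis .
  qed
  define c where "c = R / 2"
  have c: "0 < c" "c < R" using \<open>R > 0\<close> by (auto simp: c_def)
  define M3 where "M3 = c ^ N * (C * K * c powr - (real DIM('a) / p - real k))"
  have hc: "\<bar>h m c\<bar> \<le> M3" for m
  proof -
    have "ennreal \<bar>sphere_integral (F m 0) c\<bar> \<le> sphere_L1 (F m 0) c"
      using integral_norm_bound_ennreal [OF int0, of c m] c by (simp add: sphere_integral_def sphere_L1_def)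
    also have "\<dots> \<le> ennreal (C * K * c powr - (real DIM('a) / p - real k))"
      using C c by simp
    finally have "\<bar>sphere_integral (F m 0) c\<bar> \<le> C * K * c powr - (real DIM('a) / p - real k)"
      using \<open>C \<ge> 0\<close> \<open>K > 0\<close> by (subst (asm) ennreal_le_iff) auto
    then show ?thesis using c by (auto simp: h_def M3_def abs_mult intro!: mult_left_mono)
  qed
  have M: "(\<integral>t. \<bar>g m t\<bar> \<partial>lborel) \<le> max M2 M3" "\<bar>h m c\<bar> \<le> max M2 M3" for m
    using gM [of m] hc [of m] by auto
  obtain \<tau> H where \<tau>: "strict_mono (\<tau> :: nat \<Rightarrow> nat)"
    and H: "AE r in lborel. r \<in> {0<..<R} \<longrightarrow> (\<lambda>m. h (\<tau> m) r) \<longlonglongrightarrow> H r"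
    by (rule helly_absolutely_continuous [OF g M(1) hg c M(2)])
  have "AE r in lborel. r \<in> {0<..<R} \<longrightarrow> (\<lambda>m. sphere_integral (F (\<tau> m) 0) r) \<longlonglongrightarrow> H r / r ^ N"
    using H
  proof eventually_elim
    case (elim r)
    show ?case
    proof
      assume r: "r \<in> {0<..<R}"
      then have "(\<lambda>m. h (\<tau> m) r / r ^ N) \<longlonglongrightarrow> H r / r ^ N"
        using elim by (intro tendsto_divide) auto
      then show "(\<lambda>m. sphere_integral (F (\<tau> m) 0) r) \<longlonglongrightarrow> H r / r ^ N"
        using r by (simp add: h_def)
    qed
  qed
  with \<tau> show thesis by (rule that)
qed

section \<open>Calculus of smooth functions\<close>

lemma partial_eqI: "(f has_derivative D) (at x) \<Longrightarrow> partial i f x = D (axis i 1)"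
  unfolding partial_def by (metis frechet_derivative_at)

lemma has_derivative_cong_open:
  assumes "open U" "x \<in> U" "\<And>y. y \<in> U \<Longrightarrow> f y = g y"
  shows "(f has_derivative D) (at x) \<longleftrightarrow> (g has_derivative D) (at x)"
  using assms has_derivative_transform_within_open [of f D x UNIV U g] has_derivative_transform_within_open [of g D x UNIV U f]
  by auto

lemma differentiable_cong_open:
  assumes "open U" "x \<in> U" "\<And>y. y \<in> U \<Longrightarrow> f y = g y"
  shows "f differentiable (at x) \<longleftrightarrow> g differentiable (at x)"
  by (simp add: differentiable_def has_derivative_cong_open [OF assms])

lemma partial_cong_open:
  assumes "open U" "x \<in> U" "\<And>y. y \<in> U \<Longrightarrow> f y = g y"
  shows "partial i f x = partial i g x"
  by (simp add: partial_def frechet_derivative_def has_derivative_cong_open [OF assms])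

lemma partial_const [simp]: "partial i (\<lambda>_. c) x = 0"
  by (subst partial_eqI) (auto intro: has_derivative_const)

lemma partial_component: "partial i (\<lambda>y. y $ j) x = (if i = j then 1 else 0)"
proof -
  have "((\<lambda>y. y $ j) has_derivative (\<lambda>y. y $ j)) (at x)"
    by (intro bounded_linear.has_derivative [OF bounded_linear_vec_nth]) (rule has_derivative_ident)
  from partial_eqI [OF this, of i] show ?thesis by (simp add: axis_def eq_commute)
qed

lemma partial_add:
  assumes "f differentiable (at x)" "g differentiable (at x)"
  shows "partial i (\<lambda>y. f y + g y) x = partial i f x + partial i g x"
  using partial_eqI [OF has_derivative_add [OF assms [THEN frechet_derivative_works [THEN iffD1]]], of i] by (simp add: partial_def)

lemma partial_mult:
  assumes "f differentiable (at x)" "g differentiable (at x)"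
  shows "partial i (\<lambda>y. f y * g y) x = partial i f x * g x + f x * partial i g x"
  using partial_eqI [OF has_derivative_mult [OF assms [THEN frechet_derivative_works [THEN iffD1]]], of i] by (simp add: partial_def)

lemma partial_sum:
  assumes "\<And>a. a \<in> A \<Longrightarrow> f a differentiable (at x)"
  shows "partial i (\<lambda>y. \<Sum>a\<in>A. f a y) x = (\<Sum>a\<in>A. partial i (f a) x)"
  using partial_eqI [OF has_derivative_sum [OF assms [THEN frechet_derivative_works [THEN iffD1]]], where i = i] by (simp add: partial_def)

lemma partial_inverse:
  assumes "f differentiable (at x)" "f x \<noteq> 0"
  shows "partial i (\<lambda>y. inverse (f y)) x = - (partial i f x * (inverse (f x) * inverse (f x)))"
  using partial_eqI [OF Deriv.has_derivative_inverse [OF assms(2) assms(1) [THEN frechet_derivative_works [THEN iffD1]]], of i]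
  by (simp add: partial_def mult_ac)

lemma norm_has_derivative:
  fixes x :: "'a::real_inner"
  assumes "x \<noteq> 0"
  shows "(norm has_derivative (\<lambda>h. (x \<bullet> h) / norm x)) (at x)"
  using has_derivative_norm [OF assms] by (simp add: sgn_div_norm divide_inverse inner_commute mult.commute)

lemma compose_norm_has_derivative:
  fixes x :: "'a::real_inner"
  assumes "x \<noteq> 0" and "(h has_real_derivative h') (at (norm x))"
  shows "((\<lambda>y. h (norm y)) has_derivative (\<lambda>v. h' * ((x \<bullet> v) / norm x))) (at x)"
  using has_derivative_compose [OF norm_has_derivative [OF assms(1)] assms(2) [unfolded has_field_derivative_def]]
  by simp

lemma partial_compose_norm:
  assumes "x \<noteq> 0" and "(h has_real_derivative h') (at (norm x))"
  shows "partial i (\<lambda>y. h (norm y)) x = h' * (x $ i / norm x)"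
  using partial_eqI [OF compose_norm_has_derivative [OF assms], of i] by (simp add: inner_axis)

lemma frechet_derivative_eq_sum_partial:
  assumes "f differentiable (at x)"
  shows "frechet_derivative f (at x) v = (\<Sum>i\<in>UNIV. v $ i * partial i f x)"
proof -
  have l: "linear (frechet_derivative f (at x))"
    by (rule linear_frechet_derivative [OF assms])
  have "frechet_derivative f (at x) v = frechet_derivative f (at x) (\<Sum>i\<in>UNIV. v $ i *\<^sub>R axis i 1)"
    by (metis basis_expansion scalar_mult_eq_scaleR)
  also have "\<dots> = (\<Sum>i\<in>UNIV. v $ i * partial i f x)"
    by (simp add: linear_sum [OF l] linear_cmul [OF l] partial_def)
  finally show ?thesis .
qed

text \<open>Smoothness is \<open>ck n\<close> for all \<open>n\<close>. The closure properties are
  proved for \<open>ck n\<close> by induction on \<open>n\<close>, for which the iterated partial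
  derivatives in \<open>smooth_on\<close> give no handle. Note that \<open>ck 0\<close> already
  demands differentiability.\<close>

primrec ck :: "nat \<Rightarrow> (real^'n::finite) set \<Rightarrow> (real^'n \<Rightarrow> real) \<Rightarrow> bool" where
  "ck 0 U f \<longleftrightarrow> (\<forall>x\<in>U. f differentiable (at x))"
| "ck (Suc n) U f \<longleftrightarrow> (\<forall>x\<in>U. f differentiable (at x)) \<and> (\<forall>i. ck n U (partial i f))"

lemma smooth_on_partial: "smooth_on U f \<Longrightarrow> smooth_on U (partial i f)"
  unfolding smooth_on_def
proof (intro allI ballI)
  fix "is" x assume "\<forall>is. \<forall>x\<in>U. foldr partial is f differentiable (at x)" "x \<in> U"
  then have "foldr partial (is @ [i]) f differentiable (at x)" by blast
  then show "foldr partial is (partial i f) differentiable (at x)" by simp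
qed

lemma smooth_on_differentiable: "smooth_on U f \<Longrightarrow> x \<in> U \<Longrightarrow> f differentiable (at x)"
  unfolding smooth_on_def by (auto dest: spec [of _ "[]"])

lemma smooth_on_subset: "smooth_on U f \<Longrightarrow> V \<subseteq> U \<Longrightarrow> smooth_on V f"
  by (auto simp: smooth_on_def)

lemma smooth_on_imp_ck: "smooth_on U f \<Longrightarrow> ck n U f"
  by (induction n arbitrary: f) (auto simp: smooth_on_differentiable smooth_on_partial)

lemma smooth_on_ckI:
  assumes "\<And>n. ck n U f"
  shows "smooth_on U f"
proof -
  have "\<forall>x\<in>U. foldr partial is f differentiable (at x)" if "\<forall>n. ck n U f" for "is"
    using that
  \<comment> \<open>\<open>foldr\<close> applies the last index of the list first, so splitting off
    the last element replaces \<open>f\<close> by one of its partial derivatives.\<close>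
  proof (induction "is" arbitrary: f rule: rev_induct)
    case Nil
    then show ?case by (auto dest: spec [of _ 0])
  next
    case (snoc i "is")
    from snoc.prems have "\<forall>n. ck n U (partial i f)" by (metis ck.simps(2))
    from snoc.IH [OF this] show ?case by simp
  qed
  then show ?thesis using assms by (simp add: smooth_on_def)
qed

lemma ck_SucD: "ck (Suc n) U f \<Longrightarrow> ck n U f"
  by (induction n arbitrary: f) auto

lemma ck_cong:
  assumes "open U" "\<And>y. y \<in> U \<Longrightarrow> f y = g y"
  shows "ck n U f \<longleftrightarrow> ck n U g"
  using assms(2)
proof (induction n arbitrary: f g)
  case 0
  then show ?case using differentiable_cong_open [OF \<open>open U\<close>, of _ f g] by auto
next
  case (Suc n)
  have "ck n U (partial i f) \<longleftrightarrow> ck n U (partial i g)" for i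
    by (rule Suc.IH) (auto intro!: partial_cong_open [OF \<open>open U\<close>] Suc.prems)
  then show ?case using differentiable_cong_open [OF \<open>open U\<close>, of _ f g] Suc.prems by auto
qed

lemma ck_add:
  assumes "open U"
  shows "ck n U f \<Longrightarrow> ck n U g \<Longrightarrow> ck n U (\<lambda>x. f x + g x)"
proof (induction n arbitrary: f g)
  case (Suc n)
  have "ck n U (partial i (\<lambda>x. f x + g x))" for i
    using Suc.prems Suc.IH [of "partial i f" "partial i g"]
    by (subst ck_cong [OF assms partial_add]) auto
  then show ?case using Suc.prems by auto
qed auto

lemma ck_mult:
  assumes "open U"
  shows "ck n U f \<Longrightarrow> ck n U g \<Longrightarrow> ck n U (\<lambda>x. f x * g x)"
proof (induction n arbitrary: f g)
  case (Suc n)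
  have "ck n U (partial i (\<lambda>x. f x * g x))" for i
    using Suc.prems Suc.IH [of "partial i f" g] Suc.IH [of f "partial i g"]
      ck_SucD [OF Suc.prems(1)] ck_SucD [OF Suc.prems(2)]
    by (subst ck_cong [OF assms partial_mult]) (auto intro!: ck_add assms)
  then show ?case using Suc.prems by (auto intro!: differentiable_mult)
qed (auto intro!: differentiable_mult)

lemma smooth_on_cong: "open U \<Longrightarrow> (\<And>y. y \<in> U \<Longrightarrow> f y = g y) \<Longrightarrow> smooth_on U f \<Longrightarrow> smooth_on U g"
  by (metis ck_cong smooth_on_ckI smooth_on_imp_ck)

lemma smooth_on_const: "smooth_on U (\<lambda>_. c)"
proof (rule smooth_on_ckI)
  fix n show "ck n U (\<lambda>_. c)"
  proof (induction n arbitrary: c)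
    case (Suc n)
    have "partial i (\<lambda>_. c) = (\<lambda>_. 0)" for i :: 'a by (rule ext) simp
    then show ?case using Suc [of 0] by simp
  qed simp
qed

lemma smooth_on_component: "smooth_on U (\<lambda>x::real^'n. x $ j)"
proof (rule smooth_on_ckI)
  have d: "(\<lambda>x::real^'n. x $ j) differentiable (at x)" for x
    by (rule differentiableI [OF bounded_linear.has_derivative [OF bounded_linear_vec_nth has_derivative_ident]])
  fix n show "ck n U (\<lambda>x. x $ j)"
  proof (cases n)
    case (Suc m)
    have "partial i (\<lambda>x. x $ j) = (\<lambda>_. if i = j then 1 else 0)" for i :: 'n
      by (rule ext) (rule partial_component)
    then show ?thesis using d Suc by (auto simp: smooth_on_imp_ck [OF smooth_on_const])
  qed (use d in simp)
qed

lemma smooth_on_add: "open U \<Longrightarrow> smooth_on U f \<Longrightarrow> smooth_on U g \<Longrightarrow> smooth_on U (\<lambda>x. f x + g x)"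
  by (rule smooth_on_ckI, rule ck_add; simp add: smooth_on_imp_ck)

lemma smooth_on_mult: "open U \<Longrightarrow> smooth_on U f \<Longrightarrow> smooth_on U g \<Longrightarrow> smooth_on U (\<lambda>x. f x * g x)"
  by (rule smooth_on_ckI, rule ck_mult; simp add: smooth_on_imp_ck)

lemma smooth_on_diff: "open U \<Longrightarrow> smooth_on U f \<Longrightarrow> smooth_on U g \<Longrightarrow> smooth_on U (\<lambda>x. f x - g x)"
  using smooth_on_add [of U f "\<lambda>x. - 1 * g x"] smooth_on_mult [of U "\<lambda>_. - 1" g] smooth_on_const [of U "- 1"]
  by simp

lemma smooth_on_sum: "open U \<Longrightarrow> (\<And>a. a \<in> A \<Longrightarrow> smooth_on U (f a)) \<Longrightarrow> smooth_on U (\<lambda>x. \<Sum>a\<in>A. f a x)"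
  by (induction A rule: infinite_finite_induct) (auto intro!: smooth_on_const smooth_on_add)

text \<open>The partial derivatives of the reciprocal are polynomials in the reciprocal and the
  partial derivatives of \<open>f\<close>, so the claim at order n yields the one at n + 1.\<close>

lemma ck_inverse:
  assumes "open U" and nz: "\<And>x. x \<in> U \<Longrightarrow> f x \<noteq> 0"
  shows "ck n U f \<Longrightarrow> ck n U (\<lambda>x. inverse (f x))"
proof (induction n)
  case 0
  then show ?case using nz by (auto intro!: differentiable_inverse)
next
  case (Suc n)
  have IH: "ck n U (\<lambda>x. inverse (f x))" by (rule Suc.IH [OF ck_SucD [OF Suc.prems]])
  have "ck n U (\<lambda>x. - 1 * (partial i f x * (inverse (f x) * inverse (f x))))" for i
    using IH Suc.prems by (intro ck_mult assms smooth_on_imp_ck [OF smooth_on_const]) auto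
  then have "ck n U (partial i (\<lambda>x. inverse (f x)))" for i
    using Suc.prems nz by (subst ck_cong [OF assms(1) partial_inverse]) auto
  then show ?case using Suc.prems nz by (auto intro!: differentiable_inverse)
qed

lemma smooth_on_inverse:
  "open U \<Longrightarrow> (\<And>x. x \<in> U \<Longrightarrow> f x \<noteq> 0) \<Longrightarrow> smooth_on U f \<Longrightarrow> smooth_on U (\<lambda>x. inverse (f x))"
  by (rule smooth_on_ckI, rule ck_inverse; simp add: smooth_on_imp_ck)

lemma differentiable_compose_norm:
  fixes x :: "'a::real_inner"
  assumes "x \<noteq> 0" and "(h has_real_derivative h') (at (norm x))"
  shows "(\<lambda>y. h (norm y)) differentiable (at x)"
  using compose_norm_has_derivative [OF assms] by (auto simp: differentiable_def)

text \<open>Bootstrapping again: the partial derivatives of the norm are coordinates times the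
  reciprocal of the norm.\<close>

lemma smooth_on_norm:
  assumes "open U" "0 \<notin> U"
  shows "smooth_on U (norm :: real^'n \<Rightarrow> real)"
proof (rule smooth_on_ckI)
  have d: "(norm :: real^'n \<Rightarrow> real) differentiable (at x)" if "x \<in> U" for x
    using that assms by (intro differentiable_compose_norm [of x "\<lambda>t. t" 1]) (auto intro!: DERIV_ident)
  fix n show "ck n U (norm :: real^'n \<Rightarrow> real)"
  proof (induction n)
    case (Suc n)
    have "partial i (norm :: real^'n \<Rightarrow> real) x = x $ i * inverse (norm x)" if "x \<in> U" for i x
      using that assms partial_compose_norm [of x "\<lambda>t. t" 1 i] by (auto simp: divide_inverse)
    moreover have "ck n U (\<lambda>x. x $ i * inverse (norm x))" for i
      using assms by (intro ck_mult ck_inverse Suc smooth_on_imp_ck [OF smooth_on_component]) auto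
    ultimately have "ck n U (partial i (norm :: real^'n \<Rightarrow> real))" for i
      by (subst ck_cong [OF assms(1)]) auto
    then show ?case using d by simp
  qed (use d in simp)
qed

text \<open>The profile comes with the sequence \<open>h\<close> of its successive derivatives,
  because a partial derivative of \<open>h j (norm x)\<close> involves
  \<open>h (Suc j) (norm x)\<close>; the induction is over all \<open>j\<close> at once.\<close>

lemma smooth_on_compose_norm:
  assumes "open U" "0 \<notin> U"
    and h: "\<And>j x. x \<in> U \<Longrightarrow> (h j has_real_derivative h (Suc j) (norm x)) (at (norm x))"
  shows "smooth_on U (\<lambda>x. h j (norm x))"
proof (rule smooth_on_ckI)
  have d: "(\<lambda>y. h j (norm y)) differentiable (at x)" if "x \<in> U" for x j
    using that assms(2) by (intro differentiable_compose_norm [OF _ h]) auto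
  fix n show "ck n U (\<lambda>x. h j (norm x))"
  proof (induction n arbitrary: j)
    case (Suc n)
    have "partial i (\<lambda>x. h j (norm x)) x = h (Suc j) (norm x) * (x $ i * inverse (norm x))" if "x \<in> U" for i x
      using that assms(2) partial_compose_norm [of x "h j" "h (Suc j) (norm x)" i] h [of x j] by (auto simp: divide_inverse)
    moreover have "ck n U (\<lambda>x. h (Suc j) (norm x) * (x $ i * inverse (norm x)))" for i
      using assms by (intro ck_mult ck_inverse Suc smooth_on_imp_ck [OF smooth_on_component]
          smooth_on_imp_ck [OF smooth_on_norm]) auto
    ultimately have "ck n U (partial i (\<lambda>x. h j (norm x)))" for i
      by (subst ck_cong [OF assms(1)]) auto
    then show ?case using d by simp
  qed (use d in simp)
qed

lemma smooth_on_continuous_on: "smooth_on U f \<Longrightarrow> continuous_on U f"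
  by (intro continuous_at_imp_continuous_on ballI differentiable_imp_continuous_within)
    (rule smooth_on_differentiable)

section \<open>Radial directions and the warped metric\<close>

text \<open>The Cartesian components of the radial unit vector and equally of the covector dr, since
  the warped metric maps the one to the other (\<open>g_dir\<close>). At the origin it is 0 by the
  convention on division.\<close>

definition dir :: "'n::finite \<Rightarrow> real^'n \<Rightarrow> real" where
  "dir i x = x $ i / norm x"

lemma sum_dir_dir: "x \<noteq> 0 \<Longrightarrow> (\<Sum>i\<in>UNIV. dir i x * dir i x) = 1"
proof -
  assume "x \<noteq> 0"
  have "(\<Sum>i\<in>UNIV. dir i x * dir i x) = (x \<bullet> x) / (norm x)\<^sup>2"
    by (simp add: dir_def inner_vec_def sum_divide_distrib power2_eq_square)
  then show ?thesis using \<open>x \<noteq> 0\<close> by (simp add: power2_norm_eq_inner)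
qed

lemma dir_scaleR: "t > 0 \<Longrightarrow> norm w = 1 \<Longrightarrow> dir i (t *\<^sub>R w) = w $ i"
  by (simp add: dir_def)

lemma smooth_on_dir:
  assumes "open U" "0 \<notin> U"
  shows "smooth_on U (dir i)"
proof -
  have "smooth_on U (\<lambda>x::real^'a. x $ i * inverse (norm x))"
    using assms by (intro smooth_on_mult smooth_on_inverse smooth_on_norm smooth_on_component) auto
  then show ?thesis by (simp add: dir_def [abs_def] divide_inverse)
qed

lemma partial_dir:
  assumes "x \<noteq> 0"
  shows "partial i (dir j) x = ((if i = j then 1 else 0) - dir i x * dir j x) / norm x"
proof -
  have inv: "((\<lambda>t. inverse t) has_real_derivative - inverse (norm x ^ 2)) (at (norm x))"
    using assms by (auto intro!: derivative_eq_intros simp: power2_eq_square)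
  have "partial i (dir j) x = partial i (\<lambda>x. x $ j * inverse (norm x)) x"
    by (simp add: dir_def [abs_def] divide_inverse)
  also have "\<dots> = partial i (\<lambda>x. x $ j) x * inverse (norm x) + x $ j * partial i (\<lambda>x. inverse (norm x)) x"
    using assms inv by (intro partial_mult differentiable_compose_norm
      smooth_on_differentiable [OF smooth_on_component UNIV_I]) auto
  also have "partial i (\<lambda>x. inverse (norm x)) x = - inverse (norm x ^ 2) * (x $ i / norm x)"
    by (rule partial_compose_norm [OF assms inv])
  also have "partial i (\<lambda>x. x $ j) x * inverse (norm x) + x $ j * (- inverse (norm x ^ 2) * (x $ i / norm x))
      = ((if i = j then 1 else 0) - dir i x * dir j x) / norm x"
    unfolding partial_component using assms by (simp add: dir_def field_simps power2_eq_square)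
  finally show ?thesis .
qed

lemma sum_mult_delta:
  fixes f :: "'a::finite \<Rightarrow> real"
  shows "(\<Sum>k\<in>UNIV. f k * (if k = j then 1 else 0)) = f j"
    and "(\<Sum>k\<in>UNIV. (if j = k then 1 else 0) * f k) = f j"
  by (simp_all add: if_distrib [of "\<lambda>c. _ * c"] if_distrib [of "\<lambda>c. c * _"] cong: if_cong)

text \<open>The radial unit vector is constant along rays; the formula in \<open>partial_dir\<close>
  is the projection onto the tangential directions, which annihilates it.\<close>

lemma sum_dir_partial_dir:
  assumes "x \<noteq> 0"
  shows "(\<Sum>i\<in>UNIV. dir i x * partial i (dir j) x) = 0"
proof -
  have "(\<Sum>i\<in>UNIV. dir i x * partial i (dir j) x) =
      ((\<Sum>i\<in>UNIV. dir i x * (if i = j then 1 else 0)) - dir j x * (\<Sum>i\<in>UNIV. dir i x * dir i x)) / norm x"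
    by (simp add: partial_dir [OF assms] sum_divide_distrib sum_distrib_left sum_subtractf [symmetric]
        algebra_simps diff_divide_distrib)
  then show ?thesis using sum_dir_dir [OF assms] by (simp add: sum_mult_delta)
qed

text \<open>With P the orthogonal projection onto the radial line this is P + a (1 - P): eigenvalue
  1 radially and \<open>a\<close> tangentially. Such matrices multiply by multiplying their
  parameters, so inverses and square roots are explicit.\<close>

definition radial_mat :: "real \<Rightarrow> real^'n::finite \<Rightarrow> real^'n^'n" where
  "radial_mat a x = (\<chi> i j. dir i x * dir j x + a * ((if i = j then 1 else 0) - dir i x * dir j x))"

lemma radial_mat_nth:
  "radial_mat a x $ i $ j = (1 - a) * (dir i x * dir j x) + a * (if i = j then 1 else 0)"
  by (simp add: radial_mat_def algebra_simps)

lemma radial_mat_sym: "radial_mat a x $ i $ j = radial_mat a x $ j $ i"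
  by (simp add: radial_mat_nth mult.commute eq_commute)

lemma radial_mat_1: "radial_mat 1 x = mat 1"
  by (simp add: radial_mat_def mat_def vec_eq_iff)

lemma radial_mat_dir:
  assumes "x \<noteq> 0"
  shows "(\<Sum>j\<in>UNIV. radial_mat a x $ i $ j * dir j x) = dir i x"
proof -
  have "(\<Sum>j\<in>UNIV. radial_mat a x $ i $ j * dir j x) =
     (1 - a) * dir i x * (\<Sum>j\<in>UNIV. dir j x * dir j x) + a * (\<Sum>j\<in>UNIV. (if i = j then 1 else 0) * dir j x)"
    by (simp add: radial_mat_nth distrib_left distrib_right sum.distrib sum_distrib_left mult_ac)
  then show ?thesis unfolding sum_dir_dir [OF assms] sum_mult_delta by (simp add: algebra_simps)
qed

lemma radial_mat_mult:
  assumes "x \<noteq> 0"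
  shows "radial_mat a x ** radial_mat b x = radial_mat (a * b) x"
proof -
  have "(\<Sum>k\<in>UNIV. radial_mat a x $ i $ k * radial_mat b x $ k $ j) = radial_mat (a * b) x $ i $ j" for i j
  proof -
    have "(\<Sum>k\<in>UNIV. radial_mat a x $ i $ k * radial_mat b x $ k $ j)
       = (1 - b) * dir j x * (\<Sum>k\<in>UNIV. radial_mat a x $ i $ k * dir k x)
         + b * (\<Sum>k\<in>UNIV. radial_mat a x $ i $ k * (if k = j then 1 else 0))"
      unfolding radial_mat_nth [of b] by (simp add: distrib_left sum.distrib sum_distrib_left mult_ac)
    also have "\<dots> = (1 - b) * dir j x * dir i x + b * radial_mat a x $ i $ j"
      by (simp add: radial_mat_dir [OF assms] sum_mult_delta)
    finally show ?thesis by (simp add: radial_mat_nth algebra_simps)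
  qed
  then show ?thesis by (simp add: matrix_matrix_mult_def vec_eq_iff)
qed

lemma matrix_inv_unique:
  fixes A B :: "'a::semiring_1 ^ 'n ^ 'n"
  assumes "A ** B = mat 1" "B ** A = mat 1"
  shows "matrix_inv A = B"
proof -
  have "A ** matrix_inv A = mat 1"
    unfolding matrix_inv_def by (rule someI2 [where a = B]) (use assms in auto)
  then have "B ** (A ** matrix_inv A) = B" by simp
  then show ?thesis by (simp add: matrix_mul_assoc assms(2))
qed

lemma matrix_inv_radial_mat:
  assumes "x \<noteq> 0" "a \<noteq> 0"
  shows "matrix_inv (radial_mat a x) = radial_mat (1 / a) x"
  using assms by (intro matrix_inv_unique) (simp_all add: radial_mat_mult radial_mat_1)

lemma frechet_derivative_norm:
  assumes "x \<noteq> 0"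
  shows "frechet_derivative norm (at x) (axis i 1) = dir i x"
  using partial_compose_norm [OF assms DERIV_ident, of i] by (simp add: partial_def dir_def)

lemma frechet_derivative_sgn:
  fixes x :: "real^'n::finite"
  assumes "x \<noteq> 0"
  shows "frechet_derivative sgn (at x) v = (1 / norm x) *\<^sub>R v - ((x \<bullet> v) / norm x ^ 3) *\<^sub>R x"
proof -
  have inv: "((\<lambda>t. inverse t) has_real_derivative - inverse (norm x ^ 2)) (at (norm x))"
    using assms by (auto intro!: derivative_eq_intros simp: power2_eq_square)
  have "((\<lambda>y. inverse (norm y) *\<^sub>R y) has_derivative
      (\<lambda>v. inverse (norm x) *\<^sub>R v + (- inverse (norm x ^ 2) * ((x \<bullet> v) / norm x)) *\<^sub>R x)) (at x)"
    by (intro has_derivative_scaleR compose_norm_has_derivative assms inv has_derivative_ident)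
  then have "(sgn has_derivative
      (\<lambda>v. inverse (norm x) *\<^sub>R v + (- inverse (norm x ^ 2) * ((x \<bullet> v) / norm x)) *\<^sub>R x)) (at x)"
    by (simp add: sgn_div_norm [abs_def])
  from frechet_derivative_at [OF this, symmetric] show ?thesis
    by (simp add: divide_inverse power2_eq_square power3_eq_cube mult_ac)
qed

text \<open>The derivative of \<open>sgn\<close> is the tangential projection divided by
  \<open>norm x\<close>. A projection is its own Gram matrix, which leaves the tangential eigenvalue
  (\<phi>(r) / r)^2.\<close>

lemma warped_metric_eq_radial_mat:
  fixes x :: "real^'n::finite"
  assumes "x \<noteq> 0"
  shows "warped_metric \<phi> x = radial_mat ((\<phi> (norm x) / norm x)\<^sup>2) x"
proof -
  have "frechet_derivative sgn (at x) (axis i 1) \<bullet> frechet_derivative sgn (at x) (axis j 1)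
      = ((if i = j then 1 else 0) - dir i x * dir j x) / (norm x)\<^sup>2" for i j
  proof -
    have gen: "a * (a * s - b * t) - c * (a * u - b * v) = a * a * s - a * c * u - b * a * t + b * c * v"
      for a b c s t u v :: real by (simp add: algebra_simps)
    have ax: "axis i (1::real) $ j = (if i = j then 1 else 0)" for i j :: 'n by (simp add: axis_def)
    define n where "n = norm x"
    have n: "n \<noteq> 0" "x \<bullet> x = n * n"
      using assms by (simp_all add: n_def power2_norm_eq_inner [symmetric] power2_eq_square)
    have c: "x $ i = dir i x * n" for i using n by (simp add: dir_def n_def)
    have D: "frechet_derivative sgn (at x) (axis i 1) = (1 / n) *\<^sub>R axis i 1 - (dir i x / (n * n)) *\<^sub>R x" for i
      using n by (simp add: frechet_derivative_sgn [OF assms] inner_axis n_def [symmetric] c power3_eq_cube)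
    have "frechet_derivative sgn (at x) (axis i 1) \<bullet> frechet_derivative sgn (at x) (axis j 1)
      = 1 / n * (1 / n) * (axis i 1 \<bullet> axis j (1::real)) - 1 / n * (dir j x / (n * n)) * (axis i 1 \<bullet> x)
        - dir i x / (n * n) * (1 / n) * (x \<bullet> axis j 1) + dir i x / (n * n) * (dir j x / (n * n)) * (x \<bullet> x)"
      unfolding D inner_diff_left inner_diff_right inner_scaleR_left inner_scaleR_right
      by (rule gen)
    also have "\<dots> = ((if i = j then 1 else 0) - dir i x * dir j x) / n\<^sup>2"
      using n by (simp add: ax inner_axis_axis inner_axis inner_axis' c power2_eq_square divide_simps)
    finally show ?thesis by (simp add: n_def)
  qed
  then show ?thesis using assms
    by (simp add: warped_metric_def radial_mat_def frechet_derivative_norm power_divide)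
qed

text \<open>The rays through the origin are geodesics.\<close>

lemma christoffel_dir:
  fixes g :: "real^'n::finite \<Rightarrow> real^'n^'n"
  assumes U: "open U" "0 \<notin> U" "x \<in> U"
    and d: "\<And>i j y. y \<in> U \<Longrightarrow> (\<lambda>y. g y $ i $ j) differentiable (at y)"
    and sym: "\<And>y i j. y \<in> U \<Longrightarrow> g y $ i $ j = g y $ j $ i"
    and rad: "\<And>y i. y \<in> U \<Longrightarrow> (\<Sum>j\<in>UNIV. g y $ i $ j * dir j y) = dir i y"
  shows "(\<Sum>i\<in>UNIV. \<Sum>j\<in>UNIV. dir i x * dir j x * christoffel g l i j x) = 0"
proof -
  have "x \<noteq> 0" using U by auto
  define G where "G i j = (\<lambda>y. g y $ i $ j)" for i j
  have G: "partial k (G i j) x = partial k (G j i) x" for i j k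
    unfolding G_def using U sym by (intro partial_cong_open [of U]) auto
  have dd: "dir i differentiable (at x)" for i :: 'n
    by (rule smooth_on_differentiable [OF smooth_on_dir [OF U(1,2)] U(3)])
  have dG: "G i j differentiable (at x)" for i j
    unfolding G_def by (rule d [OF U(3)])
  \<comment> \<open>Differentiating \<open>rad\<close>, the statement that the metric fixes the
    radial direction, moves the derivative from the metric to \<open>dir\<close>.\<close>
  have P: "(\<Sum>j\<in>UNIV. partial k (G i j) x * dir j x) = partial k (dir i) x - (\<Sum>j\<in>UNIV. G i j x * partial k (dir j) x)" for i k
  proof -
    have "partial k (dir i) x = partial k (\<lambda>y. \<Sum>j\<in>UNIV. G i j y * dir j y) x"
      unfolding G_def using U by (intro partial_cong_open [of U]) (auto simp: rad)
    also have "\<dots> = (\<Sum>j\<in>UNIV. partial k (\<lambda>y. G i j y * dir j y) x)"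
      by (intro partial_sum differentiable_mult dd dG)
    also have "\<dots> = (\<Sum>j\<in>UNIV. partial k (G i j) x * dir j x + G i j x * partial k (dir j) x)"
      by (intro sum.cong refl partial_mult dd dG)
    finally show ?thesis by (simp add: sum.distrib)
  qed
  let ?A = "\<lambda>m. \<Sum>i\<in>UNIV. \<Sum>j\<in>UNIV. dir i x * dir j x * partial i (G j m) x"
    and ?A' = "\<lambda>m. \<Sum>i\<in>UNIV. \<Sum>j\<in>UNIV. dir i x * dir j x * partial j (G i m) x"
    and ?B = "\<lambda>m. \<Sum>i\<in>UNIV. \<Sum>j\<in>UNIV. dir i x * dir j x * partial m (G i j) x"
  have A: "?A m = 0" for m
  proof -
    have "?A m =
       (\<Sum>i\<in>UNIV. dir i x * (\<Sum>j\<in>UNIV. partial i (G m j) x * dir j x))"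
      by (simp add: sum_distrib_left G [of _ _ m] mult_ac)
    also have "\<dots> = (\<Sum>i\<in>UNIV. dir i x * partial i (dir m) x)
         - (\<Sum>i\<in>UNIV. \<Sum>j\<in>UNIV. G m j x * (dir i x * partial i (dir j) x))"
      unfolding P by (simp add: right_diff_distrib sum_subtractf sum_distrib_left mult_ac)
    also have "(\<Sum>i\<in>UNIV. \<Sum>j\<in>UNIV. G m j x * (dir i x * partial i (dir j) x))
        = (\<Sum>j\<in>UNIV. G m j x * (\<Sum>i\<in>UNIV. dir i x * partial i (dir j) x))"
      by (subst sum.swap) (simp add: sum_distrib_left)
    finally show ?thesis by (simp add: sum_dir_partial_dir [OF \<open>x \<noteq> 0\<close>])
  qed
  have A': "?A' m = 0" for m
    by (subst sum.swap) (use A [of m] in \<open>simp add: mult_ac\<close>)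
  \<comment> \<open>Here the two sums left by \<open>P\<close> cancel, because the symmetric matrix
    of the metric fixes \<open>dir\<close>. In \<open>A\<close> each of them is 0, as
    \<open>dir\<close> is constant along rays.\<close>
  have B: "?B m = 0" for m
  proof -
    have "?B m
        = (\<Sum>i\<in>UNIV. dir i x * (\<Sum>j\<in>UNIV. partial m (G i j) x * dir j x))"
      by (simp add: sum_distrib_left mult_ac)
    also have "\<dots> = (\<Sum>i\<in>UNIV. dir i x * partial m (dir i) x)
         - (\<Sum>i\<in>UNIV. \<Sum>j\<in>UNIV. partial m (dir j) x * (G j i x * dir i x))"
      unfolding P using sym [OF U(3)]
      by (simp add: right_diff_distrib sum_subtractf sum_distrib_left mult_ac G_def)
    also have "(\<Sum>i\<in>UNIV. \<Sum>j\<in>UNIV. partial m (dir j) x * (G j i x * dir i x))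
        = (\<Sum>j\<in>UNIV. partial m (dir j) x * (\<Sum>i\<in>UNIV. G j i x * dir i x))"
      by (subst sum.swap) (simp add: sum_distrib_left)
    finally show ?thesis using rad [OF U(3)] by (simp add: G_def mult.commute)
  qed
  let ?t = "\<lambda>i j m. dir i x * dir j x * partial i (G j m) x  + dir i x * dir j x * partial j (G i m) x - dir i x * dir j x * partial m (G i j) x"
  let ?c = "\<lambda>m. matrix_inv (g x) $ l $ m / 2"
  have "(\<Sum>i\<in>UNIV. \<Sum>j\<in>UNIV. dir i x * dir j x * christoffel g l i j x) =
    (\<Sum>i\<in>UNIV. \<Sum>j\<in>UNIV. \<Sum>m\<in>UNIV. ?c m * ?t i j m)"
    unfolding christoffel_def G_def sum_divide_distrib sum_distrib_left
    by (intro sum.cong refl) (simp add: field_simps)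
  also have "\<dots> = (\<Sum>m\<in>UNIV. \<Sum>i\<in>UNIV. \<Sum>j\<in>UNIV. ?c m * ?t i j m)"
    by (subst sum.swap, subst (2) sum.swap, rule refl)
  also have "\<dots> = (\<Sum>m\<in>UNIV. ?c m * (?A m
        + ?A' m
        - ?B m))"
    by (simp only: sum_distrib_left [symmetric] sum.distrib sum_subtractf)
  finally show ?thesis by (simp add: A A' B)
qed

section \<open>Multi-indices as lists, and contraction of tensors with the radial direction\<close>

lemma sum_lists_Suc:
  "(\<Sum>is\<in>{is :: 'n::finite list. length is = Suc j}. f is) = (\<Sum>i\<in>UNIV. \<Sum>is\<in>{is. length is = j}. f (i # is))"
proof -
  have "{is :: 'n list. length is = Suc j} = (\<lambda>(i, is). i # is) ` (UNIV \<times> {is. length is = j})"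
    by (auto simp: length_Suc_conv image_iff)
  moreover have "inj_on (\<lambda>(i, is). i # is) (UNIV \<times> {is :: 'n list. length is = j})"
    by (auto simp: inj_on_def)
  ultimately show ?thesis
    by (simp add: sum.reindex sum.cartesian_product case_prod_beta')
qed

lemma finite_lists_length [simp]: "finite {is :: 'n::finite list. length is = j}"
  using finite_lists_length_eq [of "UNIV :: 'n set" j] by simp

lemma prod_sum_lists:
  fixes c :: "nat \<Rightarrow> 'n::finite \<Rightarrow> real"
  shows "(\<Prod>s<j. \<Sum>a\<in>UNIV. c s a) = (\<Sum>as\<in>{as. length as = j}. \<Prod>s<j. c s (as ! s))"
proof (induction j arbitrary: c)
  case (Suc j)
  have "(\<Prod>s<Suc j. \<Sum>a\<in>UNIV. c s a) = (\<Sum>a\<in>UNIV. c 0 a) * (\<Sum>as\<in>{as. length as = j}. \<Prod>s<j. c (Suc s) (as ! s))"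
    by (simp add: prod.lessThan_Suc_shift Suc.IH del: prod.lessThan_Suc)
  also have "\<dots> = (\<Sum>as\<in>{as. length as = Suc j}. \<Prod>s<Suc j. c s (as ! s))"
    by (simp add: sum_lists_Suc prod.lessThan_Suc_shift sum_product del: prod.lessThan_Suc)
  finally show ?case .
qed simp

text \<open>The covariant tensor \<open>T\<close> evaluated on \<open>j\<close> copies of the unit
  radial vector.\<close>

definition radial_part :: "nat \<Rightarrow> ('n::finite list \<Rightarrow> real^'n \<Rightarrow> real) \<Rightarrow> real^'n \<Rightarrow> real" where
  "radial_part j T x = (\<Sum>is\<in>{is. length is = j}. (\<Prod>s<j. dir (is ! s) x) * T is x)"

text \<open>Renaming the summation index turns the correction term at slot s into \<open>T\<close>
  times a Christoffel symbol contracted with \<open>d\<close> in both lower indices, which is 0 by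
  assumption.\<close>

lemma sum_christoffel_radial:
  fixes T :: "'n::finite list \<Rightarrow> real" and d :: "'n \<Rightarrow> real" and \<Gamma> :: "'n \<Rightarrow> 'n \<Rightarrow> 'n \<Rightarrow> real"
  assumes "s < j" and \<Gamma>: "\<And>m. (\<Sum>i\<in>UNIV. \<Sum>l\<in>UNIV. d i * d l * \<Gamma> m i l) = 0"
  shows "(\<Sum>i\<in>UNIV. \<Sum>is\<in>{is. length is = j}. d i * (\<Prod>s<j. d (is ! s)) * (\<Sum>m\<in>UNIV. \<Gamma> m i (is ! s) * T (is[s := m]))) = 0"
proof -
  let ?L = "{is :: 'n list. length is = j}"
  \<comment> \<open>The factor of slot s is left out, so that \<open>P\<close> does not change when
    the entry at s is replaced.\<close>
  define P where "P is = (\<Prod>t\<in>{..<j} - {s}. d (is ! t))" for "is" :: "'n list"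
  have P: "(\<Prod>t<j. d (is ! t)) = d (is ! s) * P is" for "is"
    unfolding P_def using \<open>s < j\<close> by (intro prod.remove) auto
  have P_upd: "P (is[s := m]) = P is" for "is" m
    unfolding P_def by (intro prod.cong) auto
  have "(\<Sum>is\<in>?L. d i * (\<Prod>s<j. d (is ! s)) * (\<Sum>m\<in>UNIV. \<Gamma> m i (is ! s) * T (is[s := m])))
      = (\<Sum>is\<in>?L. \<Sum>l\<in>UNIV. P is * T is * (d i * d l * \<Gamma> (is ! s) i l))" for i
  proof -
    have "(\<Sum>is\<in>?L. d i * (\<Prod>s<j. d (is ! s)) * (\<Sum>m\<in>UNIV. \<Gamma> m i (is ! s) * T (is[s := m])))
       = (\<Sum>(is, m)\<in>?L \<times> UNIV. d i * (d (is ! s) * P is) * (\<Gamma> m i (is ! s) * T (is[s := m])))"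
      by (simp add: P sum_distrib_left sum.cartesian_product)
    \<comment> \<open>The reindexing is the involution that exchanges the entry at slot s with the
      extra index.\<close>
    also have "\<dots> = (\<Sum>(is, l)\<in>?L \<times> UNIV. P is * T is * (d i * d l * \<Gamma> (is ! s) i l))"
      by (rule sum.reindex_bij_witness [where i = "\<lambda>(is, l). (is[s := l], is ! s)" and j = "\<lambda>(is, l). (is[s := l], is ! s)"])
        (use \<open>s < j\<close> in \<open>auto simp: P_upd\<close>)
    finally show ?thesis by (simp add: sum.cartesian_product)
  qed
  then have "(\<Sum>i\<in>UNIV. \<Sum>is\<in>?L. d i * (\<Prod>s<j. d (is ! s)) * (\<Sum>m\<in>UNIV. \<Gamma> m i (is ! s) * T (is[s := m])))
      = (\<Sum>i\<in>UNIV. \<Sum>is\<in>?L. \<Sum>l\<in>UNIV. P is * T is * (d i * d l * \<Gamma> (is ! s) i l))" by simp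
  also have "\<dots> = (\<Sum>is\<in>?L. P is * T is * (\<Sum>i\<in>UNIV. \<Sum>l\<in>UNIV. d i * d l * \<Gamma> (is ! s) i l))"
    by (subst sum.swap) (simp add: sum_distrib_left)
  finally show ?thesis by (simp add: \<Gamma>)
qed

text \<open>Since rays are geodesics, all Christoffel corrections cancel in a purely radial
  contraction, and only the derivatives of the components remain.\<close>

lemma radial_part_cov_deriv:
  fixes g :: "real^'n::finite \<Rightarrow> real^'n^'n"
  assumes \<Gamma>: "\<And>m. (\<Sum>i\<in>UNIV. \<Sum>l\<in>UNIV. dir i x * dir l x * christoffel g m i l x) = 0"
  shows "radial_part (Suc j) (cov_deriv g T) x =
    (\<Sum>is\<in>{is. length is = j}. (\<Prod>s<j. dir (is ! s) x) * (\<Sum>i\<in>UNIV. dir i x * partial i (T is) x))"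
proof -
  let ?L = "{is :: 'n list. length is = j}"
  let ?P = "\<lambda>is. \<Prod>s<j. dir (is ! s) x"
  let ?G = "\<lambda>i is s. \<Sum>m\<in>UNIV. christoffel g m i (is ! s) x * T (is[s := m]) x"
  have "radial_part (Suc j) (cov_deriv g T) x =
    (\<Sum>i\<in>UNIV. \<Sum>is\<in>?L. dir i x * ?P is * cov_deriv g T (i # is) x)"
    by (simp add: radial_part_def sum_lists_Suc prod.lessThan_Suc_shift del: prod.lessThan_Suc cov_deriv.simps)
  also have "\<dots> = (\<Sum>i\<in>UNIV. \<Sum>is\<in>?L. dir i x * ?P is * partial i (T is) x) -
     (\<Sum>i\<in>UNIV. \<Sum>is\<in>?L. \<Sum>s<j. dir i x * ?P is * ?G i is s)"
    by (simp add: right_diff_distrib sum_subtractf sum_distrib_left)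
  also have "(\<Sum>i\<in>UNIV. \<Sum>is\<in>?L. \<Sum>s<j. dir i x * ?P is * ?G i is s)
    = (\<Sum>s<j. \<Sum>i\<in>UNIV. \<Sum>is\<in>?L. dir i x * ?P is * ?G i is s)"
    by (subst sum.swap, subst (2) sum.swap, rule refl)
  also have "\<dots> = 0"
  proof (rule sum.neutral, rule ballI)
    fix s assume "s \<in> {..<j}"
    then have "s < j" by simp
    from sum_christoffel_radial [where d = "\<lambda>i. dir i x" and \<Gamma> = "\<lambda>m i l. christoffel g m i l x" and T = "\<lambda>is. T is x", OF this \<Gamma>]
    show "(\<Sum>i\<in>UNIV. \<Sum>is\<in>?L. dir i x * ?P is * ?G i is s) = 0" .
  qed
  also have "(\<Sum>i\<in>UNIV. \<Sum>is\<in>?L. dir i x * ?P is * partial i (T is) x)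
     = (\<Sum>is\<in>?L. ?P is * (\<Sum>i\<in>UNIV. dir i x * partial i (T is) x))"
    by (subst sum.swap) (simp add: sum_distrib_left mult_ac)
  finally show ?thesis by simp
qed

lemma has_real_derivative_ray:
  assumes "f differentiable (at (t *\<^sub>R w))"
  shows "((\<lambda>t. f (t *\<^sub>R w)) has_real_derivative (\<Sum>i\<in>UNIV. w $ i * partial i f (t *\<^sub>R w))) (at t)"
proof -
  let ?D = "frechet_derivative f (at (t *\<^sub>R w))"
  have D: "(f has_derivative ?D) (at (t *\<^sub>R w))"
    using assms by (simp add: frechet_derivative_works)
  have "((\<lambda>t. t *\<^sub>R w) has_derivative (\<lambda>h. h *\<^sub>R w)) (at t)"
    by (intro has_derivative_scaleR_left has_derivative_ident)
  from has_derivative_compose [OF this D]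
  have "((\<lambda>t. f (t *\<^sub>R w)) has_derivative (\<lambda>h. ?D (h *\<^sub>R w))) (at t)" .
  moreover have "?D (h *\<^sub>R w) = (\<Sum>i\<in>UNIV. w $ i * partial i f (t *\<^sub>R w)) * h" for h
    unfolding frechet_derivative_eq_sum_partial [OF assms]
    by (simp add: sum_distrib_left mult_ac)
  ultimately show ?thesis by (simp add: has_field_derivative_def)
qed

text \<open>Along the ray through a unit vector \<open>w\<close> the components of
  \<open>dir\<close> are the constants \<open>w $ i\<close>, so the derivative falls on
  \<open>T\<close> alone. The identification holds only for positive parameters, whence the
  restriction to \<open>{0<..}\<close>.\<close>

lemma has_real_derivative_radial_part:
  assumes "t > 0" "norm w = 1" and d: "\<And>is. T is differentiable (at (t *\<^sub>R w))"
    and \<Gamma>: "\<And>m. (\<Sum>i\<in>UNIV. \<Sum>l\<in>UNIV. dir i (t *\<^sub>R w) * dir l (t *\<^sub>R w) * christoffel g m i l (t *\<^sub>R w)) = 0"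
  shows "((\<lambda>t. radial_part j T (t *\<^sub>R w)) has_real_derivative radial_part (Suc j) (cov_deriv g T) (t *\<^sub>R w)) (at t)"
proof -
  let ?L = "{is. length is = j}"
  have "((\<lambda>t. \<Sum>is\<in>?L. (\<Prod>s<j. w $ (is ! s)) * T is (t *\<^sub>R w)) has_real_derivative
      (\<Sum>is\<in>?L. (\<Prod>s<j. w $ (is ! s)) * (\<Sum>i\<in>UNIV. w $ i * partial i (T is) (t *\<^sub>R w)))) (at t)"
    by (intro DERIV_sum DERIV_cmult has_real_derivative_ray d)
  moreover have "radial_part (Suc j) (cov_deriv g T) (t *\<^sub>R w) =
      (\<Sum>is\<in>?L. (\<Prod>s<j. w $ (is ! s)) * (\<Sum>i\<in>UNIV. w $ i * partial i (T is) (t *\<^sub>R w)))"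
    using assms(1,2) by (simp add: radial_part_cov_deriv [OF \<Gamma>] dir_scaleR)
  moreover have "(\<Sum>is\<in>?L. (\<Prod>s<j. w $ (is ! s)) * T is (u *\<^sub>R w)) = radial_part j T (u *\<^sub>R w)" if "u \<in> {0<..}" for u
    using that assms(2) by (simp add: radial_part_def dir_scaleR)
  ultimately show ?thesis
    using \<open>t > 0\<close> by (auto intro: has_field_derivative_transform_within_open [where S = "{0<..}"])
qed

section \<open>Smoothness and linearity of iterated covariant derivatives\<close>

lemma smooth_on_christoffel:
  assumes "open U" "\<And>i j. smooth_on U (\<lambda>x. g x $ i $ j)" "\<And>i j. smooth_on U (\<lambda>x. matrix_inv (g x) $ i $ j)"
  shows "smooth_on U (christoffel g l i j)"
proof -
  have "smooth_on U (\<lambda>x. (\<Sum>m\<in>UNIV. matrix_inv (g x) $ l $ m *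
        (partial i (\<lambda>y. g y $ j $ m) x + partial j (\<lambda>y. g y $ i $ m) x
          - partial m (\<lambda>y. g y $ i $ j) x)) * (1 / 2))"
    by (intro smooth_on_mult smooth_on_sum smooth_on_diff smooth_on_add smooth_on_const smooth_on_partial assms)
  then show ?thesis by (simp add: christoffel_def [abs_def])
qed

lemma smooth_on_cov_deriv:
  assumes "open U" "\<And>l i j. smooth_on U (christoffel g l i j)" "\<And>is. smooth_on U (T is)"
  shows "smooth_on U (cov_deriv g T is)"
proof (cases "is")
  case Nil
  then show ?thesis using smooth_on_const by (simp add: fun_eq_iff [symmetric] cov_deriv.simps(1) [abs_def])
next
  case (Cons i "js")
  have "smooth_on U (\<lambda>x. partial i (T js) x
       - (\<Sum>s<length js. \<Sum>m\<in>UNIV. christoffel g m i (js ! s) x * T (js[s := m]) x))"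
    by (intro smooth_on_mult smooth_on_sum smooth_on_diff smooth_on_partial assms)
  then show ?thesis by (simp add: Cons cov_deriv.simps(2) [abs_def])
qed

lemma smooth_on_nabla:
  assumes "open U" "\<And>l i j. smooth_on U (christoffel g l i j)" "smooth_on U u"
  shows "smooth_on U (nabla g j u is)"
proof -
  have "smooth_on U ((cov_deriv g ^^ j) (\<lambda>_. u) is)" for "is"
    by (induction j arbitrary: "is") (auto intro: smooth_on_cov_deriv assms)
  then show ?thesis by (simp add: nabla_def)
qed

lemma nabla_diff:
  assumes "open U" "\<And>l i j. smooth_on U (christoffel g l i j)" "smooth_on U u" "smooth_on U v" "x \<in> U"
  shows "nabla g j (\<lambda>x. u x - v x) is x = nabla g j u is x - nabla g j v is x"
  using \<open>x \<in> U\<close>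
proof (induction j arbitrary: "is" x)
  case 0
  then show ?case by (simp add: nabla_def)
next
  case (Suc j)
  have step: "nabla g (Suc j) w = cov_deriv g (nabla g j w)" for w by (simp add: nabla_def)
  show ?case
  proof (cases "is")
    case (Cons i "js")
    have sm: "nabla g j w js differentiable (at x)" if "smooth_on U w" for w
      by (rule smooth_on_differentiable [OF smooth_on_nabla Suc.prems]) (use assms that in auto)
    have "partial i (nabla g j (\<lambda>x. u x - v x) js) x = partial i (\<lambda>x. nabla g j u js x + (- 1) * nabla g j v js x) x"
      by (rule partial_cong_open [OF assms(1) Suc.prems]) (simp add: Suc.IH)
    also have "\<dots> = partial i (nabla g j u js) x + partial i (\<lambda>x. (- 1) * nabla g j v js x) x"
      by (intro partial_add differentiable_mult differentiable_const sm assms)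
    also have "partial i (\<lambda>x. (- 1) * nabla g j v js x) x = - partial i (nabla g j v js) x"
      by (subst partial_mult) (auto intro: sm assms)
    finally show ?thesis
      by (simp add: step Cons Suc.IH [OF Suc.prems] right_diff_distrib sum_subtractf)
  qed (simp add: step)
qed

section \<open>Balls with a warped metric\<close>

text \<open>With a square root \<open>B\<close> of the inverse metric the tensor norm becomes a Euclidean norm.\<close>

lemma prod_matrix_square:
  fixes B :: "real^'n::finite^'n"
  assumes A: "\<And>i l. A $ i $ l = (\<Sum>a\<in>UNIV. B $ a $ i * B $ a $ l)"
  shows "(\<Sum>is\<in>{is. length is = j}. \<Sum>ls\<in>{ls. length ls = j}. (\<Prod>s<j. A $ (is ! s) $ (ls ! s)) * T is * T ls)
    = (\<Sum>as\<in>{as. length as = j}. (\<Sum>is\<in>{is. length is = j}. (\<Prod>s<j. B $ (as ! s) $ (is ! s)) * T is)\<^sup>2)"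
proof -
  let ?L = "{is :: 'n list. length is = j}"
  let ?t = "\<lambda>as is. (\<Prod>s<j. B $ (as ! s) $ (is ! s)) * T is"
  have "(\<Sum>is\<in>?L. \<Sum>ls\<in>?L. (\<Prod>s<j. A $ (is ! s) $ (ls ! s)) * T is * T ls)
    = (\<Sum>is\<in>?L. \<Sum>ls\<in>?L. \<Sum>as\<in>?L. ?t as is * ?t as ls)"
    by (simp add: A prod_sum_lists prod.distrib sum_distrib_left sum_distrib_right mult_ac)
  also have "\<dots> = (\<Sum>is\<in>?L. \<Sum>as\<in>?L. \<Sum>ls\<in>?L. ?t as is * ?t as ls)"
    by (intro sum.cong refl sum.swap)
  also have "\<dots> = (\<Sum>as\<in>?L. \<Sum>is\<in>?L. \<Sum>ls\<in>?L. ?t as is * ?t as ls)"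
    by (rule sum.swap)
  also have "\<dots> = (\<Sum>as\<in>?L. (\<Sum>is\<in>?L. (\<Prod>s<j. B $ (as ! s) $ (is ! s)) * T is)\<^sup>2)"
    by (simp add: power2_eq_square sum_product)
  finally show ?thesis .
qed

lemma tensor_norm_eq_L2_set:
  fixes B :: "real^'n::finite^'n"
  assumes "\<And>i l. matrix_inv (g x) $ i $ l = (\<Sum>a\<in>UNIV. B $ a $ i * B $ a $ l)"
  shows "tensor_norm g j T x =
    L2_set (\<lambda>as. \<Sum>is\<in>{is. length is = j}. (\<Prod>s<j. B $ (as ! s) $ (is ! s)) * T is x) {as. length as = j}"
  unfolding tensor_norm_def L2_set_def by (subst prod_matrix_square [of "matrix_inv (g x)" B, OF assms]) (rule refl)

text \<open>Cauchy-Schwarz. As \<open>B\<close> fixes the radial direction, the radial part is the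
  Euclidean inner product of the tensor transformed by \<open>B\<close> with the
  \<open>j\<close>-fold tensor power of a unit vector, which has norm 1.\<close>

lemma abs_radial_part_le_tensor_norm:
  fixes B :: "real^'n::finite^'n"
  assumes "x \<noteq> 0"
    and inv: "\<And>i l. matrix_inv (g x) $ i $ l = (\<Sum>a\<in>UNIV. B $ a $ i * B $ a $ l)"
    and B: "\<And>i. (\<Sum>a\<in>UNIV. dir a x * B $ a $ i) = dir i x"
  shows "\<bar>radial_part j T x\<bar> \<le> tensor_norm g j T x"
proof -
  let ?L = "{is :: 'n list. length is = j}"
  let ?t = "\<lambda>as. \<Sum>is\<in>?L. (\<Prod>s<j. B $ (as ! s) $ (is ! s)) * T is x"
  let ?e = "\<lambda>as. \<Prod>s<j. dir (as ! s) x"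
  have "radial_part j T x = (\<Sum>is\<in>?L. (\<Prod>s<j. \<Sum>a\<in>UNIV. dir a x * B $ a $ (is ! s)) * T is x)"
    by (simp add: radial_part_def B)
  also have "\<dots> = (\<Sum>is\<in>?L. \<Sum>as\<in>?L. ?e as * ((\<Prod>s<j. B $ (as ! s) $ (is ! s)) * T is x))"
    by (simp add: prod_sum_lists prod.distrib sum_distrib_left sum_distrib_right mult_ac)
  also have "\<dots> = (\<Sum>as\<in>?L. ?e as * ?t as)"
    by (subst sum.swap) (simp add: sum_distrib_left)
  finally have "\<bar>radial_part j T x\<bar> \<le> (\<Sum>as\<in>?L. \<bar>?e as\<bar> * \<bar>?t as\<bar>)"
    by (simp add: abs_mult [symmetric])
  also have "\<dots> \<le> L2_set ?e ?L * L2_set ?t ?L"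
    by (rule L2_set_mult_ineq)
  also have "L2_set ?e ?L = 1"
  proof -
    have "(\<Sum>as\<in>?L. (?e as)\<^sup>2) = (\<Prod>s<j. \<Sum>a\<in>UNIV. dir a x * dir a x)"
      unfolding prod_sum_lists by (simp add: power2_eq_square prod.distrib)
    then show ?thesis by (simp add: L2_set_def sum_dir_dir [OF \<open>x \<noteq> 0\<close>])
  qed
  finally show ?thesis by (simp add: tensor_norm_eq_L2_set [of g x B, OF inv])
qed

lemma tensor_norm_triangle:
  fixes B :: "real^'n::finite^'n"
  assumes inv: "\<And>i l. matrix_inv (g x) $ i $ l = (\<Sum>a\<in>UNIV. B $ a $ i * B $ a $ l)"
    and T: "\<And>is. T is x = T1 is x + T2 is x"
  shows "tensor_norm g j T x \<le> tensor_norm g j T1 x + tensor_norm g j T2 x"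
  unfolding tensor_norm_eq_L2_set [of g x B, OF inv] T distrib_left sum.distrib by (rule L2_set_triangle_ineq)

text \<open>Leibniz' formula has n! terms. Only two-sided bounds on the volume density are wanted,
  so no determinant is ever evaluated.\<close>

lemma abs_det_le:
  fixes A :: "real^'n::finite^'n"
  assumes "\<And>i j. \<bar>A $ i $ j\<bar> \<le> M"
  shows "\<bar>det A\<bar> \<le> fact CARD('n) * M ^ CARD('n)"
proof -
  let ?P = "{p. p permutes (UNIV :: 'n set)}"
  have s: "\<bar>of_int (sign p) :: real\<bar> = 1" for p :: "'n \<Rightarrow> 'n"
    by (simp add: sign_def)
  have "\<bar>det A\<bar> \<le> (\<Sum>p\<in>?P. \<bar>of_int (sign p) * (\<Prod>i\<in>UNIV. A $ i $ p i)\<bar>)"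
    unfolding det_def by (rule sum_abs)
  also have "\<dots> \<le> (\<Sum>p\<in>?P. M ^ CARD('n))"
  proof (rule sum_mono)
    fix p :: "'n \<Rightarrow> 'n"
    have "\<bar>of_int (sign p) * (\<Prod>i\<in>UNIV. A $ i $ p i)\<bar> = (\<Prod>i\<in>UNIV. \<bar>A $ i $ p i\<bar>)"
      by (simp add: abs_mult s abs_prod)
    also have "\<dots> \<le> (\<Prod>i\<in>(UNIV :: 'n set). M)"
      using assms by (intro prod_mono) auto
    finally show "\<bar>of_int (sign p) * (\<Prod>i\<in>UNIV. A $ i $ p i)\<bar> \<le> M ^ CARD('n)" by simp
  qed
  also have "\<dots> = fact CARD('n) * M ^ CARD('n)"
    using card_permutations [of "UNIV :: 'n set" "CARD('n)"] by simp
  finally show ?thesis .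
qed

lemma abs_dir_le_1: "\<bar>dir i x\<bar> \<le> 1"
  using component_le_norm_cart [of x i] by (auto simp: dir_def divide_le_eq)

lemma abs_radial_mat_le:
  assumes "a \<ge> 0"
  shows "\<bar>radial_mat a x $ i $ j\<bar> \<le> 1 + 2 * a"
proof -
  have "\<bar>dir i x * dir j x\<bar> \<le> 1 * 1"
    unfolding abs_mult by (intro mult_mono abs_dir_le_1) auto
  then have "\<bar>1 - a\<bar> * \<bar>dir i x * dir j x\<bar> \<le> (1 + a) * 1"
    using assms by (intro mult_mono) auto
  then have "\<bar>(1 - a) * (dir i x * dir j x)\<bar> \<le> 1 + a" by (simp add: abs_mult)
  then show ?thesis using assms by (auto simp: radial_mat_nth)
qed

section \<open>The warped metric on the punctured ball\<close>

locale warped_ball =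
  fixes \<phi> :: "real \<Rightarrow> real" and R :: real
  assumes R_pos: "R > 0" and warp: "warping_function R \<phi>"
    and lim_R: "\<exists>l>0. (\<phi> \<longlongrightarrow> l) (at_left R)"
begin

lemma deriv_within_DERIV:
  assumes "0 < r" "r < R"
  shows "(deriv_within {0..<R} j \<phi> has_real_derivative deriv_within {0..<R} (Suc j) \<phi> r) (at r)"
proof -
  have "at r within {0..<R} = at r"
    by (rule at_within_interior) (use assms in \<open>simp add: interior_atLeastLessThan\<close>)
  moreover have "deriv_within {0..<R} j \<phi> differentiable (at r within {0..<R})"
    using warp assms by (auto simp: warping_function_def smooth_within_def)
  ultimately show ?thesis
    by (simp add: has_real_derivative_iff_has_vector_derivative vector_derivative_works [symmetric])
qed

lemma phi_pos: "0 < r \<Longrightarrow> r < R \<Longrightarrow> 0 < \<phi> r"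
  using warp by (auto simp: warping_function_def)

lemma phi_0: "\<phi> 0 = 0"
  using warp by (auto simp: warping_function_def dest: spec [of _ 0])

lemma phi_isCont: "0 < r \<Longrightarrow> r < R \<Longrightarrow> isCont \<phi> r"
  using deriv_within_DERIV [of r 0] by (auto dest: DERIV_isCont)

text \<open>The quotient extends to a continuous positive function \<psi> on the compact interval
  \<open>{0..R}\<close>, with value 1, the derivative of \<phi>, at 0 and l / R at R. Its extreme
  values are the constants.\<close>

lemma phi_ratio_bounds:
  obtains c1 c2 where "0 < c1" "\<And>r. 0 < r \<Longrightarrow> r < R \<Longrightarrow> c1 \<le> \<phi> r / r" "\<And>r. 0 < r \<Longrightarrow> r < R \<Longrightarrow> \<phi> r / r \<le> c2"
proof -
  obtain l where l: "l > 0" "(\<phi> \<longlongrightarrow> l) (at_left R)" using lim_R by blast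
  have 0: "((\<lambda>r. \<phi> r / r) \<longlongrightarrow> 1) (at_right 0)"
  proof -
    have "(\<phi> has_vector_derivative 1) (at 0 within {0..<R})"
      using warp R_pos vector_derivative_works [of \<phi> "at 0 within {0..<R}"]
      by (auto simp: warping_function_def smooth_within_def dest: spec [of _ "0::nat"])
    then have "((\<lambda>r. (\<phi> r - \<phi> 0) / (r - 0)) \<longlongrightarrow> 1) (at 0 within {0..<R})"
      by (simp add: has_real_derivative_iff_has_vector_derivative [symmetric] has_field_derivative_iff)
    moreover have "at 0 within {0..<R} = at_right (0::real)"
      using R_pos by (intro at_within_nhd [of _ "{..<R}"]) auto
    ultimately show ?thesis by (simp add: phi_0)
  qed
  define \<psi> where "\<psi> r = (if r = 0 then 1 else if r = R then l / R else \<phi> r / r)" for r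
  have ev: "eventually (\<lambda>r. \<phi> r / r = \<psi> r) (at r within S)" for r :: real and S
    using eventually_neq_at_within [of 0 r S] eventually_neq_at_within [of R r S]
    by eventually_elim (simp add: \<psi>_def)
  have "continuous_on {0..R} \<psi>"
  proof (rule continuous_on_IccI [OF _ _ _ R_pos])
    have "((\<lambda>r. \<phi> r / r) \<longlongrightarrow> \<psi> 0) (at_right 0)" using 0 by (simp add: \<psi>_def)
    then show "(\<psi> \<longlongrightarrow> \<psi> 0) (at_right 0)"
      by (rule Lim_transform_eventually) (rule ev)
    have "((\<lambda>r. \<phi> r / r) \<longlongrightarrow> \<psi> R) (at_left R)"
      using R_pos unfolding \<psi>_def by (auto intro!: tendsto_divide l)
    then show "(\<psi> \<longlongrightarrow> \<psi> R) (at_left R)"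
      by (rule Lim_transform_eventually) (rule ev)
    fix r assume r: "0 < r" "r < R"
    have "((\<lambda>r. \<phi> r / r) \<longlongrightarrow> \<psi> r) (at r)"
      using r phi_isCont [OF r] unfolding \<psi>_def isCont_def by (auto intro!: tendsto_divide)
    then show "(\<psi> \<longlongrightarrow> \<psi> r) (at r)"
      by (rule Lim_transform_eventually) (rule ev)
  qed
  then obtain a b where "a \<in> {0..R}" "\<And>r. r \<in> {0..R} \<Longrightarrow> \<psi> a \<le> \<psi> r" "\<And>r. r \<in> {0..R} \<Longrightarrow> \<psi> r \<le> \<psi> b"
    using continuous_attains_inf [of "{0..R}" \<psi>] continuous_attains_sup [of "{0..R}" \<psi>] R_pos
    by (metis atLeastAtMost_iff compact_Icc empty_iff less_imp_le order_refl)
  moreover have "0 < \<psi> r" if "r \<in> {0..R}" for r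
    using that l R_pos phi_pos [of r] by (auto simp: \<psi>_def)
  moreover have "\<psi> r = \<phi> r / r" if "0 < r" "r < R" for r
    using that by (simp add: \<psi>_def)
  ultimately show thesis
    using that [of "\<psi> a" "\<psi> b"] by (metis atLeastAtMost_iff less_imp_le)
qed

text \<open>The metric is defined by cases at the origin, and \<open>dir\<close> is smooth only away
  from it. All calculus takes place here; the omitted point is a null set.\<close>

abbreviation "punctured \<equiv> ball 0 R - {0}"

abbreviation "g \<equiv> warped_metric \<phi>"

text \<open>The symmetric square root of the inverse metric, with tangential eigenvalue r /
  \<phi>(r).\<close>

abbreviation "root_inv x \<equiv> radial_mat (norm x / \<phi> (norm x)) x"

abbreviation "leb \<equiv> lebesgue_on (ball 0 R)"

abbreviation "vol_measure \<equiv> vol (ball 0 R) g"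

abbreviation "smooth_W \<equiv> smooth_sobolev (ball 0 R) g"

abbreviation "W_norm \<equiv> smooth_sobolev_norm (ball 0 R) g"

abbreviation "represents \<equiv> sobolev_represents (ball 0 R) g"

lemma open_punctured: "open (punctured :: (real^'n) set)"
  by (intro open_delete open_ball)

lemma phi_norm_pos: "x \<in> punctured \<Longrightarrow> 0 < \<phi> (norm x)"
  by (intro phi_pos) auto

lemma matrix_inv_g:
  assumes "x \<in> punctured"
  shows "matrix_inv (g x) = radial_mat ((norm x / \<phi> (norm x))\<^sup>2) x"
  using assms phi_norm_pos [OF assms]
  by (simp add: warped_metric_eq_radial_mat matrix_inv_radial_mat power_divide)

lemma matrix_inv_g_square:
  assumes "x \<in> punctured"
  shows "matrix_inv (g x) $ i $ l = (\<Sum>a\<in>UNIV. root_inv x $ a $ i * root_inv x $ a $ l)"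
proof -
  have "root_inv x ** root_inv x = matrix_inv (g x)"
    using assms by (simp add: matrix_inv_g radial_mat_mult power2_eq_square)
  then have "matrix_inv (g x) $ i $ l = (\<Sum>a\<in>UNIV. root_inv x $ i $ a * root_inv x $ a $ l)"
    by (simp add: matrix_matrix_mult_def vec_eq_iff)
  then show ?thesis by (simp add: radial_mat_sym [of _ x i])
qed

lemma smooth_on_radial_mat:
  assumes "open U" "0 \<notin> U" "smooth_on U c"
  shows "smooth_on U (\<lambda>x. radial_mat (c x) x $ i $ j)"
  unfolding radial_mat_nth
  by (intro smooth_on_add smooth_on_mult smooth_on_diff smooth_on_const smooth_on_dir assms)

lemma smooth_on_phi_norm: "smooth_on punctured (\<lambda>x :: real^'n. \<phi> (norm x))"
proof -
  have "smooth_on punctured (\<lambda>x :: real^'n. deriv_within {0..<R} 0 \<phi> (norm x))"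
    by (rule smooth_on_compose_norm [where h = "\<lambda>j. deriv_within {0..<R} j \<phi>"])
      (auto intro!: deriv_within_DERIV open_punctured simp del: deriv_within.simps)
  then show ?thesis by simp
qed

lemma smooth_on_norm_punctured: "smooth_on punctured (norm :: real^'n \<Rightarrow> real)"
  by (intro smooth_on_norm open_punctured) auto

lemma smooth_on_g: "smooth_on punctured (\<lambda>x :: real^'n. g x $ i $ j)"
proof -
  have "smooth_on punctured (\<lambda>x :: real^'n. radial_mat ((\<phi> (norm x) * inverse (norm x)) * (\<phi> (norm x) * inverse (norm x))) x $ i $ j)"
    by (intro smooth_on_radial_mat smooth_on_mult smooth_on_inverse smooth_on_phi_norm smooth_on_norm_punctured open_punctured) auto
  then show ?thesis
    by (rule smooth_on_cong [OF open_punctured, rotated])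
      (simp add: warped_metric_eq_radial_mat power2_eq_square divide_inverse)
qed

lemma smooth_on_matrix_inv_g: "smooth_on punctured (\<lambda>x :: real^'n. matrix_inv (g x) $ i $ j)"
proof -
  have "smooth_on punctured (\<lambda>x :: real^'n. radial_mat ((norm x * inverse (\<phi> (norm x))) * (norm x * inverse (\<phi> (norm x)))) x $ i $ j)"
    by (intro smooth_on_radial_mat smooth_on_mult smooth_on_inverse smooth_on_phi_norm smooth_on_norm_punctured open_punctured)
      (use phi_norm_pos in \<open>force+\<close>)
  then show ?thesis
    by (rule smooth_on_cong [OF open_punctured, rotated])
      (simp add: matrix_inv_g power2_eq_square divide_inverse)
qed

lemma smooth_on_christoffel_g: "smooth_on punctured (christoffel (g :: real^'n \<Rightarrow> _) l i j)"
  by (intro smooth_on_christoffel open_punctured smooth_on_g smooth_on_matrix_inv_g)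

lemma smooth_on_nabla_g:
  "smooth_on (ball 0 R) (u :: real^'n \<Rightarrow> real) \<Longrightarrow> smooth_on punctured (nabla g j u is)"
  by (intro smooth_on_nabla open_punctured smooth_on_christoffel_g) (auto intro: smooth_on_subset)

lemma g_dir:
  assumes "y \<in> punctured"
  shows "(\<Sum>j\<in>UNIV. g y $ i $ j * dir j y) = dir i y"
  using assms by (simp add: warped_metric_eq_radial_mat radial_mat_dir)

lemma christoffel_g_dir:
  assumes "x \<in> punctured"
  shows "(\<Sum>i\<in>UNIV. \<Sum>j\<in>UNIV. dir i x * dir j x * christoffel g l i j x) = 0"
proof (rule christoffel_dir [OF open_punctured _ assms])
  show "(\<lambda>y. g y $ i $ j) differentiable (at y)" if "y \<in> punctured" for i j and y :: "real^'a"
    by (rule smooth_on_differentiable [OF smooth_on_g that])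
  show "g y $ i $ j = g y $ j $ i" if "y \<in> punctured" for i j and y :: "real^'a"
    using that by (simp add: warped_metric_eq_radial_mat radial_mat_sym [of _ y i])
  show "(\<Sum>j\<in>UNIV. g y $ i $ j * dir j y) = dir i y" if "y \<in> punctured" for i and y :: "real^'a"
    by (rule g_dir [OF that])
qed auto

text \<open>Cut off to 0 outside the punctured ball, which makes it Borel measurable on the whole
  space as \<open>ray_chain\<close> demands. In particular order 0 agrees with \<open>u\<close> only
  off the origin.\<close>

definition radial_derivs :: "(real^'n \<Rightarrow> real) \<Rightarrow> nat \<Rightarrow> real^'n::finite \<Rightarrow> real" where
  "radial_derivs u j x = (if x \<in> punctured then radial_part j (nabla g j u) x else 0)"

lemma radial_derivs_0: "x \<in> punctured \<Longrightarrow> radial_derivs u 0 x = u x"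
  by (simp add: radial_derivs_def radial_part_def nabla_def)

lemma abs_radial_derivs_le:
  assumes "x \<in> punctured"
  shows "\<bar>radial_derivs u j x\<bar> \<le> tensor_norm g j (nabla g j u) x"
proof -
  have "(\<Sum>a\<in>UNIV. dir a x * root_inv x $ a $ i) = dir i x" for i
    using assms radial_mat_dir [of x "norm x / \<phi> (norm x)" i]
    by (simp add: mult.commute radial_mat_sym [of _ x i])
  then show ?thesis
    using abs_radial_part_le_tensor_norm [of x g "root_inv x", OF _ matrix_inv_g_square [OF assms]] assms
    by (simp add: radial_derivs_def)
qed

lemma ray_chain_radial_derivs:
  fixes u :: "real^'n \<Rightarrow> real"
  assumes u: "smooth_on (ball 0 R) u"
  shows "ray_chain R (radial_derivs u)"
  unfolding ray_chain_def
proof (intro conjI allI impI)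
  fix j
  have "continuous_on punctured (dir i :: real^'n \<Rightarrow> real)" for i
    by (rule smooth_on_continuous_on [OF smooth_on_dir [OF open_punctured]]) auto
  then have "continuous_on punctured (radial_part j (nabla g j u))"
    unfolding radial_part_def [abs_def]
    by (intro continuous_intros smooth_on_continuous_on [OF smooth_on_nabla_g [OF u]])
  then have "(\<lambda>x. if x \<in> punctured then radial_part j (nabla g j u) x else 0) \<in> borel_measurable borel"
    by (intro borel_measurable_continuous_on_if continuous_intros) (auto intro: open_punctured borel_open)
  then show "radial_derivs u j \<in> borel_measurable borel"
    by (simp add: radial_derivs_def [abs_def])
next
  fix j and w :: "real^'n" and t :: real
  assume w: "norm w = 1" and t: "0 < t" "t < R"
  have p: "s *\<^sub>R w \<in> punctured" if "s \<in> {0<..<R}" for s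
    using that w by auto
  have "nabla g (Suc j) u = cov_deriv g (nabla g j u)" by (simp add: nabla_def)
  then have "((\<lambda>t. radial_part j (nabla g j u) (t *\<^sub>R w)) has_real_derivative radial_part (Suc j) (nabla g (Suc j) u) (t *\<^sub>R w)) (at t)"
    using has_real_derivative_radial_part [OF t(1) w smooth_on_differentiable [OF smooth_on_nabla_g [OF u] p] christoffel_g_dir [OF p]] t
    by simp
  then have "((\<lambda>t. radial_part j (nabla g j u) (t *\<^sub>R w)) has_real_derivative radial_derivs u (Suc j) (t *\<^sub>R w)) (at t)"
    using p [of t] t by (simp add: radial_derivs_def)
  then show "((\<lambda>t. radial_derivs u j (t *\<^sub>R w)) has_real_derivative radial_derivs u (Suc j) (t *\<^sub>R w)) (at t)"
    by (rule has_field_derivative_transform_within_open [where S = "{0<..<R}"]) (use t p in \<open>auto simp: radial_derivs_def\<close>)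
qed

lemma continuous_on_punctured_measurable:
  fixes f :: "real^'n \<Rightarrow> real"
  assumes "continuous_on punctured f"
  shows "f \<in> borel_measurable leb"
proof -
  have "(\<lambda>x. if x \<in> punctured then f x else 0) \<in> borel_measurable borel"
    using assms by (intro borel_measurable_continuous_on_if) (auto intro: open_punctured borel_open)
  from measurable_If [OF borel_measurable_const this, of "\<lambda>x. x = 0" "f 0"]
  have "(\<lambda>x. if x = 0 then f 0 else if x \<in> punctured then f x else 0) \<in> borel_measurable borel"
    by simp
  then have "(\<lambda>x. if x = 0 then f 0 else if x \<in> punctured then f x else 0) \<in> borel_measurable leb"
    by (intro measurable_restrict_space1 measurable_completion) simp
  then show ?thesis
    by (rule measurable_cong [THEN iffD1, rotated]) auto
qed

lemma tensor_norm_nabla_measurable: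
  fixes u :: "real^'n \<Rightarrow> real"
  assumes "smooth_on (ball 0 R) u"
  shows "tensor_norm g j (nabla g j u) \<in> borel_measurable leb"
  unfolding tensor_norm_def [abs_def]
  by (intro continuous_on_punctured_measurable continuous_intros smooth_on_continuous_on [OF smooth_on_nabla_g [OF assms]]
      smooth_on_continuous_on [OF smooth_on_matrix_inv_g])

lemma sqrt_det_g:
  assumes "x \<in> punctured"
  shows "sqrt (det (g x)) = \<bar>det (radial_mat (\<phi> (norm x) / norm x) x)\<bar>"
proof -
  have "g x = radial_mat (\<phi> (norm x) / norm x) x ** radial_mat (\<phi> (norm x) / norm x) x"
    using assms by (simp add: warped_metric_eq_radial_mat radial_mat_mult power2_eq_square)
  then show ?thesis by (simp add: det_mul)
qed

text \<open>The upper bound is \<open>abs_det_le\<close>. The lower one follows from the upper bound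
  for the inverse matrix, since the determinants for \<open>a\<close> and \<open>1 / a\<close>
  multiply to 1.\<close>

lemma sqrt_det_g_bounds:
  obtains D1 D2 where "0 < D1" "D1 \<le> D2" "\<And>x :: real^'n. x \<in> punctured \<Longrightarrow> D1 \<le> sqrt (det (g x))"
    "\<And>x :: real^'n. x \<in> punctured \<Longrightarrow> sqrt (det (g x)) \<le> D2"
proof -
  obtain c1 c2 where c: "0 < c1" "\<And>r. 0 < r \<Longrightarrow> r < R \<Longrightarrow> c1 \<le> \<phi> r / r" "\<And>r. 0 < r \<Longrightarrow> r < R \<Longrightarrow> \<phi> r / r \<le> c2"
    using phi_ratio_bounds by blast
  define E where "E a = fact CARD('n) * (1 + 2 * a) ^ CARD('n)" for a :: real
  have "c1 \<le> c2" using c(2,3) [of "R / 2"] R_pos by simp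
  then have "E (1 / c1) > 0" "E c2 > 0" using c(1) by (auto simp: E_def intro!: mult_pos_pos zero_less_power add_pos_pos)
  have D: "\<bar>det (radial_mat a x)\<bar> \<le> E b" if "0 \<le> a" "a \<le> b" for a b and x :: "real^'n"
  proof -
    have "\<bar>det (radial_mat a x)\<bar> \<le> E a"
      unfolding E_def by (rule abs_det_le) (rule abs_radial_mat_le [OF that(1)])
    also have "E a \<le> E b" using that by (auto simp: E_def intro!: mult_left_mono power_mono)
    finally show ?thesis .
  qed
  have "1 / E (1 / c1) \<le> sqrt (det (g x)) \<and> sqrt (det (g x)) \<le> E c2" if x: "x \<in> punctured" for x :: "real^'n"
  proof -
    define a where "a = \<phi> (norm x) / norm x"
    have a: "c1 \<le> a" "a \<le> c2" using c(2,3) [of "norm x"] x by (auto simp: a_def)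
    then have "a > 0" using c(1) by simp
    have "det (radial_mat a x) * det (radial_mat (1 / a) x) = 1"
      using x \<open>a > 0\<close> by (simp add: det_mul [symmetric] radial_mat_mult radial_mat_1)
    then have 1: "\<bar>det (radial_mat a x)\<bar> * \<bar>det (radial_mat (1 / a) x)\<bar> = 1"
      by (simp add: abs_mult [symmetric])
    have "\<bar>det (radial_mat (1 / a) x)\<bar> \<le> E (1 / c1)"
      using a c(1) by (intro D) (auto intro!: divide_left_mono)
    then have "1 \<le> \<bar>det (radial_mat a x)\<bar> * E (1 / c1)"
      using mult_left_mono [of _ _ "\<bar>det (radial_mat a x)\<bar>"] 1 by fastforce
    then have "1 / E (1 / c1) \<le> \<bar>det (radial_mat a x)\<bar>"
      using \<open>E (1 / c1) > 0\<close> by (simp add: divide_le_eq)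
    moreover have "\<bar>det (radial_mat a x)\<bar> \<le> E c2"
      using a \<open>a > 0\<close> by (intro D) auto
    ultimately show ?thesis by (simp add: sqrt_det_g [OF x] a_def)
  qed
  then show thesis
    using that [of "1 / E (1 / c1)" "max (1 / E (1 / c1)) (E c2)"] \<open>E (1 / c1) > 0\<close> by (simp add: le_max_iff_disj)
qed

end

section \<open>Sobolev norms and radial derivatives\<close>

text \<open>A crude substitute for Minkowski's inequality. It is used only for integrability and for
  boundedness with some constant.\<close>

lemma abs_add_powr_le:
  fixes a b p :: real
  assumes "p \<ge> 1"
  shows "\<bar>a + b\<bar> powr p \<le> 2 powr p * (\<bar>a\<bar> powr p + \<bar>b\<bar> powr p)"
proof -
  have "\<bar>a + b\<bar> powr p \<le> (2 * max \<bar>a\<bar> \<bar>b\<bar>) powr p"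
    using assms by (intro powr_mono2) auto
  also have "\<dots> = 2 powr p * max \<bar>a\<bar> \<bar>b\<bar> powr p"
    by (simp add: powr_mult)
  also have "max \<bar>a\<bar> \<bar>b\<bar> powr p \<le> \<bar>a\<bar> powr p + \<bar>b\<bar> powr p"
    by (auto simp: max_def)
  finally show ?thesis by (simp add: mult_left_mono)
qed

lemma lp_space_diff:
  assumes "p \<ge> 1" "u \<in> lp_space M p" "v \<in> lp_space M p"
  shows "(\<lambda>x. u x - v x) \<in> lp_space M p"
proof -
  have [measurable]: "u \<in> borel_measurable M" "v \<in> borel_measurable M"
    using assms by (auto simp: lp_space_def)
  have "integrable M (\<lambda>x. 2 powr p * (\<bar>u x\<bar> powr p + \<bar>v x\<bar> powr p))"
    using assms by (intro integrable_mult_right Bochner_Integration.integrable_add) (auto simp: lp_space_def)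
  then have "integrable M (\<lambda>x. \<bar>u x - v x\<bar> powr p)"
    by (rule Bochner_Integration.integrable_bound)
      (use abs_add_powr_le [OF assms(1), of "u _" "- v _"] in \<open>auto intro!: AE_I2\<close>)
  then show ?thesis by (simp add: lp_space_def)
qed

lemma integral_le_of_lp_norm_le:
  assumes "p \<ge> 1" "lp_norm M p f \<le> K"
  shows "(\<integral>x. \<bar>f x\<bar> powr p \<partial>M) \<le> K powr p"
proof -
  have "(\<integral>x. \<bar>f x\<bar> powr p \<partial>M) = (lp_norm M p f) powr p"
    using assms(1) by (simp add: lp_norm_def powr_powr)
  also have "\<dots> \<le> K powr p"
    using assms by (intro powr_mono2) (auto simp: lp_norm_def)
  finally show ?thesis .
qed

lemma lp_norm_nonneg: "0 \<le> lp_norm M p f"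
  by (simp add: lp_norm_def)

lemma lp_norm_le_smooth_sobolev_norm:
  "j \<le> k \<Longrightarrow> lp_norm (vol U g) p (tensor_norm g j (nabla g j u)) \<le> smooth_sobolev_norm U g k p u"
  unfolding smooth_sobolev_norm_def by (rule member_le_sum) (auto simp: lp_norm_nonneg)

lemma smooth_sobolev_norm_nonneg: "0 \<le> smooth_sobolev_norm U g k p u"
  unfolding smooth_sobolev_norm_def by (intro sum_nonneg lp_norm_nonneg)

lemma sobolev_represents_subseq:
  assumes "sobolev_represents U g k p us u" "strict_mono s"
  shows "sobolev_represents U g k p (us \<circ> s) u"
  unfolding sobolev_represents_def
proof (intro conjI allI impI)
  show "(us \<circ> s) n \<in> smooth_sobolev U g k p" for n
    using assms by (simp add: sobolev_represents_def)
  show "u \<in> lp_space (vol U g) p"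
    using assms by (simp add: sobolev_represents_def)
  show "(\<lambda>n. lp_norm (vol U g) p (\<lambda>x. (us \<circ> s) n x - u x)) \<longlonglongrightarrow> 0"
    using assms LIMSEQ_subseq_LIMSEQ [of "\<lambda>n. lp_norm (vol U g) p (\<lambda>x. us n x - u x)" 0 s]
    by (simp add: sobolev_represents_def o_def)
  fix e :: real assume "e > 0"
  then obtain n0 where n0: "\<forall>m\<ge>n0. \<forall>n\<ge>n0. smooth_sobolev_norm U g k p (\<lambda>x. us m x - us n x) < e"
    using assms(1) unfolding sobolev_represents_def by blast
  have "smooth_sobolev_norm U g k p (\<lambda>x. (us \<circ> s) m x - (us \<circ> s) n x) < e" if "m \<ge> n0" "n \<ge> n0" for m n
    using n0 that seq_suble [OF assms(2), of m] seq_suble [OF assms(2), of n] by auto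
  then show "\<exists>n0. \<forall>m\<ge>n0. \<forall>n\<ge>n0. smooth_sobolev_norm U g k p (\<lambda>x. (us \<circ> s) m x - (us \<circ> s) n x) < e"
    by blast
qed

lemma AE_lebesgue_on_iff:
  assumes "S \<in> sets borel"
  shows "(AE x in lebesgue_on S. P x) \<longleftrightarrow> (AE x in lborel. x \<in> S \<longrightarrow> P x)"
  using assms by (simp add: AE_restrict_space_iff AE_completion_iff)

lemma nn_integral_lebesgue_on:
  fixes f :: "'a::euclidean_space \<Rightarrow> ennreal"
  assumes "f \<in> borel_measurable borel" "S \<in> sets borel"
  shows "(\<integral>\<^sup>+x. f x \<partial>lebesgue_on S) = (\<integral>\<^sup>+x\<in>S. f x \<partial>lborel)"
  using assms by (simp add: nn_integral_restrict_space nn_integral_completion)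

section \<open>Comparison of Riemannian volume and Lebesgue measure; norms of smooth
  functions\<close>

context warped_ball
begin

lemma sets_vol [measurable_cong, simp]: "sets vol_measure = sets leb"
  by (simp add: vol_def)

lemma space_vol [simp]: "space vol_measure = ball 0 R"
  by (simp add: vol_def)

lemma AE_leb_iff: "(AE x :: 'a::euclidean_space in leb. P x) \<longleftrightarrow> (AE x in lborel. x \<in> ball 0 R \<longrightarrow> P x)"
  by (rule AE_lebesgue_on_iff) simp

lemma AE_leb_punctured_iff:
  "(AE x :: 'a::euclidean_space in leb. P x) \<longleftrightarrow> (AE x in lborel. x \<in> punctured \<longrightarrow> P x)"
  unfolding AE_leb_iff using AE_lborel_singleton [of "0 :: 'a"] by (auto elim: eventually_elim2)

lemma AE_lebesgue_on_punctured: "AE x in leb. (x :: 'a::euclidean_space) \<in> punctured"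
  by (simp add: AE_leb_punctured_iff)

lemma volume_density_measurable [measurable]:
  "(\<lambda>x :: real^'n. ennreal (sqrt (det (g x)))) \<in> borel_measurable leb"
proof -
  have "(\<lambda>x :: real^'n. sqrt (det (g x))) \<in> borel_measurable leb"
    unfolding det_def
    by (intro continuous_on_punctured_measurable continuous_intros smooth_on_continuous_on [OF smooth_on_g])
  then show ?thesis by measurable
qed

lemma nn_integral_vol:
  fixes f :: "real^'n \<Rightarrow> ennreal"
  assumes "f \<in> borel_measurable leb"
  shows "(\<integral>\<^sup>+x. f x \<partial>vol_measure) = (\<integral>\<^sup>+x. ennreal (sqrt (det (g x))) * f x \<partial>leb)"
  unfolding vol_def using assms by (intro nn_integral_density) auto

lemma nn_integral_lebesgue_le_vol:
  obtains D where "0 < D" "\<And>f :: real^'n \<Rightarrow> ennreal. f \<in> borel_measurable leb \<Longrightarrow>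
       (\<integral>\<^sup>+x. f x \<partial>leb) \<le> ennreal D * (\<integral>\<^sup>+x. f x \<partial>vol_measure)"
proof -
  obtain E E' where E: "0 < E" "E \<le> E'" "\<And>x :: real^'n. x \<in> punctured \<Longrightarrow> E \<le> sqrt (det (g x))"
    "\<And>x :: real^'n. x \<in> punctured \<Longrightarrow> sqrt (det (g x)) \<le> E'"
    using sqrt_det_g_bounds by blast
  have "(\<integral>\<^sup>+x. f x \<partial>leb) \<le> ennreal (1 / E) * (\<integral>\<^sup>+x. f x \<partial>vol_measure)"
    if [measurable]: "f \<in> borel_measurable leb" for f :: "real^'n \<Rightarrow> ennreal"
  proof -
    have "(\<integral>\<^sup>+x. f x \<partial>leb) \<le> (\<integral>\<^sup>+x. ennreal (1 / E) * (ennreal (sqrt (det (g x))) * f x) \<partial>leb)"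
    proof (rule nn_integral_mono_AE)
      show "AE x in leb. f x \<le> ennreal (1 / E) * (ennreal (sqrt (det (g x))) * f x)"
        using AE_lebesgue_on_punctured
      proof eventually_elim
        case (elim x)
        have "1 \<le> 1 / E * sqrt (det (g x))"
          using E(1) E(3) [OF elim] by (simp add: field_simps)
        then have "ennreal 1 \<le> ennreal (1 / E * sqrt (det (g x)))" by (rule ennreal_leI)
        also have "\<dots> = ennreal (1 / E) * ennreal (sqrt (det (g x)))"
          using E(1) by (intro ennreal_mult') simp
        finally have "1 * f x \<le> ennreal (1 / E) * ennreal (sqrt (det (g x))) * f x"
          by (intro mult_right_mono) simp_all
        then show ?case by (simp add: mult.assoc)
      qed
    qed
    then show ?thesis by (simp add: nn_integral_cmult nn_integral_vol)
  qed
  then show thesis using that [of "1 / E"] E(1) by simp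
qed

lemma nn_integral_vol_le_lebesgue:
  obtains D where "0 < D" "\<And>f :: real^'n \<Rightarrow> ennreal. f \<in> borel_measurable leb \<Longrightarrow>
       (\<integral>\<^sup>+x. f x \<partial>vol_measure) \<le> ennreal D * (\<integral>\<^sup>+x. f x \<partial>leb)"
proof -
  obtain E' E where E: "0 < E'" "E' \<le> E" "\<And>x :: real^'n. x \<in> punctured \<Longrightarrow> E' \<le> sqrt (det (g x))"
    "\<And>x :: real^'n. x \<in> punctured \<Longrightarrow> sqrt (det (g x)) \<le> E"
    using sqrt_det_g_bounds by blast
  have "(\<integral>\<^sup>+x. f x \<partial>vol_measure) \<le> ennreal E * (\<integral>\<^sup>+x. f x \<partial>leb)"
    if [measurable]: "f \<in> borel_measurable leb" for f :: "real^'n \<Rightarrow> ennreal"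
  proof -
    have "(\<integral>\<^sup>+x. ennreal (sqrt (det (g x))) * f x \<partial>leb) \<le> (\<integral>\<^sup>+x. ennreal E * f x \<partial>leb)"
      by (rule nn_integral_mono_AE, use AE_lebesgue_on_punctured in eventually_elim)
        (use E in \<open>auto intro!: mult_right_mono ennreal_leI\<close>)
    then show ?thesis by (simp add: nn_integral_cmult nn_integral_vol)
  qed
  then show thesis using that [of E] E(1,2) by simp
qed

lemma AE_vol_iff: "(AE x :: real^'n in vol_measure. P x) \<longleftrightarrow> (AE x in leb. P x)"
proof -
  obtain D1 D2 where D: "0 < D1" "D1 \<le> D2" "\<And>x :: real^'n. x \<in> punctured \<Longrightarrow> D1 \<le> sqrt (det (g x))"
    "\<And>x :: real^'n. x \<in> punctured \<Longrightarrow> sqrt (det (g x)) \<le> D2"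
    using sqrt_det_g_bounds by blast
  have "AE x :: real^'n in leb. 0 < ennreal (sqrt (det (g x)))"
    using AE_lebesgue_on_punctured
  proof eventually_elim
    case (elim x)
    have "0 < sqrt (det (g x))" using D(1) D(3) [OF elim] by linarith
    then show ?case by (simp only: ennreal_less_zero_iff)
  qed
  then have "(AE x :: real^'n in leb. 0 < ennreal (sqrt (det (g x))) \<longrightarrow> P x) \<longleftrightarrow> (AE x in leb. P x)"
    by (auto elim: eventually_elim2)
  then show ?thesis unfolding vol_def AE_density [OF volume_density_measurable] .
qed

lemma tensor_norm_nonneg: "x \<in> punctured \<Longrightarrow> 0 \<le> tensor_norm g j T x"
  by (simp add: tensor_norm_eq_L2_set [OF matrix_inv_g_square])

text \<open>The passage from the manifold to the Euclidean ball: radial derivatives are dominated by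
  tensor norms, and \<open>c\<close> absorbs the lower bound of the volume density.\<close>

lemma smooth_sobolev_ray_chain_bound:
  obtains c where "c > 0" and
    "\<And>(u :: real^'n \<Rightarrow> real) k K. u \<in> smooth_W k p \<Longrightarrow> W_norm k p u \<le> K \<Longrightarrow> K > 0 \<Longrightarrow> p \<ge> 1 \<Longrightarrow>
       ray_chain_bound k p R (c * K) (radial_derivs u)"
proof -
  obtain D1 where "0 < D1" and D1: "\<And>f :: real^'n \<Rightarrow> ennreal. f \<in> borel_measurable leb \<Longrightarrow>
       (\<integral>\<^sup>+x. f x \<partial>leb) \<le> ennreal D1 * (\<integral>\<^sup>+x. f x \<partial>vol_measure)"
    using nn_integral_lebesgue_le_vol by blast
  define c where "c = D1 powr (1 / p)"
  have "c > 0" using \<open>0 < D1\<close> by (simp add: c_def)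
  moreover have "ray_chain_bound k p R (c * K) (radial_derivs u)"
    if u: "u \<in> smooth_W k p" and uK: "W_norm k p u \<le> K" and "K > 0" "p \<ge> 1"
    for u :: "real^'n \<Rightarrow> real" and k K
    unfolding ray_chain_bound_def
  proof (intro conjI allI impI)
    have sm: "smooth_on (ball 0 R) u" using u by (simp add: smooth_sobolev_def)
    then show rc: "ray_chain R (radial_derivs u)" by (rule ray_chain_radial_derivs)
    show "0 < c * K" using \<open>c > 0\<close> \<open>K > 0\<close> by simp
    fix j assume "j \<le> k"
    let ?T = "tensor_norm g j (nabla g j u)"
    have T: "?T \<in> lp_space vol_measure p" using u \<open>j \<le> k\<close> by (simp add: smooth_sobolev_def)
    note [measurable] = tensor_norm_nabla_measurable [OF sm] ray_chain_measurable [OF rc]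
    have "lp_norm vol_measure p ?T \<le> K"
      using lp_norm_le_smooth_sobolev_norm [OF \<open>j \<le> k\<close>] uK by (rule order_trans)
    then have I: "(\<integral>x. \<bar>?T x\<bar> powr p \<partial>vol_measure) \<le> K powr p"
      using \<open>p \<ge> 1\<close> by (intro integral_le_of_lp_norm_le)
    have "(\<integral>\<^sup>+x\<in>ball 0 R. ennreal (\<bar>radial_derivs u j x\<bar> powr p) \<partial>lborel)
        = (\<integral>\<^sup>+x. ennreal (\<bar>radial_derivs u j x\<bar> powr p) \<partial>leb)"
      by (rule nn_integral_lebesgue_on [symmetric]) simp_all
    also have "\<dots> \<le> (\<integral>\<^sup>+x. ennreal (\<bar>?T x\<bar> powr p) \<partial>leb)"
    proof (rule nn_integral_mono_AE)
      show "AE x in leb. ennreal (\<bar>radial_derivs u j x\<bar> powr p) \<le> ennreal (\<bar>?T x\<bar> powr p)"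
        using AE_lebesgue_on_punctured
      proof eventually_elim
        case (elim x)
        then have "\<bar>radial_derivs u j x\<bar> \<le> \<bar>?T x\<bar>" using abs_radial_derivs_le [OF elim, of u j] by simp
        then show ?case using \<open>p \<ge> 1\<close> by (intro ennreal_leI powr_mono2) auto
      qed
    qed
    also have "\<dots> \<le> ennreal D1 * (\<integral>\<^sup>+x. ennreal (\<bar>?T x\<bar> powr p) \<partial>vol_measure)"
      by (rule D1) measurable
    also have "(\<integral>\<^sup>+x. ennreal (\<bar>?T x\<bar> powr p) \<partial>vol_measure) = ennreal (\<integral>x. \<bar>?T x\<bar> powr p \<partial>vol_measure)"
      using T by (intro nn_integral_eq_integral) (auto simp: lp_space_def)
    also have "ennreal D1 * \<dots> \<le> ennreal D1 * ennreal (K powr p)"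
      using I by (intro mult_left_mono ennreal_leI) auto
    also have "\<dots> = ennreal ((c * K) powr p)"
      using \<open>0 < D1\<close> \<open>K > 0\<close> \<open>p \<ge> 1\<close> by (simp add: c_def powr_mult powr_powr flip: ennreal_mult)
    finally show "(\<integral>\<^sup>+x\<in>ball 0 R. ennreal (\<bar>radial_derivs u j x\<bar> powr p) \<partial>lborel) \<le> ennreal ((c * K) powr p)" .
  qed
  ultimately show thesis using that by blast
qed

text \<open>The Bochner integral of a non-integrable function is 0, so a small norm of a difference
  carries information only together with integrability.\<close>

lemma smooth_sobolev_diff_lp:
  fixes u v :: "real^'n \<Rightarrow> real"
  assumes "p \<ge> 1" "u \<in> smooth_W k p" "v \<in> smooth_W k p" "j \<le> k"
  shows "tensor_norm g j (nabla g j (\<lambda>x. u x - v x)) \<in> lp_space vol_measure p"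
    and "AE x in vol_measure. tensor_norm g j (nabla g j u) x \<le> tensor_norm g j (nabla g j (\<lambda>x. u x - v x)) x + tensor_norm g j (nabla g j v) x"
proof -
  have sm: "smooth_on (ball 0 R) u" "smooth_on (ball 0 R) v"
    using assms by (auto simp: smooth_sobolev_def)
  then have smd: "smooth_on (ball 0 R) (\<lambda>x. u x - v x)" by (intro smooth_on_diff open_ball)
  note [measurable] = sm [THEN tensor_norm_nabla_measurable, of j] smd [THEN tensor_norm_nabla_measurable, of j]
  let ?Tu = "tensor_norm g j (nabla g j u)" and ?Tv = "tensor_norm g j (nabla g j v)"
    and ?Td = "tensor_norm g j (nabla g j (\<lambda>x. u x - v x))"
  have nd: "nabla g j (\<lambda>x. u x - v x) is x = nabla g j u is x - nabla g j v is x" if "x \<in> punctured" for x "is"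
    using sm that
    by (intro nabla_diff [OF open_punctured smooth_on_christoffel_g]) (auto intro: smooth_on_subset)
  have minus: "tensor_norm g j (\<lambda>is x. - T is x) x = tensor_norm g j T x" for T and x :: "real^'n"
    by (simp add: tensor_norm_def)
  have 1: "?Td x \<le> ?Tu x + ?Tv x" if "x \<in> punctured" for x
    using tensor_norm_triangle [of g x "root_inv x" "nabla g j (\<lambda>x. u x - v x)" "nabla g j u" "\<lambda>is x. - nabla g j v is x" j, OF matrix_inv_g_square [OF that]]
    by (simp add: nd [OF that] minus)
  have 2: "?Tu x \<le> ?Td x + ?Tv x" if "x \<in> punctured" for x
    using tensor_norm_triangle [of g x "root_inv x" "nabla g j u" "nabla g j (\<lambda>x. u x - v x)" "nabla g j v" j, OF matrix_inv_g_square [OF that]]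
    by (simp add: nd [OF that])
  have AE_p: "AE x :: real^'n in vol_measure. x \<in> punctured"
    by (simp only: AE_vol_iff AE_lebesgue_on_punctured)
  show "AE x in vol_measure. ?Tu x \<le> ?Td x + ?Tv x"
    using AE_p by eventually_elim (rule 2)
  have int: "integrable vol_measure (\<lambda>x. 2 powr p * (\<bar>?Tu x\<bar> powr p + \<bar>?Tv x\<bar> powr p))"
    using assms by (intro integrable_mult_right Bochner_Integration.integrable_add) (auto simp: lp_space_def smooth_sobolev_def)
  have "integrable vol_measure (\<lambda>x. \<bar>?Td x\<bar> powr p)"
  proof (rule Bochner_Integration.integrable_bound [OF int])
    show "AE x in vol_measure. norm (\<bar>?Td x\<bar> powr p) \<le> norm (2 powr p * (\<bar>?Tu x\<bar> powr p + \<bar>?Tv x\<bar> powr p))"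
      using AE_p
    proof eventually_elim
      case (elim x)
      have "\<bar>?Td x\<bar> powr p \<le> \<bar>?Tu x + ?Tv x\<bar> powr p"
        using 1 [OF elim] tensor_norm_nonneg [OF elim] \<open>p \<ge> 1\<close> by (intro powr_mono2) auto
      also have "\<dots> \<le> 2 powr p * (\<bar>?Tu x\<bar> powr p + \<bar>?Tv x\<bar> powr p)"
        by (rule abs_add_powr_le [OF \<open>p \<ge> 1\<close>])
      finally show ?case by simp
    qed
  qed measurable
  then show "?Td \<in> lp_space vol_measure p"
    by (simp add: lp_space_def)
qed

text \<open>Ensures that \<open>sobolev_norm\<close> is an infimum over a nonempty set. Along a
  representing Cauchy sequence the norms stay in a compact interval, and a subsequence with
  convergent norms represents the same function.\<close>

lemma sobolev_represents_norm_convergent: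
  fixes u :: "real^'n \<Rightarrow> real"
  assumes "p \<ge> 1" and rep: "represents k p us u"
  shows "\<exists>us' l. represents k p us' u \<and> (\<lambda>n. W_norm k p (us' n)) \<longlonglongrightarrow> l"
proof -
  let ?N = "W_norm k p"
  have us: "us n \<in> smooth_W k p" for n
    using rep by (simp add: sobolev_represents_def)
  obtain n0 where n0: "\<forall>m\<ge>n0. \<forall>n\<ge>n0. ?N (\<lambda>x. us m x - us n x) < 1"
    using rep zero_less_one unfolding sobolev_represents_def by blast
  define I where "I j n = (\<integral>x. \<bar>tensor_norm g j (nabla g j (us n)) x\<bar> powr p \<partial>vol_measure)" for j n
  \<comment> \<open>The 1 bounds the integral for the difference to \<open>us n0\<close>, by the
    Cauchy property with e = 1.\<close>
  define b where "b j = (2 powr p * (1 + I j n0)) powr (1 / p)" for j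
  have le_b: "lp_norm vol_measure p (tensor_norm g j (nabla g j (us n))) \<le> b j" if "n \<ge> n0" "j \<le> k" for n j
  proof -
    let ?T = "tensor_norm g j (nabla g j (us n))" and ?S = "tensor_norm g j (nabla g j (us n0))"
      and ?Td = "tensor_norm g j (nabla g j (\<lambda>x. us n x - us n0 x))"
    note d = smooth_sobolev_diff_lp [OF \<open>p \<ge> 1\<close> us [of n] us [of n0] \<open>j \<le> k\<close>]
    have "lp_norm vol_measure p ?Td \<le> 1"
      using lp_norm_le_smooth_sobolev_norm [OF \<open>j \<le> k\<close>, of "ball 0 R" g p "\<lambda>x. us n x - us n0 x"] n0 \<open>n \<ge> n0\<close> by fastforce
    then have Id: "(\<integral>x. \<bar>?Td x\<bar> powr p \<partial>vol_measure) \<le> 1"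
      using integral_le_of_lp_norm_le [OF \<open>p \<ge> 1\<close>, of vol_measure ?Td 1] by simp
    have i: "integrable vol_measure (\<lambda>x. \<bar>tensor_norm g j (nabla g j (us n)) x\<bar> powr p)" for n
      using us [of n] \<open>j \<le> k\<close> by (auto simp: lp_space_def smooth_sobolev_def)
    have id: "integrable vol_measure (\<lambda>x. \<bar>?Td x\<bar> powr p)"
      using d(1) by (simp add: lp_space_def)
    have AE_p: "AE x :: real^'n in vol_measure. x \<in> punctured"
      by (simp only: AE_vol_iff AE_lebesgue_on_punctured)
    have "I j n \<le> (\<integral>x. 2 powr p * (\<bar>?Td x\<bar> powr p + \<bar>?S x\<bar> powr p) \<partial>vol_measure)"
      unfolding I_def
    proof (rule integral_mono_AE [OF i [of n]])
      show "integrable vol_measure (\<lambda>x. 2 powr p * (\<bar>?Td x\<bar> powr p + \<bar>?S x\<bar> powr p))"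
        by (intro integrable_mult_right Bochner_Integration.integrable_add id i)
      show "AE x in vol_measure. \<bar>?T x\<bar> powr p \<le> 2 powr p * (\<bar>?Td x\<bar> powr p + \<bar>?S x\<bar> powr p)"
        using AE_p d(2)
      proof eventually_elim
        case (elim x)
        have "\<bar>?T x\<bar> powr p \<le> \<bar>?Td x + ?S x\<bar> powr p"
          using elim(2) tensor_norm_nonneg [OF elim(1)] \<open>p \<ge> 1\<close> by (intro powr_mono2) auto
        also have "\<dots> \<le> 2 powr p * (\<bar>?Td x\<bar> powr p + \<bar>?S x\<bar> powr p)"
          by (rule abs_add_powr_le [OF \<open>p \<ge> 1\<close>])
        finally show ?case .
      qed
    qed
    also have "\<dots> = 2 powr p * ((\<integral>x. \<bar>?Td x\<bar> powr p \<partial>vol_measure) + I j n0)"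
      unfolding I_def by (simp add: Bochner_Integration.integral_add [OF id i])
    also have "\<dots> \<le> 2 powr p * (1 + I j n0)" using Id by simp
    finally have "I j n \<le> 2 powr p * (1 + I j n0)" .
    moreover have "0 \<le> I j n" by (simp add: I_def)
    ultimately show ?thesis
      unfolding lp_norm_def b_def I_def [symmetric] using \<open>p \<ge> 1\<close> by (intro powr_mono2) auto
  qed
  have "?N (us n) \<le> (\<Sum>j\<le>k. b j)" if "n \<ge> n0" for n
    unfolding smooth_sobolev_norm_def using le_b that by (intro sum_mono) auto
  then have "\<forall>n. ?N (us (n + n0)) \<in> {0..\<Sum>j\<le>k. b j}"
    by (auto simp: smooth_sobolev_norm_nonneg)
  then obtain l s where s: "strict_mono (s :: nat \<Rightarrow> nat)" and l: "((\<lambda>n. ?N (us (n + n0))) \<circ> s) \<longlonglongrightarrow> l"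
    using compact_Icc [of 0 "\<Sum>j\<le>k. b j"] unfolding compact_def by meson
  \<comment> \<open>The bound on the norms holds from n0 on, hence the shift.\<close>
  have "strict_mono (\<lambda>n. s n + n0)" using s by (auto simp: strict_mono_def)
  then have "represents k p (us \<circ> (\<lambda>n. s n + n0)) u"
    by (rule sobolev_represents_subseq [OF rep])
  moreover have "(\<lambda>n. ?N ((us \<circ> (\<lambda>n. s n + n0)) n)) \<longlonglongrightarrow> l"
    using l by (simp add: o_def)
  ultimately show ?thesis by blast
qed

end

section \<open>The pointwise bound\<close>

lemma ennreal_suminf_imp_tendsto_0:
  fixes f :: "nat \<Rightarrow> ennreal"
  assumes "(\<Sum>n. f n) < \<infinity>"
  shows "(\<lambda>n. enn2real (f n)) \<longlonglongrightarrow> 0" "f n < \<infinity>"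
proof -
  have fin: "f n < \<infinity>" for n
    using ennreal_suminf_lessD assms by blast
  then show "f n < \<infinity>" .
  have "(\<Sum>n. ennreal (enn2real (f n))) = (\<Sum>n. f n)"
    using fin by (intro suminf_cong) (simp add: less_top)
  then have "summable (\<lambda>n. enn2real (f n))"
    using assms by (intro summable_suminf_not_top) auto
  then show "(\<lambda>n. enn2real (f n)) \<longlonglongrightarrow> 0" by (rule summable_LIMSEQ_zero)
qed

text \<open>The spaces are built on completed Lebesgue measure, while the polar formulas are stated
  for Borel functions.\<close>

lemma borel_representative:
  fixes u :: "'a::euclidean_space \<Rightarrow> real"
  assumes "u \<in> borel_measurable (lebesgue_on S)" and S: "S \<in> sets borel"
  obtains u' where "u' \<in> borel_measurable borel" "AE x in lebesgue_on S. u x = u' x"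
proof -
  have "(\<lambda>x. if x \<in> S then u x else 0) \<in> borel_measurable lebesgue"
    using assms by (intro borel_measurable_if_I) auto
  then obtain u' where u': "u' \<in> borel_measurable lborel" "AE x in lborel. (if x \<in> S then u x else 0) = u' x"
    using completion_ex_borel_measurable_real by blast
  have "AE x in lebesgue_on S. u x = u' x"
    unfolding AE_lebesgue_on_iff [OF S] using u'(2) by eventually_elim auto
  with u'(1) show thesis using that by simp
qed

text \<open>The converse direction to \<open>AE_polar\<close>: the spheres with radii in a null set
  form a null set, because on a sphere the indicator in question is constant.\<close>

lemma AE_radial:
  assumes "R > 0" and "AE r in lborel. r \<in> {0<..<R} \<longrightarrow> P r"
  shows "AE x :: 'a::euclidean_space in lborel. x \<in> ball 0 R - {0} \<longrightarrow> P (norm x)"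
proof -
  obtain Z where Z: "{r. \<not> (r \<in> {0<..<R} \<longrightarrow> P r)} \<subseteq> Z" and Z0: "emeasure lborel Z = 0"
    and [measurable]: "Z \<in> sets borel"
    using assms(2) by (auto elim!: AE_E)
  let ?I = "\<lambda>r. \<integral>\<^sup>+w. indicator Z (norm (r *\<^sub>R w)) \<partial>(cone_measure :: 'a measure)"
  have "(\<integral>\<^sup>+x\<in>ball (0::'a) R. indicator Z (norm x) \<partial>lborel) =
    (\<integral>\<^sup>+r\<in>{0<..<R}. ennreal (real DIM('a) * r ^ (DIM('a) - 1)) *
       ?I r \<partial>lborel)"
    using assms by (subst nn_integral_polar) auto
  also have "\<dots> = (\<integral>\<^sup>+r. 0 \<partial>(lborel :: real measure))"
  proof (rule nn_integral_cong_AE)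
    have "AE r in lborel. r \<notin> Z"
      using Z0 by (intro AE_not_in) auto
    then show "AE r in lborel. ennreal (real DIM('a) * r ^ (DIM('a) - 1)) *
       ?I r * indicator {0<..<R} r = 0"
    proof eventually_elim
      case (elim r)
      have "?I r = (\<integral>\<^sup>+w. 0 \<partial>(cone_measure :: 'a measure))"
        if "r > 0"
        by (rule nn_integral_cong_AE, use AE_cone_measure_norm in eventually_elim) (use that elim in simp)
      then show ?case by (auto simp: indicator_def)
    qed
  qed
  finally have "(\<integral>\<^sup>+x\<in>ball (0::'a) R. indicator Z (norm x) \<partial>lborel) = 0" by simp
  moreover have [measurable]: "ball (0::'a) R \<in> sets borel" by simp
  ultimately have "AE x :: 'a in lborel. indicator Z (norm x) * indicator (ball 0 R) x = (0 :: ennreal)"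
    by (subst (asm) nn_integral_0_iff_AE) measurable
  then show ?thesis
  proof eventually_elim
    case (elim x)
    show ?case
    proof
      assume "x \<in> ball 0 R - {0}"
      then have "norm x \<in> {0<..<R}" "norm x \<notin> Z"
        using elim by (auto simp: indicator_def split: if_splits)
      then show "P (norm x)" using Z by blast
    qed
  qed
qed

text \<open>In polar coordinates the exponent is s + N - 1 > -1, which is integrable at 0.\<close>

lemma nn_integral_norm_powr_finite:
  assumes "R > 0" "s > - real DIM('a)"
  shows "(\<integral>\<^sup>+x\<in>ball (0::'a::euclidean_space) R. ennreal (norm x powr s) \<partial>lborel) < \<infinity>"
proof -
  define N where "N = DIM('a)"
  have "N \<ge> 1" by (simp add: N_def DIM_positive Suc_leI)
  define e where "e = s + real N - 1"
  have "e > -1" using assms by (simp add: e_def N_def)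
  let ?S = "emeasure (cone_measure :: 'a measure) UNIV"
  let ?I = "\<lambda>r. \<integral>\<^sup>+w. ennreal (norm (r *\<^sub>R w) powr s) \<partial>(cone_measure :: 'a measure)"
  have fin: "(\<integral>\<^sup>+r\<in>{0<..<R}. ennreal (r powr e) \<partial>lborel) < \<infinity>"
  proof -
    have "((\<lambda>r. r powr e) has_integral (R powr (e + 1) / (e + 1))) {0..R}"
      using \<open>e > -1\<close> assms(1) by (intro has_integral_powr_from_0) auto
    then have "((\<lambda>r. if r \<in> {0..R} then r powr e else 0) has_integral (R powr (e + 1) / (e + 1))) UNIV"
      by (subst has_integral_restrict_UNIV)
    then have "(\<integral>\<^sup>+r. ennreal (if r \<in> {0..R} then r powr e else 0) \<partial>lborel) = ennreal (R powr (e + 1) / (e + 1))"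
      by (intro nn_integral_has_integral_lborel) auto
    moreover have "(\<integral>\<^sup>+r\<in>{0<..<R}. ennreal (r powr e) \<partial>lborel) \<le> (\<integral>\<^sup>+r. ennreal (if r \<in> {0..R} then r powr e else 0) \<partial>lborel)"
      by (intro nn_integral_mono) (auto simp: indicator_def)
    ultimately show ?thesis by (simp add: order.strict_trans1)
  qed
  have "(\<integral>\<^sup>+x\<in>ball (0::'a) R. ennreal (norm x powr s) \<partial>lborel) =
    (\<integral>\<^sup>+r\<in>{0<..<R}. ennreal (real N * r ^ (N - 1)) *
       ?I r \<partial>lborel)"
    using assms unfolding N_def by (subst nn_integral_polar) auto
  also have "\<dots> = (\<integral>\<^sup>+r. ennreal (real N) * ?S * (ennreal (r powr e) * indicator {0<..<R} r) \<partial>lborel)"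
  proof (rule nn_integral_cong)
    fix r :: real
    have "ennreal (real N * r ^ (N - 1)) * ?I r
        = ennreal (real N) * ?S * ennreal (r powr e)" if r: "0 < r"
    proof -
      have "?I r = (\<integral>\<^sup>+w. ennreal (r powr s) \<partial>(cone_measure :: 'a measure))"
        by (rule nn_integral_cong_AE, use AE_cone_measure_norm in eventually_elim) (use r in simp)
      also have "\<dots> = ennreal (r powr s) * ?S" by simp
      finally have *: "?I r = ennreal (r powr s) * ?S" .
      have "r ^ (N - 1) * r powr s = r powr e"
        using r \<open>N \<ge> 1\<close> by (simp add: e_def powr_realpow [symmetric] powr_add [symmetric] of_nat_diff algebra_simps)
      then have "ennreal (real N * r ^ (N - 1)) * ennreal (r powr s) = ennreal (real N) * ennreal (r powr e)"
        using r by (simp add: ennreal_mult [symmetric] mult.assoc)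
      then show ?thesis unfolding * by (simp add: mult_ac)
    qed
    then show "ennreal (real N * r ^ (N - 1)) * ?I r * indicator {0<..<R} r
      = ennreal (real N) * ?S * (ennreal (r powr e) * indicator {0<..<R} r)"
      by (auto simp: indicator_def)
  qed
  also have "\<dots> = ennreal (real N) * ?S * (\<integral>\<^sup>+r\<in>{0<..<R}. ennreal (r powr e) \<partial>lborel)"
    by (rule nn_integral_cmult) measurable
  also have "\<dots> < \<infinity>"
    using fin by (simp add: ennreal_mult_less_top cone.emeasure_eq_measure)
  finally show ?thesis .
qed

text \<open>The argument \<open>type_n\<close> puts the type variable \<open>'n\<close> among the
  parameters of the locale, so that the dimension may occur in its assumptions.\<close>

locale radial_embedding = warped_ball +
  fixes p q \<theta> :: real and k :: nat and type_n :: "'n::finite itself"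
  assumes p: "p \<ge> 1" and k: "k \<ge> 1" and kp: "real CARD('n) > real k * p"
    and \<theta>: "\<theta> \<ge> 0" and q: "1 \<le> q" "q < (\<theta> + real CARD('n)) * p / (real CARD('n) - real k * p)"
begin

abbreviation vol_n :: "(real^'n) measure" where "vol_n \<equiv> vol_measure"

abbreviation leb_n :: "(real^'n) measure" where "leb_n \<equiv> leb"

text \<open>The decay exponent of \<open>radial_lemma\<close>.\<close>

definition b :: real where "b = real CARD('n) / p - real k"

lemma b_pos: "b > 0"
  using kp p by (simp add: b_def field_simps)

text \<open>Subcriticality of \<open>q\<close> in the form in which the integrability of
  \<open>weight\<close> needs it.\<close>

lemma bq: "q * b < \<theta> + real CARD('n)"
proof -
  have "q * (real CARD('n) - real k * p) < (\<theta> + real CARD('n)) * p"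
    using q(2) kp by (simp add: less_divide_eq)
  then have "q * (real CARD('n) - real k * p) / p < \<theta> + real CARD('n)"
    using p by (simp add: divide_less_eq)
  moreover have "q * (real CARD('n) - real k * p) / p = q * b"
    using p by (simp add: b_def field_simps)
  ultimately show ?thesis by simp
qed

lemma kb: "real DIM(real^'n) / p > real k"
  using b_pos by (simp add: b_def)

lemma phi_norm_measurable [measurable]: "(\<lambda>x. \<phi> (norm x)) \<in> borel_measurable leb_n"
  by (intro continuous_on_punctured_measurable smooth_on_continuous_on smooth_on_phi_norm)

lemma norm_measurable_leb [measurable]: "norm \<in> borel_measurable leb_n"
  by (intro measurable_restrict_space1 measurable_completion) simp

text \<open>The \<open>q\<close>-th power of the pointwise bound \<open>norm x powr - b\<close>,
  times the weight of the target space: up to constants the dominating function for everything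
  below.\<close>

definition weight :: "real^'n \<Rightarrow> real" where
  "weight x = norm x powr (- b * q) * \<phi> (norm x) powr \<theta>"

lemma weight_measurable [measurable]: "weight \<in> borel_measurable leb_n"
  unfolding weight_def [abs_def] by measurable

text \<open>As \<phi>(r) \<le> c2 * r and \<theta> \<ge> 0, the weight is at most a multiple of
  r^(\<theta> - b q), and \<open>bq\<close> puts this exponent above -N.\<close>

lemma weight_integrable: "integrable vol_n weight"
proof (rule integrableI_bounded)
  obtain c1 c2 where c: "0 < c1" "\<And>r. 0 < r \<Longrightarrow> r < R \<Longrightarrow> c1 \<le> \<phi> r / r" "\<And>r. 0 < r \<Longrightarrow> r < R \<Longrightarrow> \<phi> r / r \<le> c2"
    using phi_ratio_bounds by blast
  have "c2 > 0" using c(1) c(2,3) [of "R / 2"] R_pos by simp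
  obtain D2 where "0 < D2" and D2: "\<And>f :: real^'n \<Rightarrow> ennreal. f \<in> borel_measurable leb \<Longrightarrow>
       (\<integral>\<^sup>+x. f x \<partial>vol_measure) \<le> ennreal D2 * (\<integral>\<^sup>+x. f x \<partial>leb)"
    using nn_integral_vol_le_lebesgue by blast
  have "(\<integral>\<^sup>+x. ennreal (norm (weight x)) \<partial>vol_n) \<le> ennreal D2 * (\<integral>\<^sup>+x. ennreal (norm (weight x)) \<partial>leb_n)"
    by (rule D2) measurable
  also have "\<dots> \<le> ennreal D2 * (\<integral>\<^sup>+x. ennreal (c2 powr \<theta>) * ennreal (norm x powr (\<theta> - b * q)) \<partial>leb_n)"
  proof (intro mult_left_mono nn_integral_mono_AE)
    show "AE x in leb_n. ennreal (norm (weight x)) \<le> ennreal (c2 powr \<theta>) * ennreal (norm x powr (\<theta> - b * q))"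
      using AE_lebesgue_on_punctured
    proof eventually_elim
      case (elim x)
      then have x: "0 < norm x" "norm x < R" by auto
      have "\<phi> (norm x) powr \<theta> \<le> (c2 * norm x) powr \<theta>"
        using c(3) [OF x] x phi_pos [OF x] \<theta> by (intro powr_mono2) (auto simp: divide_le_eq)
      then have "weight x \<le> norm x powr (- b * q) * (c2 powr \<theta> * norm x powr \<theta>)"
        using \<open>c2 > 0\<close> by (simp add: weight_def powr_mult mult_left_mono)
      also have "\<dots> = c2 powr \<theta> * norm x powr (\<theta> - b * q)"
        using x by (simp add: powr_diff powr_minus_divide)
      finally show ?case by (simp add: weight_def ennreal_leI flip: ennreal_mult)
    qed
  qed simp
  also have "(\<integral>\<^sup>+x. ennreal (c2 powr \<theta>) * ennreal (norm x powr (\<theta> - b * q)) \<partial>leb_n)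
      = ennreal (c2 powr \<theta>) * (\<integral>\<^sup>+x. ennreal (norm x powr (\<theta> - b * q)) \<partial>leb_n)"
    by (rule nn_integral_cmult) measurable
  also have "(\<integral>\<^sup>+x. ennreal (norm x powr (\<theta> - b * q)) \<partial>leb_n) = (\<integral>\<^sup>+x\<in>ball (0 :: real^'n) R. ennreal (norm x powr (\<theta> - b * q)) \<partial>lborel)"
    by (rule nn_integral_lebesgue_on) simp_all
  also have "ennreal D2 * (ennreal (c2 powr \<theta>) * \<dots>) < \<infinity>"
    using nn_integral_norm_powr_finite [where 'a = "real^'n", of R "\<theta> - b * q"] bq R_pos
    by (simp add: ennreal_mult_less_top mult.commute)
  finally show "(\<integral>\<^sup>+x. ennreal (norm (weight x)) \<partial>vol_n) < \<infinity>" .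
qed measurable

lemma weighted_norm_le:
  assumes u [measurable]: "u \<in> borel_measurable leb_n" and "A \<ge> 0"
    and bound: "AE x in leb_n. \<bar>u x\<bar> \<le> A * norm x powr - b"
  shows "u \<in> weighted_space R \<phi> \<theta> q"
    and "weighted_norm R \<phi> \<theta> q u \<le> A * (\<integral>x. weight x \<partial>vol_n) powr (1 / q)"
proof -
  have le: "AE x in vol_n. \<bar>u x\<bar> powr q * \<phi> (norm x) powr \<theta> \<le> A powr q * weight x"
    unfolding AE_vol_iff using bound
  proof eventually_elim
    case (elim x)
    have "\<bar>u x\<bar> powr q \<le> (A * norm x powr - b) powr q"
      using elim q by (intro powr_mono2) auto
    also have "\<dots> = A powr q * norm x powr (- b * q)"
      using \<open>A \<ge> 0\<close> by (simp add: powr_mult powr_powr)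
    finally have "\<bar>u x\<bar> powr q * \<phi> (norm x) powr \<theta> \<le> A powr q * norm x powr (- b * q) * \<phi> (norm x) powr \<theta>"
      by (rule mult_right_mono) simp
    then show ?case by (simp add: weight_def mult_ac)
  qed
  have int: "integrable vol_n (\<lambda>x. A powr q * weight x)"
    by (intro integrable_mult_right weight_integrable)
  have i: "integrable vol_n (\<lambda>x. \<bar>u x\<bar> powr q * \<phi> (norm x) powr \<theta>)"
    by (rule Bochner_Integration.integrable_bound [OF int]) (measurable, use le in eventually_elim, auto)
  then show "u \<in> weighted_space R \<phi> \<theta> q"
    by (simp add: weighted_space_def)
  have "(\<integral>x. \<bar>u x\<bar> powr q * \<phi> (norm x) powr \<theta> \<partial>vol_n) \<le> (\<integral>x. A powr q * weight x \<partial>vol_n)"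
    by (rule integral_mono_AE [OF i int le])
  then have "weighted_norm R \<phi> \<theta> q u \<le> (A powr q * (\<integral>x. weight x \<partial>vol_n)) powr (1 / q)"
    unfolding weighted_norm_def using q by (intro powr_mono2) auto
  also have "\<dots> = A * (\<integral>x. weight x \<partial>vol_n) powr (1 / q)"
    using q \<open>A \<ge> 0\<close> by (simp add: powr_mult powr_powr weight_def)
  finally show "weighted_norm R \<phi> \<theta> q u \<le> A * (\<integral>x. weight x \<partial>vol_n) powr (1 / q)" .
qed

lemma smooth_sobolev_lp:
  assumes "u \<in> smooth_W k p"
  shows "u \<in> lp_space vol_n p"
proof -
  have "(\<Sum>is\<in>{is :: 'n list. length is = 0}. f is) = f []" for f :: "'n list \<Rightarrow> real" by simp
  then have "tensor_norm g 0 (nabla g 0 u) = (\<lambda>x :: real^'n. \<bar>u x\<bar>)"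
    by (auto simp: tensor_norm_def nabla_def fun_eq_iff)
  moreover have "tensor_norm g 0 (nabla g 0 u) \<in> lp_space vol_n p"
    using assms by (auto simp: smooth_sobolev_def)
  moreover have "u \<in> borel_measurable leb_n"
    using assms by (intro continuous_imp_measurable_on_sets_lebesgue) (auto simp: smooth_sobolev_def intro: smooth_on_continuous_on)
  ultimately show ?thesis by (simp add: lp_space_def)
qed

lemma sobolev_represents_AE_subseq:
  fixes u :: "real^'n \<Rightarrow> real"
  assumes rep: "represents k p us u"
  shows "\<exists>s. strict_mono (s :: nat \<Rightarrow> nat) \<and> (AE x in leb_n. (\<lambda>n. us (s n) x) \<longlonglongrightarrow> u x)"
proof -
  have d: "(\<lambda>x. us n x - u x) \<in> lp_space vol_n p" for n
    using rep lp_space_diff [OF p smooth_sobolev_lp, of "us n" u] by (simp add: sobolev_represents_def)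
  let ?I = "\<lambda>n. \<integral>x. norm (\<bar>us n x - u x\<bar> powr p) \<partial>vol_n"
  have "(\<lambda>n. lp_norm vol_n p (\<lambda>x. us n x - u x) powr p) \<longlonglongrightarrow> 0 powr p"
    using rep p by (intro tendsto_powr' tendsto_const) (auto simp: sobolev_represents_def lp_norm_nonneg)
  moreover have "lp_norm vol_n p (\<lambda>x. us n x - u x) powr p = ?I n" for n
    using p by (simp add: lp_norm_def powr_powr)
  ultimately have "?I \<longlonglongrightarrow> 0" by simp
  then obtain s where s: "strict_mono (s :: nat \<Rightarrow> nat)" and AE: "AE x in vol_n. (\<lambda>n. \<bar>us (s n) x - u x\<bar> powr p) \<longlonglongrightarrow> 0"
    using tendsto_L1_AE_subseq [of vol_n "\<lambda>n x. \<bar>us n x - u x\<bar> powr p"] d by (auto simp: lp_space_def)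
  have "AE x in leb_n. (\<lambda>n. us (s n) x) \<longlonglongrightarrow> u x"
    using AE unfolding AE_vol_iff
  proof eventually_elim
    case (elim x)
    have "(\<lambda>n. (\<bar>us (s n) x - u x\<bar> powr p) powr (1 / p)) \<longlonglongrightarrow> 0 powr (1 / p)"
      using elim p by (intro tendsto_powr' tendsto_const) auto
    then have "(\<lambda>n. us (s n) x - u x) \<longlonglongrightarrow> 0"
      using p by (simp add: powr_powr tendsto_rabs_zero_iff)
    then show ?case by (simp add: LIM_zero_iff)
  qed
  with s show ?thesis by blast
qed

abbreviation "X_norm \<equiv> sobolev_norm (ball (0 :: real^'n) R) g k p"

abbreviation "smooth_norm \<equiv> smooth_sobolev_norm (ball (0 :: real^'n) R) g k p"

text \<open>The infimum need not be known to be attained; the strict inequality with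
  \<open>K\<close> provides a representing sequence whose norms are eventually below
  \<open>K\<close>.\<close>

lemma sobolev_rad_representation:
  fixes u :: "real^'n \<Rightarrow> real"
  assumes "u \<in> sobolev_rad R \<phi> k p" "X_norm u < K"
  obtains us l v where "represents k p us u" "(\<lambda>n. smooth_norm (us n)) \<longlonglongrightarrow> l"
    "AE x in leb_n. u x = v (norm x)" "l < K"
proof -
  let ?S = "{l. \<exists>us. represents k p us u \<and> (\<lambda>n. smooth_norm (us n)) \<longlonglongrightarrow> l}"
  have "u \<in> sobolev (ball 0 R) g k p" using assms(1) by (simp add: sobolev_rad_def)
  then obtain us0 where "represents k p us0 u" by (auto simp: sobolev_def)
  from sobolev_represents_norm_convergent [OF p this] have "?S \<noteq> {}" by blast
  moreover have "Inf ?S < K" using assms(2) by (simp add: sobolev_norm_def)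
  ultimately obtain l where "l \<in> ?S" "l < K" by (rule cInf_lessD [THEN bexE]) blast
  then obtain us where us: "represents k p us u" "(\<lambda>n. smooth_norm (us n)) \<longlonglongrightarrow> l" by blast
  obtain w where "radial R w" and w: "AE x in leb_n. u x = w x"
    using assms(1) by (auto simp: sobolev_rad_def AE_vol_iff)
  then obtain v where v: "\<And>x. x \<in> punctured \<Longrightarrow> w x = v (norm x)" by (auto simp: radial_def)
  have "AE x in leb_n. u x = v (norm x)"
    using w AE_lebesgue_on_punctured by eventually_elim (simp add: v)
  with us \<open>l < K\<close> show thesis using that by blast
qed

text \<open>On almost every sphere the approximants tend to the constant \<open>v r\<close> at
  almost every point. Fatou's lemma then bounds \<sigma> times its absolute value by the radial
  lemma for the approximants, whence the division by \<sigma>. The constant depends neither on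
  \<open>u\<close> nor on \<open>K\<close>.\<close>

lemma sobolev_rad_pointwise_bound:
  obtains C where "C \<ge> 0" and "\<And>(u :: real^'n \<Rightarrow> real) K. u \<in> sobolev_rad R \<phi> k p \<Longrightarrow> X_norm u < K \<Longrightarrow>
     AE x in leb_n. \<bar>u x\<bar> \<le> C * K * norm x powr - b"
proof -
  define \<sigma> where "\<sigma> = measure (cone_measure :: (real^'n) measure) UNIV"
  have "\<sigma> > 0" unfolding \<sigma>_def by (rule cone_measure_pos)
  obtain c where "c > 0" and c: "\<And>(u :: real^'n \<Rightarrow> real) k K. u \<in> smooth_W k p \<Longrightarrow>
     W_norm k p u \<le> K \<Longrightarrow> K > 0 \<Longrightarrow> p \<ge> 1 \<Longrightarrow> ray_chain_bound k p R (c * K) (radial_derivs u)"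
    using smooth_sobolev_ray_chain_bound by blast
  obtain C where "C \<ge> 0" and C: "\<And>(F :: nat \<Rightarrow> real^'n \<Rightarrow> real) K r. ray_chain_bound k p R K F \<Longrightarrow> r \<in> {0<..<R} \<Longrightarrow>
     sphere_L1 (F 0) r \<le> ennreal (C * K * r powr - (real DIM(real^'n) / p - real k))"
    using radial_lemma [OF p R_pos k kb] by blast
  have e: "real DIM(real^'n) / p - real k = b" by (simp add: b_def)
  have "AE x in leb_n. \<bar>u x\<bar> \<le> C * c / \<sigma> * K * norm x powr - b"
    if u: "u \<in> sobolev_rad R \<phi> k p" and K: "X_norm u < K" for u :: "real^'n \<Rightarrow> real" and K
  proof -
    obtain us l v where rep: "represents k p us u" and l: "(\<lambda>n. smooth_norm (us n)) \<longlonglongrightarrow> l"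
      and v: "AE x in leb_n. u x = v (norm x)" and "l < K"
      by (rule sobolev_rad_representation [OF u K])
    have "0 \<le> l" using l by (rule LIMSEQ_le_const) (simp add: smooth_sobolev_norm_nonneg)
    then have "K > 0" using \<open>l < K\<close> by simp
    obtain s where s: "strict_mono (s :: nat \<Rightarrow> nat)" and AE: "AE x in leb_n. (\<lambda>n. us (s n) x) \<longlonglongrightarrow> u x"
      using sobolev_represents_AE_subseq [OF rep] by blast
    have "AE x in leb_n. (\<lambda>n. us (s n) x) \<longlonglongrightarrow> v (norm x)"
      using AE v by eventually_elim simp
    then have "AE x in lborel. x \<in> ball 0 R \<longrightarrow> (\<lambda>n. us (s n) x) \<longlonglongrightarrow> v (norm x)"
      by (simp only: AE_leb_iff)
    then have "AE r in lborel. r \<in> {0<..<R} \<longrightarrow>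
        (AE w in cone_measure. (\<lambda>n. us (s n) (r *\<^sub>R w)) \<longlonglongrightarrow> v (norm (r *\<^sub>R w)))"
      by (rule AE_polar [OF R_pos])
    \<comment> \<open>The bound is proved for the profile \<open>v\<close> at almost every radius
      and carried back to the ball by \<open>AE_radial\<close>.\<close>
    then have "AE r in lborel. r \<in> {0<..<R} \<longrightarrow> \<bar>v r\<bar> \<le> C * c / \<sigma> * K * r powr - b"
    proof eventually_elim
      case (elim r)
      show ?case
      proof
        assume r: "r \<in> {0<..<R}"
        let ?F = "\<lambda>n. radial_derivs (us (s n)) 0"
        have rc: "ray_chain R (radial_derivs (us n))" for n
          using rep by (intro ray_chain_radial_derivs) (auto simp: sobolev_represents_def smooth_sobolev_def)
        note [measurable] = ray_chain_measurable [OF rc]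
        have AE_w: "AE w in cone_measure. (\<lambda>n. ?F n (r *\<^sub>R w)) \<longlonglongrightarrow> v r"
          using elim [rule_format, OF r] AE_cone_measure_norm
        proof eventually_elim
          case (elim w)
          then have "r *\<^sub>R w \<in> punctured" "norm (r *\<^sub>R w) = r" using r by auto
          then show ?case using elim(1) by (simp add: radial_derivs_0)
        qed
        have "ennreal (\<bar>v r\<bar> * \<sigma>) = (\<integral>\<^sup>+w. ennreal \<bar>v r\<bar> \<partial>(cone_measure :: (real^'n) measure))"
          using \<open>\<sigma> > 0\<close> by (simp add: \<sigma>_def cone.emeasure_eq_measure ennreal_mult)
        also have "\<dots> = (\<integral>\<^sup>+w. liminf (\<lambda>n. ennreal \<bar>?F n (r *\<^sub>R w)\<bar>) \<partial>cone_measure)"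
        proof (rule nn_integral_cong_AE)
          show "AE w in cone_measure. ennreal \<bar>v r\<bar> = liminf (\<lambda>n. ennreal \<bar>?F n (r *\<^sub>R w)\<bar>)"
            using AE_w
          proof eventually_elim
            case (elim w)
            then have "(\<lambda>n. ennreal \<bar>?F n (r *\<^sub>R w)\<bar>) \<longlonglongrightarrow> ennreal \<bar>v r\<bar>"
              by (intro tendsto_ennrealI tendsto_rabs)
            then show ?case by (intro lim_imp_Liminf [symmetric]) auto
          qed
        qed
        also have "\<dots> \<le> liminf (\<lambda>n. \<integral>\<^sup>+w. ennreal \<bar>?F n (r *\<^sub>R w)\<bar> \<partial>cone_measure)"
          by (rule nn_integral_liminf) measurable
        also have "\<dots> \<le> liminf (\<lambda>n. ennreal (C * (c * K) * r powr - b))"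
        proof (rule Liminf_mono)
          have "(\<lambda>n. smooth_norm (us (s n))) \<longlonglongrightarrow> l"
            using LIMSEQ_subseq_LIMSEQ [OF l s] by (simp add: o_def)
          then have "eventually (\<lambda>n. smooth_norm (us (s n)) < K) sequentially"
            using \<open>l < K\<close> by (rule order_tendstoD)
          then show "eventually (\<lambda>n. (\<integral>\<^sup>+w. ennreal \<bar>?F n (r *\<^sub>R w)\<bar> \<partial>cone_measure) \<le> ennreal (C * (c * K) * r powr - b)) sequentially"
          proof eventually_elim
            case (elim n)
            have "us (s n) \<in> smooth_W k p"
              using rep by (simp add: sobolev_represents_def)
            from C [OF c [OF this less_imp_le [OF elim] \<open>K > 0\<close> p] r] show ?case
              by (simp only: sphere_L1_def e)
          qed
        qed
        also have "\<dots> = ennreal (C * (c * K) * r powr - b)"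
          by (intro Liminf_const) simp
        finally have "\<bar>v r\<bar> * \<sigma> \<le> C * (c * K) * r powr - b"
          using \<open>C \<ge> 0\<close> \<open>c > 0\<close> \<open>K > 0\<close> by (subst (asm) ennreal_le_iff) auto
        then show "\<bar>v r\<bar> \<le> C * c / \<sigma> * K * r powr - b"
          using \<open>\<sigma> > 0\<close> by (simp add: pos_le_divide_eq mult_ac)
      qed
    qed
    then have "AE x :: real^'n in lborel. x \<in> ball 0 R - {0} \<longrightarrow> \<bar>v (norm x)\<bar> \<le> C * c / \<sigma> * K * norm x powr - b"
      by (rule AE_radial [OF R_pos])
    then have "AE x in leb_n. \<bar>v (norm x)\<bar> \<le> C * c / \<sigma> * K * norm x powr - b"
      by (simp only: AE_leb_punctured_iff)
    with v show ?thesis by eventually_elim simp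
  qed
  moreover have "C * c / \<sigma> \<ge> 0" using \<open>C \<ge> 0\<close> \<open>c > 0\<close> \<open>\<sigma> > 0\<close> by simp
  ultimately show thesis using that by blast
qed

section \<open>The embedding and its compactness\<close>

lemma borel_measurable_vol [simp]: "borel_measurable vol_n = borel_measurable leb_n"
  by (rule measurable_cong_sets) simp_all

lemma sobolev_rad_measurable:
  assumes "u \<in> sobolev_rad R \<phi> k p"
  shows "u \<in> borel_measurable leb_n" "u \<in> lp_space vol_n p"
proof -
  show "u \<in> lp_space vol_n p"
    using assms by (auto simp: sobolev_rad_def sobolev_def sobolev_represents_def)
  then show "u \<in> borel_measurable leb_n" by (simp add: lp_space_def)
qed

text \<open>A negative infimum would produce a sequence of nonnegative norms with a negative
  limit.\<close>

lemma sobolev_norm_nonneg: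
  fixes u :: "real^'n \<Rightarrow> real"
  assumes "u \<in> sobolev_rad R \<phi> k p"
  shows "0 \<le> X_norm u"
proof (rule ccontr)
  assume "\<not> 0 \<le> X_norm u"
  then have "X_norm u < 0" by simp
  then obtain us l v where "(\<lambda>n. smooth_norm (us n)) \<longlonglongrightarrow> l" "l < 0"
    using sobolev_rad_representation [OF assms] by metis
  moreover from this(1) have "0 \<le> l" by (rule LIMSEQ_le_const) (simp add: smooth_sobolev_norm_nonneg)
  ultimately show False by simp
qed

lemma sobolev_rad_subset: "(sobolev_rad R \<phi> k p :: (real^'n \<Rightarrow> real) set) \<subseteq> weighted_space R \<phi> \<theta> q"
proof
  fix u :: "real^'n \<Rightarrow> real" assume u: "u \<in> sobolev_rad R \<phi> k p"
  obtain C where "C \<ge> 0" and C: "\<And>(u :: real^'n \<Rightarrow> real) K. u \<in> sobolev_rad R \<phi> k p \<Longrightarrow> X_norm u < K \<Longrightarrow>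
     AE x in leb_n. \<bar>u x\<bar> \<le> C * K * norm x powr - b"
    using sobolev_rad_pointwise_bound by blast
  have "AE x in leb_n. \<bar>u x\<bar> \<le> C * (X_norm u + 1) * norm x powr - b"
    by (rule C [OF u]) simp
  then show "u \<in> weighted_space R \<phi> \<theta> q"
    using sobolev_rad_measurable(1) [OF u] \<open>C \<ge> 0\<close> sobolev_norm_nonneg [OF u]
    by (intro weighted_norm_le(1) [where A = "C * (X_norm u + 1)"]) auto
qed

lemma sobolev_rad_embedding:
  "\<exists>C. \<forall>u \<in> sobolev_rad R \<phi> k p. weighted_norm R \<phi> \<theta> q u \<le> C * X_norm u"
proof -
  obtain C where "C \<ge> 0" and C: "\<And>(u :: real^'n \<Rightarrow> real) K. u \<in> sobolev_rad R \<phi> k p \<Longrightarrow> X_norm u < K \<Longrightarrow>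
     AE x in leb_n. \<bar>u x\<bar> \<le> C * K * norm x powr - b"
    using sobolev_rad_pointwise_bound by blast
  define J where "J = (\<integral>x. weight x \<partial>vol_n) powr (1 / q)"
  have "J \<ge> 0" by (simp add: J_def)
  have "weighted_norm R \<phi> \<theta> q u \<le> (C * J) * X_norm u" if u: "u \<in> sobolev_rad R \<phi> k p" for u :: "real^'n \<Rightarrow> real"
  proof -
    have le: "weighted_norm R \<phi> \<theta> q u \<le> (C * J) * K" if "X_norm u < K" for K
      using weighted_norm_le(2) [OF sobolev_rad_measurable(1) [OF u] _ C [OF u that]] \<open>C \<ge> 0\<close> that sobolev_norm_nonneg [OF u]
      by (simp add: J_def mult_ac)
    \<comment> \<open>K is let down to \<open>X_norm u\<close>. The case of a vanishing constant is
      split off because the limit is taken after division by it.\<close>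
    show ?thesis
    proof (cases "C * J = 0")
      case True
      then show ?thesis using le [of "X_norm u + 1"] unfolding True by simp
    next
      case False
      then have pos: "C * J > 0" using \<open>C \<ge> 0\<close> \<open>J \<ge> 0\<close> by (simp add: less_le)
      have "weighted_norm R \<phi> \<theta> q u / (C * J) \<le> X_norm u"
        by (rule dense_ge) (use le pos in \<open>simp add: pos_divide_le_eq mult.commute\<close>)
      then show ?thesis using pos by (simp add: pos_divide_le_eq mult.commute)
    qed
  qed
  then show ?thesis by blast
qed

lemma smooth_approximation:
  fixes u :: "real^'n \<Rightarrow> real"
  assumes u: "u \<in> sobolev_rad R \<phi> k p" "X_norm u < K" and "\<epsilon> > 0"
  shows "\<exists>U v. U \<in> smooth_W k p \<and> smooth_norm U \<le> K \<and>
     lp_norm vol_n p (\<lambda>x. U x - u x) \<le> \<epsilon> \<and> (AE x in leb_n. u x = v (norm x))"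
proof -
  obtain us l v where us: "represents k p us u" and l: "(\<lambda>n. smooth_norm (us n)) \<longlonglongrightarrow> l"
    "l < K" and v: "AE x in leb_n. u x = v (norm x)"
    by (rule sobolev_rad_representation [OF u])
  have "eventually (\<lambda>n. lp_norm vol_n p (\<lambda>x. us n x - u x) < \<epsilon>) sequentially"
    using us \<open>\<epsilon> > 0\<close> by (intro order_tendstoD(2) [where y = 0]) (auto simp: sobolev_represents_def)
  moreover have "eventually (\<lambda>n. smooth_norm (us n) < K) sequentially"
    by (rule order_tendstoD(2) [OF l])
  ultimately have "eventually (\<lambda>n. lp_norm vol_n p (\<lambda>x. us n x - u x) < \<epsilon> \<and> smooth_norm (us n) < K) sequentially"
    by (rule eventually_conj)
  then obtain n where "lp_norm vol_n p (\<lambda>x. us n x - u x) < \<epsilon>" "smooth_norm (us n) < K"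
    by (auto simp: eventually_sequentially)
  moreover have "us n \<in> smooth_W k p"
    using us by (simp add: sobolev_represents_def)
  ultimately show ?thesis using v by (intro exI [of _ "us n"] exI [of _ v]) auto
qed

text \<open>The \<open>L\<^sup>1\<close> distances on the ball are O(2^(-m)), hence summable. By
  monotone convergence the sum over m of the means of the differences is finite on almost every
  sphere, so these means tend to 0 along the whole sequence and therefore along any subsequence
  chosen by Helly's theorem.\<close>

lemma sphere_means_close:
  fixes us Us :: "nat \<Rightarrow> real^'n \<Rightarrow> real"
  assumes us: "\<And>m. us m \<in> lp_space vol_n p" and v: "\<And>m. AE x in leb_n. us m x = v m (norm x)"
    and U: "\<And>m. Us m \<in> smooth_W k p"
    and close: "\<And>m. lp_norm vol_n p (\<lambda>x. Us m x - us m x) \<le> (1 / 2) ^ m"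
  shows "AE r in lborel. r \<in> {0<..<R} \<longrightarrow>
    (\<lambda>m. sphere_integral (radial_derivs (Us m) 0) r - measure (cone_measure :: (real^'n) measure) UNIV * v m r) \<longlonglongrightarrow> 0"
proof -
  define \<sigma> where "\<sigma> = measure (cone_measure :: (real^'n) measure) UNIV"
  let ?F = "\<lambda>m. radial_derivs (Us m) 0"
  have [measurable]: "us m \<in> borel_measurable leb_n" for m using us [of m] by (simp add: lp_space_def)
  have rc: "ray_chain R (radial_derivs (Us m))" for m
    using U [of m] by (intro ray_chain_radial_derivs) (simp add: smooth_sobolev_def)
  note [measurable] = ray_chain_measurable [OF rc]
  \<comment> \<open>Borel representatives, so that the polar formula applies to the differences
    \<open>D m\<close>.\<close>
  have "\<exists>u'. u' \<in> borel_measurable borel \<and> (AE x in leb_n. us m x = u' x)" for m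
    using borel_representative [of "us m" "ball 0 R"] by (metis borel_open open_ball \<open>\<And>m. us m \<in> borel_measurable leb_n\<close>)
  then obtain u' where u' [measurable]: "\<And>m. u' m \<in> borel_measurable borel" and u'_eq: "\<And>m. AE x in leb_n. us m x = u' m x"
    by metis
  obtain D1 where "0 < D1" and D1: "\<And>f :: real^'n \<Rightarrow> ennreal. f \<in> borel_measurable leb \<Longrightarrow>
       (\<integral>\<^sup>+x. f x \<partial>leb) \<le> ennreal D1 * (\<integral>\<^sup>+x. f x \<partial>vol_measure)"
    using nn_integral_lebesgue_le_vol by blast
  define D where "D m x = ?F m x - u' m x" for m x
  have [measurable]: "D m \<in> borel_measurable borel" for m unfolding D_def by measurable
  define c where "c = D1 powr (1 / p)"
  have "c > 0" using \<open>0 < D1\<close> by (simp add: c_def)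
  have Dp: "(\<integral>\<^sup>+x\<in>ball 0 R. ennreal (\<bar>D m x\<bar> powr p) \<partial>lborel) \<le> ennreal ((c * (1 / 2) ^ m) powr p)" for m
  proof -
    have d: "(\<lambda>x. Us m x - us m x) \<in> lp_space vol_n p"
      by (rule lp_space_diff [OF p smooth_sobolev_lp [OF U] us])
    then have [measurable]: "(\<lambda>x. Us m x - us m x) \<in> borel_measurable leb_n" by (simp add: lp_space_def)
    have "(\<integral>\<^sup>+x\<in>ball 0 R. ennreal (\<bar>D m x\<bar> powr p) \<partial>lborel) = (\<integral>\<^sup>+x. ennreal (\<bar>D m x\<bar> powr p) \<partial>leb_n)"
      by (rule nn_integral_lebesgue_on [symmetric]) simp_all
    also have "\<dots> = (\<integral>\<^sup>+x. ennreal (\<bar>Us m x - us m x\<bar> powr p) \<partial>leb_n)"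
      by (rule nn_integral_cong_AE, use u'_eq [of m] AE_lebesgue_on_punctured in eventually_elim)
        (simp add: D_def radial_derivs_0)
    also have "\<dots> \<le> ennreal D1 * (\<integral>\<^sup>+x. ennreal (\<bar>Us m x - us m x\<bar> powr p) \<partial>vol_n)"
      by (rule D1) measurable
    also have "(\<integral>\<^sup>+x. ennreal (\<bar>Us m x - us m x\<bar> powr p) \<partial>vol_n) = ennreal (\<integral>x. \<bar>Us m x - us m x\<bar> powr p \<partial>vol_n)"
      using d by (intro nn_integral_eq_integral) (auto simp: lp_space_def)
    also have "ennreal D1 * \<dots> \<le> ennreal D1 * ennreal (((1 / 2) ^ m) powr p)"
      by (intro mult_left_mono ennreal_leI integral_le_of_lp_norm_le [OF p close]) simp
    also have "\<dots> = ennreal ((c * (1 / 2) ^ m) powr p)"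
      using \<open>0 < D1\<close> p by (simp add: c_def powr_mult powr_powr flip: ennreal_mult)
    finally show ?thesis .
  qed
  define M where "M = (measure lborel (ball (0 :: real^'n) R) + 1) * c"
  have "M \<ge> 0" using \<open>c > 0\<close> by (simp add: M_def)
  have D_L1: "(\<integral>\<^sup>+x\<in>ball 0 R. ennreal \<bar>D m x\<bar> \<partial>lborel) \<le> ennreal (M * (1 / 2) ^ m)" for m
    using nn_integral_ball_le [OF _ p _ Dp [of m]] \<open>c > 0\<close> by (simp add: M_def mult.assoc)
  define W where "W r = real DIM(real^'n) * r ^ (DIM(real^'n) - 1)" for r
  \<comment> \<open>The polar weight is included, so that the integral of \<open>X m\<close> over
    the radii is the \<open>L\<^sup>1\<close> norm of \<open>D m\<close> on the ball.\<close>
  define X where "X m r = ennreal (W r) * sphere_L1 (D m) r * indicator {0<..<R} r" for m r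
  have [measurable]: "X m \<in> borel_measurable borel" for m unfolding X_def W_def by measurable
  have "(\<integral>\<^sup>+r. X m r \<partial>lborel) \<le> ennreal (M * (1 / 2) ^ m)" for m
    using D_L1 [of m] R_pos unfolding X_def W_def sphere_L1_def by (subst (asm) nn_integral_polar) simp_all
  then have "(\<Sum>m. \<integral>\<^sup>+r. X m r \<partial>lborel) \<le> (\<Sum>m. ennreal (M * (1 / 2) ^ m))"
    by (intro suminf_le) auto
  also have "\<dots> = ennreal (\<Sum>m. M * (1 / 2) ^ m)"
    using \<open>M \<ge> 0\<close> by (intro suminf_ennreal2 summable_mult summable_geometric) auto
  finally have "(\<integral>\<^sup>+r. (\<Sum>m. X m r) \<partial>lborel) \<noteq> \<infinity>"
    by (subst nn_integral_suminf) (auto simp: top_unique)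
  then have "AE r in lborel. (\<Sum>m. X m r) \<noteq> \<infinity>"
    by (intro nn_integral_PInf_AE) measurable
  moreover have "AE r in lborel. r \<in> {0<..<R} \<longrightarrow> (AE w in cone_measure. \<forall>m. u' m (r *\<^sub>R w) = v m (norm (r *\<^sub>R w)))"
  proof (rule AE_polar [OF R_pos])
    have "AE x in leb_n. \<forall>m. u' m x = v m (norm x)"
      unfolding AE_all_countable
    proof
      fix m show "AE x in leb_n. u' m x = v m (norm x)"
        using v [of m] u'_eq [of m] by eventually_elim simp
    qed
    then show "AE x in lborel. x \<in> ball 0 R \<longrightarrow> (\<forall>m. u' m x = v m (norm x))"
      by (simp only: AE_leb_iff)
  qed
  ultimately show ?thesis
  proof eventually_elim
    case (elim r)
    show ?case unfolding \<sigma>_def [symmetric]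
    proof
      assume r: "r \<in> {0<..<R}"
      have w: "W r > 0" using r by (simp add: W_def)
      have "(\<Sum>m. X m r) < \<infinity>" using elim(1) by (simp add: less_top)
      note X0 = ennreal_suminf_imp_tendsto_0 [OF this]
      have le: "\<bar>sphere_integral (?F m) r - \<sigma> * v m r\<bar> \<le> enn2real (X m r) / W r" for m
      proof -
        have X_eq: "X m r = ennreal (W r) * sphere_L1 (D m) r" using r by (simp add: X_def)
        have fin: "sphere_L1 (D m) r < \<infinity>"
        proof -
          have "ennreal (W r) * sphere_L1 (D m) r < \<infinity>" using X0(2) [of m] X_eq by simp
          then show ?thesis using w by (auto simp: ennreal_mult_less_top)
        qed
        have int: "integrable cone_measure (\<lambda>w. D m (r *\<^sub>R w))"
          by (rule integrableI_bounded) (use fin in \<open>simp_all add: sphere_L1_def\<close>)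
        have AE: "AE w in cone_measure. ?F m (r *\<^sub>R w) = D m (r *\<^sub>R w) + v m r"
          using elim(2) [rule_format, OF r] AE_cone_measure_norm
          by eventually_elim (use r in \<open>simp add: D_def\<close>)
        have "sphere_integral (?F m) r = (\<integral>w. D m (r *\<^sub>R w) + v m r \<partial>cone_measure)"
          unfolding sphere_integral_def by (rule integral_cong_AE [OF _ _ AE]) measurable
        also have "\<dots> = (\<integral>w. D m (r *\<^sub>R w) \<partial>cone_measure) + \<sigma> * v m r"
          using int by (simp add: \<sigma>_def)
        finally have "ennreal \<bar>sphere_integral (?F m) r - \<sigma> * v m r\<bar> \<le> sphere_L1 (D m) r"
          using integral_norm_bound_ennreal [OF int] by (simp add: sphere_L1_def)
        then have "ennreal (W r) * ennreal \<bar>sphere_integral (?F m) r - \<sigma> * v m r\<bar> \<le> X m r"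
          unfolding X_eq by (rule mult_left_mono) simp
        then have "ennreal (W r * \<bar>sphere_integral (?F m) r - \<sigma> * v m r\<bar>) \<le> ennreal (enn2real (X m r))"
          using X0(2) [of m] w by (simp add: ennreal_mult less_top)
        then have "W r * \<bar>sphere_integral (?F m) r - \<sigma> * v m r\<bar> \<le> enn2real (X m r)"
          by (subst (asm) ennreal_le_iff) auto
        then show ?thesis using w by (simp add: pos_le_divide_eq mult.commute)
      qed
      have "(\<lambda>m. enn2real (X m r) / W r) \<longlonglongrightarrow> 0"
        using X0(1) by (rule tendsto_divide_zero)
      then show "(\<lambda>m. sphere_integral (?F m) r - \<sigma> * v m r) \<longlonglongrightarrow> 0"
        by (rule Lim_null_comparison [rotated]) (simp add: le)
    qed
  qed
qed

lemma weighted_norm_dominated_convergence: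
  fixes us :: "nat \<Rightarrow> real^'n \<Rightarrow> real"
  assumes us [measurable]: "\<And>n. us n \<in> borel_measurable leb_n" and u [measurable]: "u \<in> borel_measurable leb_n"
    and "A \<ge> 0" and bound: "\<And>n. AE x in leb_n. \<bar>us n x\<bar> \<le> A * norm x powr - b"
    and lim: "AE x in leb_n. (\<lambda>n. us n x) \<longlonglongrightarrow> u x"
  shows "u \<in> weighted_space R \<phi> \<theta> q" "(\<lambda>n. weighted_norm R \<phi> \<theta> q (\<lambda>x. us n x - u x)) \<longlonglongrightarrow> 0"
proof -
  have all: "AE x in leb_n. \<forall>n. \<bar>us n x\<bar> \<le> A * norm x powr - b"
    using bound by (simp add: AE_all_countable)
  have ub: "AE x in leb_n. \<bar>u x\<bar> \<le> A * norm x powr - b"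
    using all lim
  proof eventually_elim
    case (elim x)
    have "(\<lambda>n. \<bar>us n x\<bar>) \<longlonglongrightarrow> \<bar>u x\<bar>" using elim(2) by (rule tendsto_rabs)
    then show ?case using elim(1) by (intro LIMSEQ_le_const2) auto
  qed
  show "u \<in> weighted_space R \<phi> \<theta> q"
    by (rule weighted_norm_le(1) [OF u \<open>A \<ge> 0\<close> ub])
  let ?f = "\<lambda>n x. \<bar>us n x - u x\<bar> powr q * \<phi> (norm x) powr \<theta>"
  \<comment> \<open>The limit inherits the pointwise bound, so the differences are dominated with 2
    * A in place of A.\<close>
  have "(\<lambda>n. \<integral>x. ?f n x \<partial>vol_n) \<longlonglongrightarrow> (\<integral>x. 0 \<partial>vol_n)"
  proof (rule integral_dominated_convergence)
    show "integrable vol_n (\<lambda>x. (2 * A) powr q * weight x)"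
      by (intro integrable_mult_right weight_integrable)
    show "AE x in vol_n. (\<lambda>n. ?f n x) \<longlonglongrightarrow> 0"
      unfolding AE_vol_iff using lim
    proof eventually_elim
      case (elim x)
      then have "(\<lambda>n. us n x - u x) \<longlonglongrightarrow> 0" by (rule LIM_zero)
      then have "(\<lambda>n. \<bar>us n x - u x\<bar>) \<longlonglongrightarrow> 0" by (rule tendsto_rabs_zero)
      then have "(\<lambda>n. \<bar>us n x - u x\<bar> powr q) \<longlonglongrightarrow> 0 powr q"
        using q by (intro tendsto_powr' tendsto_const) auto
      then show ?case by (intro tendsto_mult_left_zero) simp
    qed
    show "AE x in vol_n. norm (?f n x) \<le> (2 * A) powr q * weight x" for n
      unfolding AE_vol_iff using all ub
    proof eventually_elim
      case (elim x)
      have "\<bar>us n x - u x\<bar> \<le> \<bar>us n x\<bar> + \<bar>u x\<bar>" by simp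
      also have "\<dots> \<le> 2 * A * norm x powr - b" using elim(1) [rule_format, of n] elim(2) by linarith
      finally have "\<bar>us n x - u x\<bar> powr q \<le> (2 * A * norm x powr - b) powr q"
        using q by (intro powr_mono2) auto
      also have "\<dots> = (2 * A) powr q * norm x powr (- b * q)"
        using \<open>A \<ge> 0\<close> by (simp add: powr_mult powr_powr)
      finally have "\<bar>us n x - u x\<bar> powr q * \<phi> (norm x) powr \<theta> \<le> (2 * A) powr q * norm x powr (- b * q) * \<phi> (norm x) powr \<theta>"
        by (rule mult_right_mono) simp
      then show ?case by (simp add: weight_def mult_ac)
    qed
  qed measurable
  then have "(\<lambda>n. (\<integral>x. ?f n x \<partial>vol_n) powr (1 / q)) \<longlonglongrightarrow> 0 powr (1 / q)"
    using q by (intro tendsto_powr' tendsto_const) (auto intro!: always_eventually integral_nonneg_AE)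
  then show "(\<lambda>n. weighted_norm R \<phi> \<theta> q (\<lambda>x. us n x - u x)) \<longlonglongrightarrow> 0"
    by (simp add: weighted_norm_def)
qed

lemma sobolev_rad_compact:
  fixes us :: "nat \<Rightarrow> real^'n \<Rightarrow> real"
  assumes us: "\<And>n. us n \<in> sobolev_rad R \<phi> k p" and B: "\<And>n. X_norm (us n) \<le> B"
  shows "\<exists>s v. strict_mono (s :: nat \<Rightarrow> nat) \<and> v \<in> weighted_space R \<phi> \<theta> q \<and>
    (\<lambda>n. weighted_norm R \<phi> \<theta> q (\<lambda>x. us (s n) x - v x)) \<longlonglongrightarrow> 0"
proof -
  \<comment> \<open>One more than \<open>B\<close>, for the strict bounds on the norm.\<close>
  define K where "K = B + 1"
  have K: "X_norm (us n) < K" for n using B [of n] by (simp add: K_def)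
  have "K > 0" using K [of 0] sobolev_norm_nonneg [OF us [of 0]] by simp
  obtain C where "C \<ge> 0" and C: "\<And>(u :: real^'n \<Rightarrow> real) K. u \<in> sobolev_rad R \<phi> k p \<Longrightarrow> X_norm u < K \<Longrightarrow>
     AE x in leb_n. \<bar>u x\<bar> \<le> C * K * norm x powr - b"
    using sobolev_rad_pointwise_bound by blast
  have "\<forall>n. \<exists>U v. U \<in> smooth_W k p \<and> smooth_norm U \<le> K \<and>
     lp_norm vol_n p (\<lambda>x. U x - us n x) \<le> (1 / 2) ^ n \<and> (AE x in leb_n. us n x = v (norm x))"
    using smooth_approximation [OF us K] by simp
  from choice [OF this] obtain Us where "\<forall>n. \<exists>v. Us n \<in> smooth_W k p \<and> smooth_norm (Us n) \<le> K \<and>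
     lp_norm vol_n p (\<lambda>x. Us n x - us n x) \<le> (1 / 2) ^ n \<and> (AE x in leb_n. us n x = v (norm x))" by blast
  from choice [OF this] obtain v where Us: "\<forall>n. Us n \<in> smooth_W k p \<and> smooth_norm (Us n) \<le> K \<and>
     lp_norm vol_n p (\<lambda>x. Us n x - us n x) \<le> (1 / 2) ^ n \<and> (AE x in leb_n. us n x = v n (norm x))" by blast
  then have U: "\<And>n. Us n \<in> smooth_W k p" "\<And>n. smooth_norm (Us n) \<le> K"
    and close: "\<And>n. lp_norm vol_n p (\<lambda>x. Us n x - us n x) \<le> (1 / 2) ^ n"
    and v: "\<And>n. AE x in leb_n. us n x = v n (norm x)"
    by auto
  obtain c where "c > 0" and c: "\<And>(u :: real^'n \<Rightarrow> real) k K. u \<in> smooth_W k p \<Longrightarrow>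
     W_norm k p u \<le> K \<Longrightarrow> K > 0 \<Longrightarrow> p \<ge> 1 \<Longrightarrow> ray_chain_bound k p R (c * K) (radial_derivs u)"
    using smooth_sobolev_ray_chain_bound by blast
  define \<sigma> where "\<sigma> = measure (cone_measure :: (real^'n) measure) UNIV"
  have "\<sigma> > 0" unfolding \<sigma>_def by (rule cone_measure_pos)
  have rcb: "ray_chain_bound k p R (c * K) (radial_derivs (Us m))" for m
    by (rule c [OF U \<open>K > 0\<close> p])
  obtain \<tau> H where \<tau>: "strict_mono (\<tau> :: nat \<Rightarrow> nat)"
    and H: "AE r in lborel. r \<in> {0<..<R} \<longrightarrow> (\<lambda>m. sphere_integral (radial_derivs (Us (\<tau> m)) 0) r) \<longlonglongrightarrow> H r"
    by (rule sphere_integral_compact [OF p R_pos k kb rcb])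
  \<comment> \<open>The means of the approximants converge by Helly's theorem and are asymptotic to
    \<sigma> times the profiles, so the profiles converge too.\<close>
  have "AE r in lborel. r \<in> {0<..<R} \<longrightarrow> (\<lambda>m. v (\<tau> m) r) \<longlonglongrightarrow> H r / \<sigma>"
    using H sphere_means_close [OF sobolev_rad_measurable(2) [OF us] v U(1) close]
  proof eventually_elim
    case (elim r)
    show ?case
    proof
      assume r: "r \<in> {0<..<R}"
      let ?A = "\<lambda>m. sphere_integral (radial_derivs (Us m) 0) r"
      have "(\<lambda>m. ?A (\<tau> m) - \<sigma> * v (\<tau> m) r) \<longlonglongrightarrow> 0"
        using LIMSEQ_subseq_LIMSEQ [OF _ \<tau>, of "\<lambda>m. ?A m - \<sigma> * v m r"] elim(2) r by (simp add: \<sigma>_def o_def)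
      then have "(\<lambda>m. ?A (\<tau> m) - (?A (\<tau> m) - \<sigma> * v (\<tau> m) r)) \<longlonglongrightarrow> H r - 0"
        using elim(1) r by (intro tendsto_diff) auto
      then have "(\<lambda>m. (\<sigma> * v (\<tau> m) r) / \<sigma>) \<longlonglongrightarrow> H r / \<sigma>"
        using \<open>\<sigma> > 0\<close> by (intro tendsto_divide) auto
      then show "(\<lambda>m. v (\<tau> m) r) \<longlonglongrightarrow> H r / \<sigma>"
        using \<open>\<sigma> > 0\<close> by simp
    qed
  qed
  then have "AE x :: real^'n in lborel. x \<in> ball 0 R - {0} \<longrightarrow> (\<lambda>m. v (\<tau> m) (norm x)) \<longlonglongrightarrow> H (norm x) / \<sigma>"
    by (rule AE_radial [OF R_pos])
  then have lim1: "AE x in leb_n. (\<lambda>m. v (\<tau> m) (norm x)) \<longlonglongrightarrow> H (norm x) / \<sigma>"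
    by (simp only: AE_leb_punctured_iff)
  have "AE x in leb_n. \<forall>m. us m x = v m (norm x)"
    using v by (simp add: AE_all_countable)
  with lim1 have lim2: "AE x in leb_n. (\<lambda>m. us (\<tau> m) x) \<longlonglongrightarrow> H (norm x) / \<sigma>"
    by eventually_elim simp
  note [measurable] = sobolev_rad_measurable(1) [OF us]
  \<comment> \<open>\<open>H\<close> comes from a selection theorem without any claim of
    measurability; a pointwise limit of measurable functions is measurable by construction.\<close>
  define u where "u x = lim (\<lambda>m. us (\<tau> m) x)" for x
  have u [measurable]: "u \<in> borel_measurable leb_n" unfolding u_def by measurable
  have lim: "AE x in leb_n. (\<lambda>m. us (\<tau> m) x) \<longlonglongrightarrow> u x"
    using lim2 by eventually_elim (simp add: u_def limI)
  have CK: "C * K \<ge> 0" using \<open>C \<ge> 0\<close> \<open>K > 0\<close> by simp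
  show ?thesis
    using weighted_norm_dominated_convergence [OF sobolev_rad_measurable(1) [OF us] u CK C [OF us K] lim] \<tau>
    by blast
qed

theorem compact_embedding_sobolev_rad:
  "compact_embedding (sobolev_rad R \<phi> k p :: (real^'n \<Rightarrow> real) set) X_norm
     (weighted_space R \<phi> \<theta> q) (weighted_norm R \<phi> \<theta> q)"
  unfolding compact_embedding_def
  using sobolev_rad_subset sobolev_rad_embedding sobolev_rad_compact by blast

end

theorem corollary1p1:
  fixes \<phi> :: "real \<Rightarrow> real" and R p q \<theta> :: real and k :: nat
  assumes "CARD('n::finite) \<ge> 2"
    and "R > 0" and "warping_function R \<phi>"
    and "p \<ge> 1" and "k \<ge> 1"
    and "\<And>j. \<exists>l>0. (deriv_within {0..<R} j \<phi> \<longlongrightarrow> l) (at_left R)"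
    and "real CARD('n) > real k * p" and "\<theta> \<ge> 0"
    and "1 \<le> q" and "q < (\<theta> + real CARD('n)) * p / (real CARD('n) - real k * p)"
  shows "compact_embedding
           (sobolev_rad R \<phi> k p :: (real^'n \<Rightarrow> real) set)
           (sobolev_norm (ball 0 R) (warped_metric \<phi>) k p)
           (weighted_space R \<phi> \<theta> q)
           (weighted_norm R \<phi> \<theta> q)"
proof -
  \<comment> \<open>The positive limit of \<phi> itself, which keeps \<phi>(r) / r away from 0 and
    \<infinity> up to the boundary.\<close>
  have "\<exists>l>0. (\<phi> \<longlongrightarrow> l) (at_left R)" using assms(6) [of 0] by simp
  then interpret radial_embedding \<phi> R p q \<theta> k "TYPE('n)"
    using assms by unfold_locales
  show ?thesis by (rule compact_embedding_sobolev_rad)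
qed

end
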